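(* Let $R$ be a commutative algebra over a field $\Bbbk$ of characteristic zero, and $f$ a nonzero element of $R$. Let $\mathcal F^\bullet$ be a filtration on $D_{R|\Bbbk}$ that is linearly dominated by the order filtration. Suppose that $(D_{R|\Bbbk},\mathcal F^\bullet)$ is linearly simple with finite dimension and finite positive multiplicity. Set $\widetilde{\mathcal F}^i=\Bbbk(s)\otimes_\Bbbk\mathcal F^i$ for all $i$. If $R$ is holonomic as a $D_{R|\Bbbk}$-module, then $R_f(s)\boldsymbol{f^s}$ is a holonomic $(D_{R(s)|\Bbbk(s)},\widetilde{\mathcal F}^\bullet)$-module.
   Context: Differential operators: for a commutative algebra $R$ over a field $\Bbbk$, $D^0_{R|\Bbbk}$ is the set of multiplications by elements of $R$; $D^i_{R|\Bbbk}=\{\delta\in\operatorname{End}_\Bbbk(R):[\delta,r]\in D^{i-1}_{R|\Bbbk}\ \forall r\in R\}$ for $i>0$; $D_{R|\Bbbk}=\bigcup_iD^i_{R|\Bbbk}$; $\operatorname{ord}(\delta)$ is the least $i$ with $\delta\in D^i_{R|\Bbbk}$. A filtration on a $\Bbbk$-algebra $A$ is an ascending exhaustive sequence $(\mathcal F^i)_{i\in\mathbb N}$ of finite-dimensional $\Bbbk$-subspaces with $\mathcal F^0=\Bbbk$ and $\mathcal F^i\mathcal F^j\subseteq\mathcal F^{i+j}$. A filtration $\mathcal F^\bullet$ on $D_{R|\Bbbk}$ is linearly dominated by the order filtration if there is a positive integer $C$ with $\mathcal F^i\subseteq D^{Ci}_{R|\Bbbk}$ for all $i$. A filtration on a left $A$-module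 compatible with $\mathcal F^\bullet$ is an ascending exhaustive sequence of finite-dimensional subspaces $\mathcal G^i$ ($i\in\mathbb N$) with $\mathcal F^i\mathcal G^j\subseteq\mathcal G^{i+j}$. $\operatorname{Dim}(\mathcal G^\bullet)=\inf\{t\ge0:\exists C,\ \dim_\Bbbk\mathcal G^i\le Ci^t\ \forall i\gg0\}$; if $d=\operatorname{Dim}(\mathcal G^\bullet)<\infty$, the multiplicity is $\operatorname e(\mathcal G^\bullet)=\limsup_i\dim_\Bbbk\mathcal G^i/i^d$. The dimension and multiplicity of $(A,\mathcal F^\bullet)$ are those of $\mathcal F^\bullet$. $(A,\mathcal F^\bullet)$ is linearly simple if there is a positive integer $C$ such that $1\in\mathcal F^{Ci}\,\delta\,\mathcal F^{Ci}$ for all $i\in\mathbb N$ and all nonzero $\delta\in\mathcal F^i$. For linearly simple $(A,\mathcal F^\bullet)$ of finite dimension and positive finite multiplicity, a nonzero $A$-module is holonomic if it admits a compatible filtration of dimension $\frac12\operatorname{Dim}(\mathcal F^\bullet)$ and finite multiplicity; the zero module is holonomic by convention. The same notions apply over the field $\Bbbk(s)$; being a holonomic $(D_{R(s)|\Bbbk(s)},\widetilde{\mathcal F}^\bullet)$-module includes that $(D_{R(s)|\Bbbk(s)},\widetilde{\mathcal F}^\bullet)$ is a linearly simple filtered $\Bbbk(s)$-algebra of finite dimension and positive finite multiplicity. Let $s$ be an indeterminate, $R(s)=R\otimes_\Bbbk\Bbbk(s)$, $R_f(s)=R_f\otimes_\Bbbk\Bbbk(s)$. The space $\widetilde{\mathcal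 F}^i$ is regarded inside $D_{R(s)|\Bbbk(s)}$ through the natural map $D_{R|\Bbbk}\otimes_\Bbbk\Bbbk(s)\to D_{R(s)|\Bbbk(s)}$ (which is an order-preserving isomorphism when $R$ is finitely generated over $\Bbbk$). $R_f(s)\boldsymbol{f^s}$ is the free $R_f(s)$-module of rank one on the formal symbol $\boldsymbol{f^s}$, on which $\delta\in D_{R(s)|\Bbbk(s)}$ acts by $\delta\cdot a(s)\boldsymbol{f^s}=\sum_{i=0}^{\operatorname{ord}(\delta)}\binom si f^{-i}\delta^{(i)}(a(s))\boldsymbol{f^s}$, where $\delta^{(0)}=\delta$, $\delta^{(i)}=[\delta^{(i-1)},f]$, $\binom si=s(s-1)\cdots(s-i+1)/i!$, and differential operators act on the localization at $f$ by the standard extension, determined inductively on the order by $\delta(v/f^t)=\big(\delta(v)-[\delta,f^t](v/f^t)\big)/f^t$. *)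

theory Defs
  imports
    Complex_Main
    "HOL-Library.Function_Algebras"
    "HOL-Library.Poly_Mapping"
    "HOL-Library.Extended_Real"
    "HOL-Library.Liminf_Limsup"
    "HOL-Computational_Algebra.Polynomial"
    "HOL-Computational_Algebra.Fraction_Field"
begin

text \<open>
  Conventions. The sort \<open>{comm_ring, comm_monoid_mult}\<close> is that of commutative unital rings in
  which \<open>0 = 1\<close> is allowed; it is needed because \<open>R\<^sub>f\<close> is the zero ring when \<open>f\<close> is nilpotent.
  An algebra (or vector space) over a field is given by its scalar multiplication \<open>sc\<close>; linear
  maps, subspaces, spans and dimensions are those of \<^theory>\<open>HOL.Modules\<close> and
  \<^theory>\<open>HOL.Vector_Spaces\<close> for that scalar multiplication.
  Operators are added pointwise, and the product of two operators is their composition.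
\<close>

definition comm_algebra ::
  "('k::field \<Rightarrow> 'r::{comm_ring,comm_monoid_mult} \<Rightarrow> 'r) \<Rightarrow> bool" where
  "comm_algebra sc \<longleftrightarrow> vector_space sc \<and> (\<forall>a x y. sc a x * y = sc a (x * y))"

definition op_scale :: "('k \<Rightarrow> 'r \<Rightarrow> 'r) \<Rightarrow> 'k \<Rightarrow> ('r \<Rightarrow> 'r) \<Rightarrow> ('r \<Rightarrow> 'r)" where
  "op_scale sc a \<delta> = (\<lambda>x. sc a (\<delta> x))"


section \<open>Differential operators\<close>

text \<open>\<open>op_comm \<delta> r\<close> is the commutator \<open>[\<delta>, r]\<close> of \<open>\<delta>\<close> with the multiplication by \<open>r\<close>.\<close>

definition op_comm :: "('r \<Rightarrow> 'r) \<Rightarrow> 'r \<Rightarrow> ('r \<Rightarrow> 'r::{comm_ring,comm_monoid_mult})" where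
  "op_comm \<delta> r = (\<lambda>x. \<delta> (r * x) - r * \<delta> x)"

primrec diff_ops_le ::
  "('k::field \<Rightarrow> 'r::{comm_ring,comm_monoid_mult} \<Rightarrow> 'r) \<Rightarrow> nat \<Rightarrow> ('r \<Rightarrow> 'r) set" where
  "diff_ops_le sc 0 = {\<delta>. \<exists>r. \<delta> = (\<lambda>x. r * x)}"
| "diff_ops_le sc (Suc i) =
     {\<delta>. Vector_Spaces.linear sc sc \<delta> \<and> (\<forall>r. op_comm \<delta> r \<in> diff_ops_le sc i)}"

definition diff_ops ::
  "('k::field \<Rightarrow> 'r::{comm_ring,comm_monoid_mult} \<Rightarrow> 'r) \<Rightarrow> ('r \<Rightarrow> 'r) set" where
  "diff_ops sc = (\<Union>i. diff_ops_le sc i)"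

definition op_order ::
  "('k::field \<Rightarrow> 'r::{comm_ring,comm_monoid_mult} \<Rightarrow> 'r) \<Rightarrow> ('r \<Rightarrow> 'r) \<Rightarrow> nat" where
  "op_order sc \<delta> = (LEAST i. \<delta> \<in> diff_ops_le sc i)"


section \<open>Filtrations, dimension and multiplicity\<close>

definition fin_dim_subspace :: "('k::field \<Rightarrow> 'v::ab_group_add \<Rightarrow> 'v) \<Rightarrow> 'v set \<Rightarrow> bool" where
  "fin_dim_subspace sc V \<longleftrightarrow> (\<exists>B. finite B \<and> V = module.span sc B)"

text \<open>
  Filtrations on a \<open>k\<close>-algebra \<open>A\<close> of operators; the base field is identified with the
  operators \<open>sc a\<close>. As \<open>F (i + j)\<close> is a subspace, it contains \<open>F i F j\<close> as soon as it contains
  all products of an element of \<open>F i\<close> and an element of \<open>F j\<close>.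
\<close>

definition alg_filtration ::
  "('k::field \<Rightarrow> 'r::{comm_ring,comm_monoid_mult} \<Rightarrow> 'r) \<Rightarrow> ('r \<Rightarrow> 'r) set
    \<Rightarrow> (nat \<Rightarrow> ('r \<Rightarrow> 'r) set) \<Rightarrow> bool" where
  "alg_filtration sc A F \<longleftrightarrow>
     (\<forall>i. fin_dim_subspace (op_scale sc) (F i)) \<and>
     mono F \<and> (\<Union>i. F i) = A \<and>
     F 0 = range sc \<and>
     (\<forall>i j. \<forall>\<alpha>\<in>F i. \<forall>\<beta>\<in>F j. \<alpha> \<circ> \<beta> \<in> F (i + j))"

definition linearly_dominated ::
  "('k::field \<Rightarrow> 'r::{comm_ring,comm_monoid_mult} \<Rightarrow> 'r) \<Rightarrow> (nat \<Rightarrow> ('r \<Rightarrow> 'r) set) \<Rightarrow> bool" where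
  "linearly_dominated sc F \<longleftrightarrow> (\<exists>C>0. \<forall>i. F i \<subseteq> diff_ops_le sc (C * i))"

definition linearly_simple ::
  "('k::field \<Rightarrow> 'r::{comm_ring,comm_monoid_mult} \<Rightarrow> 'r) \<Rightarrow> (nat \<Rightarrow> ('r \<Rightarrow> 'r) set) \<Rightarrow> bool" where
  "linearly_simple sc F \<longleftrightarrow>
     (\<exists>C>0. \<forall>i. \<forall>\<delta>\<in>F i. \<delta> \<noteq> 0 \<longrightarrow>
        id \<in> module.span (op_scale sc) {\<alpha> \<circ> \<delta> \<circ> \<beta> | \<alpha> \<beta>. \<alpha> \<in> F (C * i) \<and> \<beta> \<in> F (C * i)})"

text \<open>The dimension is \<open>\<infinity>\<close> if there is no polynomial bound.\<close>

definition filt_Dim :: "('k::field \<Rightarrow> 'v::ab_group_add \<Rightarrow> 'v) \<Rightarrow> (nat \<Rightarrow> 'v set) \<Rightarrow> ereal" where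
  "filt_Dim sc G =
     Inf {ereal t | t. t \<ge> 0 \<and>
       (\<exists>C. \<forall>\<^sub>F i in sequentially. real (vector_space.dim sc (G i)) \<le> C * real i powr t)}"

text \<open>Only meaningful if \<open>filt_Dim sc G < \<infinity>\<close>.\<close>

definition filt_mult :: "('k::field \<Rightarrow> 'v::ab_group_add \<Rightarrow> 'v) \<Rightarrow> (nat \<Rightarrow> 'v set) \<Rightarrow> ereal" where
  "filt_mult sc G =
     limsup (\<lambda>i. ereal (real (vector_space.dim sc (G i)) /
                        real i powr real_of_ereal (filt_Dim sc G)))"


section \<open>Modules over algebras of operators\<close>

text \<open>\<open>act \<delta> m\<close> is the result of \<open>\<delta> \<in> A\<close> acting on \<open>m\<close>; the module is the whole type \<open>'m\<close>.\<close>

definition left_module :: "('r \<Rightarrow> 'r::ab_group_add) set \<Rightarrow> (('r \<Rightarrow> 'r) \<Rightarrow> 'm \<Rightarrow> 'm::ab_group_add) \<Rightarrow> bool"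
  where
  "left_module A act \<longleftrightarrow>
     (\<forall>\<alpha>\<in>A. \<forall>m n. act \<alpha> (m + n) = act \<alpha> m + act \<alpha> n) \<and>
     (\<forall>\<alpha>\<in>A. \<forall>\<beta>\<in>A. \<forall>m. act (\<alpha> + \<beta>) m = act \<alpha> m + act \<beta> m) \<and>
     (\<forall>\<alpha>\<in>A. \<forall>\<beta>\<in>A. \<forall>m. act (\<alpha> \<circ> \<beta>) m = act \<alpha> (act \<beta> m)) \<and>
     (\<forall>m. act id m = m)"

text \<open>The vector space structure on an \<open>A\<close>-module induced by the inclusion of the base field in \<open>A\<close>.\<close>

definition act_scale :: "('k \<Rightarrow> 'r \<Rightarrow> 'r) \<Rightarrow> (('r \<Rightarrow> 'r) \<Rightarrow> 'm \<Rightarrow> 'm) \<Rightarrow> 'k \<Rightarrow> 'm \<Rightarrow> 'm" where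
  "act_scale sc act a m = act (sc a) m"

definition compatible_filtration ::
  "('k::field \<Rightarrow> 'r \<Rightarrow> 'r) \<Rightarrow> (nat \<Rightarrow> ('r \<Rightarrow> 'r) set) \<Rightarrow> (('r \<Rightarrow> 'r) \<Rightarrow> 'm \<Rightarrow> 'm::ab_group_add)
    \<Rightarrow> (nat \<Rightarrow> 'm set) \<Rightarrow> bool" where
  "compatible_filtration sc F act G \<longleftrightarrow>
     (\<forall>i. fin_dim_subspace (act_scale sc act) (G i)) \<and>
     mono G \<and> (\<Union>i. G i) = UNIV \<and>
     (\<forall>i j. \<forall>\<alpha>\<in>F i. \<forall>m\<in>G j. act \<alpha> m \<in> G (i + j))"

text \<open>
  Holonomicity is only defined over linearly simple filtered algebras of finite dimension and
  finite positive multiplicity, so these requirements are part of the predicate.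
\<close>

definition holonomic ::
  "('k::field \<Rightarrow> 'r::{comm_ring,comm_monoid_mult} \<Rightarrow> 'r) \<Rightarrow> ('r \<Rightarrow> 'r) set
    \<Rightarrow> (nat \<Rightarrow> ('r \<Rightarrow> 'r) set) \<Rightarrow> (('r \<Rightarrow> 'r) \<Rightarrow> 'm \<Rightarrow> 'm::ab_group_add) \<Rightarrow> bool" where
  "holonomic sc A F act \<longleftrightarrow>
     alg_filtration sc A F \<and> linearly_simple sc F \<and>
     filt_Dim (op_scale sc) F < \<infinity> \<and>
     0 < filt_mult (op_scale sc) F \<and> filt_mult (op_scale sc) F < \<infinity> \<and>
     left_module A act \<and>
     ((UNIV :: 'm set) = {0} \<or>
      (\<exists>G. compatible_filtration sc F act G \<and>
           filt_Dim (act_scale sc act) G = filt_Dim (op_scale sc) F / 2 \<and>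
           filt_mult (act_scale sc act) G < \<infinity>))"


section \<open>Localization and tensor products\<close>

text \<open>
  Localizations and tensor products depend on parameters (a ring element, scalar multiplications),
  so they cannot be introduced as types; instead, the following predicates say that a given type
  with given structure maps is a localization, respectively a tensor product.

  \<open>is_localization f \<iota>\<close>: the ring homomorphism \<open>\<iota>\<close> exhibits its codomain as \<open>R\<^sub>f\<close>.
\<close>

definition is_localization ::
  "'r::{comm_ring,comm_monoid_mult} \<Rightarrow> ('r \<Rightarrow> 'q::{comm_ring,comm_monoid_mult}) \<Rightarrow> bool" where
  "is_localization f \<iota> \<longleftrightarrow>
     (\<forall>x y. \<iota> (x + y) = \<iota> x + \<iota> y) \<and> (\<forall>x y. \<iota> (x * y) = \<iota> x * \<iota> y) \<and> \<iota> 1 = 1 \<and>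
     (\<exists>u. \<iota> f * u = 1) \<and>
     (\<forall>z. \<exists>x n. z * \<iota> f ^ n = \<iota> x) \<and>
     (\<forall>x y. \<iota> x = \<iota> y \<longleftrightarrow> (\<exists>n. f ^ n * x = f ^ n * y))"

text \<open>
  The tensor product \<open>V \<otimes>\<^sub>k W\<close> is the free abelian group on \<open>V \<times> W\<close>, here
  \<open>('v \<times> 'w) \<Rightarrow>\<^sub>0 int\<close>, modulo the following subgroup.
\<close>

inductive_set tensor_relations ::
  "('k \<Rightarrow> 'v::ab_group_add \<Rightarrow> 'v) \<Rightarrow> ('k \<Rightarrow> 'w::ab_group_add \<Rightarrow> 'w) \<Rightarrow> (('v \<times> 'w) \<Rightarrow>\<^sub>0 int) set"
  for scv :: "'k \<Rightarrow> 'v::ab_group_add \<Rightarrow> 'v" and scw :: "'k \<Rightarrow> 'w::ab_group_add \<Rightarrow> 'w"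
where
  rel_zero: "0 \<in> tensor_relations scv scw"
| rel_diff: "x \<in> tensor_relations scv scw \<Longrightarrow> y \<in> tensor_relations scv scw
     \<Longrightarrow> x - y \<in> tensor_relations scv scw"
| rel_left: "Poly_Mapping.single (v + v', w) 1 - Poly_Mapping.single (v, w) 1
     - Poly_Mapping.single (v', w) 1 \<in> tensor_relations scv scw"
| rel_right: "Poly_Mapping.single (v, w + w') 1 - Poly_Mapping.single (v, w) 1
     - Poly_Mapping.single (v, w') 1 \<in> tensor_relations scv scw"
| rel_scale: "Poly_Mapping.single (scv a v, w) 1 - Poly_Mapping.single (v, scw a w) 1
     \<in> tensor_relations scv scw"

text \<open>
  \<open>\<tau>\<close>, with \<open>\<tau> v w\<close> in the role of \<open>v \<otimes> w\<close>, exhibits its codomain as \<open>V \<otimes>\<^sub>k W\<close>: it induces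
  an isomorphism from the quotient above.
\<close>

definition is_tensor_product ::
  "('k \<Rightarrow> 'v::ab_group_add \<Rightarrow> 'v) \<Rightarrow> ('k \<Rightarrow> 'w::ab_group_add \<Rightarrow> 'w)
    \<Rightarrow> ('v \<Rightarrow> 'w \<Rightarrow> 't::ab_group_add) \<Rightarrow> bool" where
  "is_tensor_product scv scw \<tau> \<longleftrightarrow>
     (\<exists>\<phi> :: (('v \<times> 'w) \<Rightarrow>\<^sub>0 int) \<Rightarrow> 't.
        additive \<phi> \<and> (\<forall>v w. \<phi> (Poly_Mapping.single (v, w) 1) = \<tau> v w) \<and>
        surj \<phi> \<and> {x. \<phi> x = 0} = tensor_relations scv scw)"

definition is_tensor_algebra ::
  "('k \<Rightarrow> 'v::{comm_ring,comm_monoid_mult} \<Rightarrow> 'v) \<Rightarrow> ('k \<Rightarrow> 'w::{comm_ring,comm_monoid_mult} \<Rightarrow> 'w)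
    \<Rightarrow> ('v \<Rightarrow> 'w \<Rightarrow> 't::{comm_ring,comm_monoid_mult}) \<Rightarrow> bool" where
  "is_tensor_algebra scv scw \<tau> \<longleftrightarrow>
     is_tensor_product scv scw \<tau> \<and>
     (\<forall>v v' w w'. \<tau> v w * \<tau> v' w' = \<tau> (v * v') (w * w')) \<and> \<tau> 1 1 = 1"

text \<open>The structure of an algebra over the second tensor factor.\<close>

definition tensor_scale :: "('v::one \<Rightarrow> 'w \<Rightarrow> 't::times) \<Rightarrow> 'w \<Rightarrow> 't \<Rightarrow> 't" where
  "tensor_scale \<tau> c x = \<tau> 1 c * x"

text \<open>The map \<open>h \<otimes> id\<close>.\<close>

definition tensor_map ::
  "('v \<Rightarrow> 'w \<Rightarrow> 't::ab_group_add) \<Rightarrow> ('v' \<Rightarrow> 'w \<Rightarrow> 't'::ab_group_add) \<Rightarrow> ('v \<Rightarrow> 'v') \<Rightarrow> 't \<Rightarrow> 't'" where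
  "tensor_map \<tau> \<tau>' h = (THE \<phi>. additive \<phi> \<and> (\<forall>v w. \<phi> (\<tau> v w) = \<tau>' (h v) w))"


section \<open>The rational function field \<open>k(s)\<close> and the filtration \<open>k(s) \<otimes> F\<close>\<close>

definition ratfun_s :: "'k::field poly fract" where
  "ratfun_s = Fract [:0, 1:] 1"

definition ratfun_scale :: "'k::field \<Rightarrow> 'k poly fract \<Rightarrow> 'k poly fract" where
  "ratfun_scale a c = Fract [:a:] 1 * c"

text \<open>The generalized binomial coefficient \<open>gbinomial\<close> is not available, as the type constructor
  \<open>fract\<close> is not known to preserve characteristic zero.\<close>

definition binom_s :: "nat \<Rightarrow> 'k::field poly fract" where
  "binom_s i = (\<Prod>j<i. ratfun_s - of_nat j) / of_nat (fact i)"

text \<open>The image of \<open>k(s) \<otimes>\<^sub>k F i\<close> under the natural map from \<open>D \<otimes>\<^sub>k k(s)\<close> to operators on \<open>R(s)\<close>,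
  which sends \<open>\<delta> \<otimes> c\<close> to \<open>c (\<delta> \<otimes> id)\<close>.\<close>

definition extended_filtration ::
  "('r::one \<Rightarrow> 'l::field \<Rightarrow> 'rs::{comm_ring,comm_monoid_mult}) \<Rightarrow> (nat \<Rightarrow> ('r \<Rightarrow> 'r) set)
    \<Rightarrow> nat \<Rightarrow> ('rs \<Rightarrow> 'rs) set" where
  "extended_filtration \<tau> F i =
     module.span (op_scale (tensor_scale \<tau>)) (tensor_map \<tau> \<tau> ` F i)"


section \<open>The module \<open>R\<^sub>f(s) f\<^sup>s\<close>\<close>

text \<open>
  The standard extension of operators to a localization. Here \<open>j :: 'a \<Rightarrow> 'q\<close> is the map from a ring
  to its localization at \<open>g\<close> and \<open>u\<close> is the inverse of \<open>j g\<close>, so that \<open>v / g^t\<close> is \<open>j v * u ^ t\<close>.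
  The first argument bounds the order of the operator; for an operator of order \<open>0\<close> the
  commutator \<open>[\<delta>, g^t]\<close> vanishes.
\<close>

primrec ext_op_aux ::
  "nat \<Rightarrow> ('a \<Rightarrow> 'q) \<Rightarrow> 'a \<Rightarrow> 'q \<Rightarrow> ('a \<Rightarrow> 'a::{comm_ring,comm_monoid_mult})
    \<Rightarrow> 'q \<Rightarrow> 'q::{comm_ring,comm_monoid_mult}" where
  "ext_op_aux 0 j g u \<delta> x =
     (THE y. \<forall>v t. x = j v * u ^ t \<longrightarrow> y = j (\<delta> v) * u ^ t)"
| "ext_op_aux (Suc n) j g u \<delta> x =
     (THE y. \<forall>v t. x = j v * u ^ t \<longrightarrow>
        y = (j (\<delta> v) - ext_op_aux n j g u (op_comm \<delta> (g ^ t)) x) * u ^ t)"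

definition ext_op ::
  "('l::field \<Rightarrow> 'a \<Rightarrow> 'a) \<Rightarrow> ('a \<Rightarrow> 'q) \<Rightarrow> 'a \<Rightarrow> 'q \<Rightarrow> ('a \<Rightarrow> 'a::{comm_ring,comm_monoid_mult})
    \<Rightarrow> 'q \<Rightarrow> 'q::{comm_ring,comm_monoid_mult}" where
  "ext_op sc j g u \<delta> = ext_op_aux (op_order sc \<delta>) j g u \<delta>"

text \<open>
  The free module \<open>R\<^sub>f(s) f\<^sup>s\<close> is represented by \<open>R\<^sub>f(s)\<close>, with \<open>a\<close> standing for \<open>a f\<^sup>s\<close>; only the
  action of differential operators sees the symbol \<open>f\<^sup>s\<close>. The structure maps are
  \<open>\<iota> : R \<rightarrow> R\<^sub>f\<close>, \<open>\<tau> : R \<times> k(s) \<rightarrow> R(s)\<close> and \<open>\<tau>\<^sub>f : R\<^sub>f \<times> k(s) \<rightarrow> R\<^sub>f(s)\<close>.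
\<close>

definition fs_act ::
  "'r::{comm_ring,comm_monoid_mult} \<Rightarrow> ('r \<Rightarrow> 'q::{comm_ring,comm_monoid_mult})
    \<Rightarrow> ('r \<Rightarrow> 'k::field poly fract \<Rightarrow> 'rs::{comm_ring,comm_monoid_mult})
    \<Rightarrow> ('q \<Rightarrow> 'k poly fract \<Rightarrow> 'qs::{comm_ring,comm_monoid_mult})
    \<Rightarrow> ('rs \<Rightarrow> 'rs) \<Rightarrow> 'qs \<Rightarrow> 'qs" where
  "fs_act f \<iota> \<tau> \<tau>\<^sub>f \<delta> a =
     (let sc = tensor_scale \<tau>;
          fR = \<tau> f 1;
          f_inv = (THE u. \<tau>\<^sub>f (\<iota> f) 1 * u = 1);
          j = tensor_map \<tau> \<tau>\<^sub>f \<iota>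
      in \<Sum>i\<le>op_order sc \<delta>.
           tensor_scale \<tau>\<^sub>f (binom_s i)
             (f_inv ^ i * ext_op sc j fR f_inv (((\<lambda>\<eta>. op_comm \<eta> fR) ^^ i) \<delta>) a))"

end

theory Submission
  imports Defs "HOL-Computational_Algebra.Polynomial_Factorial"
begin

text \<open>
  Write \<open>K = k(s)\<close> and \<open>d\<close> for the dimension of the filtration \<open>F\<close> of the operators on \<open>R\<close>.
  Three things have to be shown: that \<open>K \<otimes> F\<close> is a filtration of the operators on \<open>R(s)\<close> with the same
  growth, that it is linearly simple, and that \<open>R\<^sub>f(s) f\<^sup>s\<close> is a module with a compatible filtration
  of dimension \<open>d/2\<close> and finite multiplicity.

  An operator on \<open>R(s)\<close> is determined by its coefficients with respect to a basis of \<open>K\<close> over \<open>k\<close>, which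
  are operators on \<open>R\<close>; at every point only finitely many of them are nonzero. If infinitely many were
  nonzero, then the sums of arbitrary subfamilies would form too large a set of operators: a
  diagonal choice gives a sum that lies in no \<open>F i\<close> (\<open>finite_slices\<close>). Hence every operator on \<open>R(s)\<close> is
  a finite \<open>K\<close>-combination of operators from \<open>R\<close> (\<open>diff_ops_tscale\<close>). Dimensions are preserved because
  linearly independent operators stay independent over \<open>K\<close> (\<open>independent_ext\<close>).

  Linear simplicity passes to \<open>K\<close> with the same constant (\<open>linearly_simple_ext\<close>). If \<open>1\<close> is not in the
  span of the products \<open>\<alpha> \<delta> \<beta>\<close>, a functional vanishes on them but not at \<open>1\<close>. After clearing
  denominators, both the functional and \<open>\<delta>\<close> can be evaluated at a scalar \<open>s = a\<close>; all but finitely many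
  \<open>a\<close> give a contradiction to linear simplicity over \<open>k\<close>.

  The action on \<open>R\<^sub>f(s) f\<^sup>s\<close> is the extension of operators to the localization, followed by the
  conjugation \<open>E \<mapsto> f\<^sup>-\<^sup>s E f\<^sup>s = \<Sum>i. (s choose i) f\<^sup>-\<^sup>i ad(f)\<^sup>i(E)\<close>. The extension is multiplicative because it is
  unique (\<open>nilpotent_op_eqI\<close>). The conjugation is multiplicative because, for natural numbers in the
  place of \<open>s\<close>, it is a true conjugation, and a polynomial identity that holds at all natural numbers
  holds at \<open>s\<close> (\<open>twist_comp\<close>).

  Let \<open>G\<close> be a filtration of \<open>R\<close> of dimension \<open>d/2\<close>, let \<open>F i\<close> consist of operators of order at most
  \<open>C i\<close>, and let \<open>f\<close> lie in \<open>F a\<close>. An operator in \<open>F i\<close> increases the exponent of the denominator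
  \<open>f\<close> by at most \<open>C i\<close>, so the \<open>K\<close>-spans of \<open>f\<^sup>-\<^sup>C\<^sup>i G((1 + a C) i)\<close> form a compatible filtration
  (\<open>compatible_fs_filtration\<close>), and their dimensions are at most \<open>dim G((1 + a C) i)\<close>. Its dimension is
  therefore at most \<open>d/2\<close>, with finite multiplicity. If the module is nonzero, it is
  at least \<open>d/2\<close> by Bernstein's inequality:
  linear simplicity makes an operator in \<open>F i\<close> detectable on a piece of the module of index linear in \<open>i\<close>,
  so \<open>dim F i\<close> is at most a product of two dimensions of pieces of the module (\<open>dim_product_bound\<close>).
\<close>

section \<open>Linear algebra\<close>

lemma vector_space_field: "vector_space ((*) :: 'k::field \<Rightarrow> 'k \<Rightarrow> 'k)"
  by unfold_locales (auto simp: algebra_simps)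

text \<open>
  Linear functionals replace ranks and determinants below: a vector outside a subspace is
  recognised by a functional, and functionals can be scaled, specialised and composed.
\<close>

lemma separating_functional:
  assumes "vector_space sc" "module.subspace sc S" "v \<notin> S"
  shows "\<exists>y. Vector_Spaces.linear sc (*) y \<and> (\<forall>x\<in>S. y x = 0) \<and> y v = 1"
proof -
  interpret V: vector_space sc by fact
  interpret P: vector_space_pair sc "(*)"
    unfolding vector_space_pair_def using assms(1) vector_space_field by blast
  obtain B where B: "B \<subseteq> S" "V.independent B" "S \<subseteq> V.span B"
    using V.maximal_independent_subset by blast
  have sp: "V.span B \<subseteq> S" using B(1) assms(2) by (rule V.span_minimal)
  have "V.independent (insert v B)"
    using B sp assms(3) by (intro V.independent_insertI) auto
  then obtain g where g: "Vector_Spaces.linear sc (*) g"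
    "\<forall>x\<in>insert v B. g x = (if x = v then 1 else 0)"
    using P.linear_independent_extend[of "insert v B" "\<lambda>x. if x = v then 1 else 0"] by blast
  have "g x = 0" if "x \<in> S" for x
  proof (rule P.linear_eq_0_on_span[OF g(1), of B])
    show "g b = 0" if "b \<in> B" for b
      using g(2) that B(1) assms(3) by auto
    show "x \<in> V.span B" using that B(3) by auto
  qed
  then show ?thesis using g by auto
qed

corollary nonzero_functional:
  assumes "vector_space sc" "v \<noteq> 0"
  shows "\<exists>y. Vector_Spaces.linear sc (*) y \<and> y v \<noteq> 0"
proof -
  interpret V: vector_space sc by fact
  have "\<exists>y. Vector_Spaces.linear sc (*) y \<and> (\<forall>x\<in>{0}. y x = 0) \<and> y v = 1"
    by (rule separating_functional) (use assms in auto)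
  then show ?thesis by force
qed

lemma linear_simps:
  assumes "Vector_Spaces.linear s1 s2 h"
  shows "h (x + y) = h x + h y" "h (x - y) = h x - h y" "h 0 = 0" "h (s1 c x) = s2 c (h x)"
    "h (sum g A) = (\<Sum>a\<in>A. h (g a))"
proof -
  interpret Vector_Spaces.linear s1 s2 h by fact
  show "h (x + y) = h x + h y" "h (x - y) = h x - h y" "h 0 = 0" "h (s1 c x) = s2 c (h x)"
    "h (sum g A) = (\<Sum>a\<in>A. h (g a))"
    by (simp_all add: add diff scale sum)
qed

lemma vector_space_op_scale:
  assumes "vector_space sc" shows "vector_space (op_scale sc)"
proof -
  interpret V: vector_space sc by fact
  show ?thesis by unfold_locales (auto simp: op_scale_def fun_eq_iff algebra_simps)
qed

lemma sum_fun_apply: "sum g A x = (\<Sum>a\<in>A. g a x)" for g :: "'a \<Rightarrow> 'b \<Rightarrow> 'c::comm_monoid_add"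
  by (induction A rule: infinite_finite_induct) simp_all

lemma fin_dim_subspace_basis:
  assumes "vector_space sc" "fin_dim_subspace sc V"
  shows "\<exists>B. finite B \<and> B \<subseteq> V \<and> \<not> module.dependent sc B \<and> V = module.span sc B
    \<and> card B = vector_space.dim sc V"
proof -
  interpret V: vector_space sc by fact
  obtain B0 where B0: "finite B0" "V = V.span B0"
    using assms(2) by (auto simp: fin_dim_subspace_def)
  obtain B where B: "B \<subseteq> V" "V.independent B" "V \<subseteq> V.span B" "card B = V.dim V"
    using V.basis_exists[of V] by blast
  have "finite B" using V.independent_span_bound[OF B0(1) B(2)] B(1) B0(2) by blast
  moreover have "V.span B \<subseteq> V" using B(1) by (simp add: B0(2) V.span_minimal)
  ultimately show ?thesis using B by blast
qed

lemma fin_dim_subspace_subspace: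
  assumes "vector_space sc" "fin_dim_subspace sc V"
  shows "module.subspace sc V"
proof -
  interpret V: vector_space sc by fact
  show ?thesis using assms(2) by (auto simp: fin_dim_subspace_def)
qed

section \<open>Differential operators\<close>

lemma op_comm_add: "op_comm (\<delta> + \<epsilon>) r = op_comm \<delta> r + op_comm \<epsilon> r"
  by (auto simp: op_comm_def fun_eq_iff distrib_left)

lemma op_comm_zero: "op_comm 0 r = 0"
  by (auto simp: op_comm_def fun_eq_iff)

lemma op_comm_mult: "op_comm (\<lambda>x. a * x) r = 0"
  by (auto simp: op_comm_def fun_eq_iff mult.left_commute)

text \<open>
  The locale form of \<open>comm_algebra\<close>, giving access to the library on vector spaces for the algebra
  and, with the prefix \<open>op\<close>, for its operators.
\<close>

locale commutative_algebra = vector_space sc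
  for sc :: "'k::field \<Rightarrow> 'r::{comm_ring,comm_monoid_mult} \<Rightarrow> 'r" +
  assumes mult_scale_left: "sc a x * y = sc a (x * y)"
begin

sublocale op: vector_space "op_scale sc"
  by (rule vector_space_op_scale) (rule vector_space_axioms)

lemma mult_scale_right: "x * sc a y = sc a (x * y)"
  using mult_scale_left[of a y x] by (simp add: mult.commute)

lemma op_comm_scale: "op_comm (op_scale sc a \<delta>) r = op_scale sc a (op_comm \<delta> r)"
  by (auto simp: op_comm_def op_scale_def fun_eq_iff mult_scale_right scale_right_diff_distrib)

lemma op_comm_diff_right:
  "Vector_Spaces.linear sc sc \<delta> \<Longrightarrow> op_comm \<delta> (r - s) = op_comm \<delta> r - op_comm \<delta> s"
  by (auto simp: op_comm_def fun_eq_iff left_diff_distrib linear_simps)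

lemma linear_mult: "Vector_Spaces.linear sc sc (\<lambda>x. r * x)"
  unfolding Vector_Spaces.linear_iff
  by (intro conjI allI vector_space_axioms) (simp_all add: distrib_left mult_scale_right)

lemma diff_ops_le_linear: "\<delta> \<in> diff_ops_le sc n \<Longrightarrow> Vector_Spaces.linear sc sc \<delta>"
  by (cases n) (auto simp: linear_mult)

lemma diff_ops_linear: "\<delta> \<in> diff_ops sc \<Longrightarrow> Vector_Spaces.linear sc sc \<delta>"
  by (auto simp: diff_ops_def diff_ops_le_linear)

lemma linear_operators_subspace: "op.subspace {\<delta>. Vector_Spaces.linear sc sc \<delta>}"
  unfolding op.subspace_def Vector_Spaces.linear_iff
  using vector_space_axioms
  by (auto simp: op_scale_def scale_right_distrib mult.commute algebra_simps)

lemma linear_zero_op: "Vector_Spaces.linear sc sc 0"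
  using op.subspace_0[OF linear_operators_subspace] by blast

lemma linear_add_op:
  "Vector_Spaces.linear sc sc \<alpha> \<Longrightarrow> Vector_Spaces.linear sc sc \<beta> \<Longrightarrow> Vector_Spaces.linear sc sc (\<alpha> + \<beta>)"
  using op.subspace_add[OF linear_operators_subspace] by blast

lemma linear_scale_op:
  "Vector_Spaces.linear sc sc \<alpha> \<Longrightarrow> Vector_Spaces.linear sc sc (op_scale sc a \<alpha>)"
  using op.subspace_scale[OF linear_operators_subspace] by blast

lemma linear_op_comm:
  assumes "Vector_Spaces.linear sc sc \<delta>"
  shows "Vector_Spaces.linear sc sc (op_comm \<delta> r)"
  unfolding Vector_Spaces.linear_iff
  using vector_space_axioms
  by (auto simp: op_comm_def linear_simps[OF assms] distrib_left mult_scale_right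
      scale_right_diff_distrib)

lemma zero_diff_ops_le: "0 \<in> diff_ops_le sc n"
proof (induction n)
  case 0
  show ?case by (auto intro!: exI[of _ 0])
next
  case (Suc n)
  then show ?case using linear_zero_op by (simp only: diff_ops_le.simps mem_Collect_eq op_comm_zero simp_thms)
qed

lemma subspace_diff_ops_le: "op.subspace (diff_ops_le sc n)"
proof (induction n)
  case 0
  show ?case
    unfolding op.subspace_def
  proof (intro conjI ballI allI)
    show "0 \<in> diff_ops_le sc 0" by (rule zero_diff_ops_le)
    show "x + y \<in> diff_ops_le sc 0" if xy: "x \<in> diff_ops_le sc 0" "y \<in> diff_ops_le sc 0" for x y
    proof -
      obtain r s where "x = (\<lambda>z. r * z)" "y = (\<lambda>z. s * z)" using xy by auto
      then have "x + y = (\<lambda>z. (r + s) * z)" by (auto simp: distrib_right)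
      then show ?thesis by auto
    qed
    show "op_scale sc c x \<in> diff_ops_le sc 0" if x: "x \<in> diff_ops_le sc 0" for c x
    proof -
      obtain r where "x = (\<lambda>z. r * z)" using x by auto
      then have "op_scale sc c x = (\<lambda>z. sc c r * z)" by (auto simp: op_scale_def mult_scale_left)
      then show ?thesis by auto
    qed
  qed
next
  case (Suc n)
  have eq: "diff_ops_le sc (Suc n) =
      {\<delta>. Vector_Spaces.linear sc sc \<delta>} \<inter> {\<delta>. \<forall>r. op_comm \<delta> r \<in> diff_ops_le sc n}"
    by auto
  have "op.subspace {\<delta>. \<forall>r. op_comm \<delta> r \<in> diff_ops_le sc n}"
    unfolding op.subspace_def
    using Suc by (auto simp: op_comm_zero op_comm_add op_comm_scale op.subspace_0 op.subspace_add op.subspace_scale)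
  then show ?case
    unfolding eq by (rule op.subspace_inter[OF linear_operators_subspace])
qed

lemma diff_ops_le_Suc: "diff_ops_le sc n \<subseteq> diff_ops_le sc (Suc n)"
proof (induction n)
  case 0
  show ?case
  proof
    fix \<delta> assume "\<delta> \<in> diff_ops_le sc 0"
    then obtain r where r: "\<delta> = (\<lambda>x. r * x)" by auto
    show "\<delta> \<in> diff_ops_le sc (Suc 0)"
      unfolding r diff_ops_le.simps(2) mem_Collect_eq op_comm_mult
      using linear_mult zero_diff_ops_le by blast
  qed
next
  case (Suc n)
  then show ?case by auto
qed

lemma diff_ops_le_mono: "m \<le> n \<Longrightarrow> diff_ops_le sc m \<subseteq> diff_ops_le sc n"
  by (rule lift_Suc_mono_le[of "diff_ops_le sc"]) (rule diff_ops_le_Suc)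

lemma op_order: "\<delta> \<in> diff_ops sc \<Longrightarrow> \<delta> \<in> diff_ops_le sc (op_order sc \<delta>)"
  unfolding op_order_def diff_ops_def by (auto intro: LeastI)

lemma subspace_diff_ops: "op.subspace (diff_ops sc)"
  unfolding op.subspace_def
proof (intro conjI ballI allI)
  show "0 \<in> diff_ops sc" using zero_diff_ops_le by (auto simp: diff_ops_def)
  show "op_scale sc c x \<in> diff_ops sc" if "x \<in> diff_ops sc" for c x
    using that op.subspace_scale[OF subspace_diff_ops_le] by (auto simp: diff_ops_def)
  show "x + y \<in> diff_ops sc" if xy: "x \<in> diff_ops sc" "y \<in> diff_ops sc" for x y
  proof -
    obtain m n where "x \<in> diff_ops_le sc m" "y \<in> diff_ops_le sc n"
      using xy by (auto simp: diff_ops_def)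
    then have "x \<in> diff_ops_le sc (max m n)" "y \<in> diff_ops_le sc (max m n)"
      using diff_ops_le_mono[of m "max m n"] diff_ops_le_mono[of n "max m n"] by auto
    then show ?thesis
      using op.subspace_add[OF subspace_diff_ops_le] by (auto simp: diff_ops_def)
  qed
qed

lemma mult_in_diff_ops: "(\<lambda>x. r * x) \<in> diff_ops sc"
  unfolding diff_ops_def by (rule UN_I[of 0]) auto

text \<open>
  Induction on the generators: if the points found so far do not separate \<open>span (insert b B)\<close>,
  then the operators that vanish at all of them form a line, which one more point separates from \<open>0\<close>.
\<close>

lemma separating_points:
  assumes "finite B"
  shows "\<exists>E. finite E \<and> (\<forall>\<phi>\<in>op.span B. (\<forall>r\<in>E. \<phi> r = 0) \<longrightarrow> \<phi> = 0)"
  using assms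
proof induction
  case empty
  show ?case by auto
next
  case (insert b B)
  then obtain E where E: "finite E" "\<And>\<phi>. \<phi> \<in> op.span B \<Longrightarrow> (\<forall>r\<in>E. \<phi> r = 0) \<Longrightarrow> \<phi> = 0"
    by blast
  show ?case
  proof (cases "\<exists>\<phi>\<in>op.span (insert b B). (\<forall>r\<in>E. \<phi> r = 0) \<and> \<phi> \<noteq> 0")
    case False
    then show ?thesis using E by blast
  next
    case True
    then obtain \<psi> where \<psi>: "\<psi> \<in> op.span (insert b B)" "\<And>r. r \<in> E \<Longrightarrow> \<psi> r = 0" "\<psi> \<noteq> 0" by blast
    then obtain t where t: "\<psi> t \<noteq> 0" by (auto simp: fun_eq_iff)
    obtain c where c: "\<psi> - op_scale sc c b \<in> op.span B"
      using \<psi>(1) op.span_breakdown_eq by blast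
    \<comment> \<open>\<open>\<psi>\<close> involves \<open>b\<close>, so every operator in the larger span can be reduced to \<open>span B\<close> by a
      multiple of \<open>\<psi>\<close>.\<close>
    have c0: "c \<noteq> 0"
    proof
      assume "c = 0"
      then have "\<psi> \<in> op.span B" using c by simp
      then show False using E(2) \<psi> by blast
    qed
    have "\<phi> = 0" if \<phi>: "\<phi> \<in> op.span (insert b B)" "\<forall>r\<in>insert t E. \<phi> r = 0" for \<phi>
    proof -
      obtain d where d: "\<phi> - op_scale sc d b \<in> op.span B"
        using \<phi>(1) op.span_breakdown_eq by blast
      let ?\<eta> = "\<phi> - op_scale sc (d / c) \<psi>"
      have "op_scale sc (d / c) (\<psi> - op_scale sc c b) = op_scale sc (d / c) \<psi> - op_scale sc d b"
        using c0 by (simp add: op.scale_right_diff_distrib)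
      then have "?\<eta> = (\<phi> - op_scale sc d b) - op_scale sc (d / c) (\<psi> - op_scale sc c b)"
        by simp
      also have "\<dots> \<in> op.span B"
        by (rule op.span_diff[OF d op.span_scale[OF c]])
      finally have "?\<eta> = 0"
        by (rule E(2)) (use \<phi>(2) \<psi>(2) in \<open>auto simp: op_scale_def\<close>)
      then have eq: "\<phi> = op_scale sc (d / c) \<psi>" by simp
      have "\<phi> t = 0" using \<phi>(2) by blast
      then have "sc (d / c) (\<psi> t) = 0" by (subst (asm) eq) (simp add: op_scale_def)
      then have "d / c = 0" using t scale_eq_0_iff by blast
      then show ?thesis unfolding eq by (simp only: op.scale_zero_left)
    qed
    moreover have "finite (insert t E)" using E(1) by simp
    ultimately show ?thesis by blast
  qed
qed

end

lemma commutative_algebra_iff: "commutative_algebra sc \<longleftrightarrow> comm_algebra sc"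
  by (auto simp: commutative_algebra_def commutative_algebra_axioms_def comm_algebra_def)

lemma alg_filtrationD:
  assumes "alg_filtration sc A F"
  shows "fin_dim_subspace (op_scale sc) (F i)" "mono F" "(\<Union>i. F i) = A" "F 0 = range sc"
    "\<alpha> \<in> F i \<Longrightarrow> \<beta> \<in> F j \<Longrightarrow> \<alpha> \<circ> \<beta> \<in> F (i + j)"
    "i \<le> j \<Longrightarrow> \<alpha> \<in> F i \<Longrightarrow> \<alpha> \<in> F j" "\<alpha> \<in> F i \<Longrightarrow> \<alpha> \<in> A"
  using assms by (auto simp: alg_filtration_def mono_def)

lemma act_scale_id: "act_scale sc (\<lambda>\<delta> m. \<delta> m) = sc"
  by (intro ext) (simp add: act_scale_def)

lemma compatible_filtrationD:
  assumes "compatible_filtration sc F act G"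
  shows "fin_dim_subspace (act_scale sc act) (G i)" "mono G" "(\<Union>i. G i) = UNIV"
    "\<alpha> \<in> F i \<Longrightarrow> m \<in> G k \<Longrightarrow> act \<alpha> m \<in> G (i + k)" "i \<le> k \<Longrightarrow> m \<in> G i \<Longrightarrow> m \<in> G k"
  using assms by (auto simp: compatible_filtration_def mono_def)

section \<open>Tensor products\<close>

lemma tensor_product_rules:
  assumes "is_tensor_product scv scw \<tau>"
  shows "\<tau> (v + v') w = \<tau> v w + \<tau> v' w" "\<tau> v (w + w') = \<tau> v w + \<tau> v w'" "\<tau> (scv a v) w = \<tau> v (scw a w)"
proof -
  obtain \<phi> where "additive \<phi>" and s: "\<And>v w. \<phi> (frag_of (v, w)) = \<tau> v w"
    and ker: "{x. \<phi> x = 0} = tensor_relations scv scw"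
    using assms unfolding is_tensor_product_def by blast
  interpret \<phi>: additive \<phi> by fact
  have rel: "\<phi> x = 0" if "x \<in> tensor_relations scv scw" for x
    using that ker by auto
  show "\<tau> (v + v') w = \<tau> v w + \<tau> v' w"
    using rel[OF rel_left, of v v' w] unfolding \<phi>.diff s by (simp add: algebra_simps)
  show "\<tau> v (w + w') = \<tau> v w + \<tau> v w'"
    using rel[OF rel_right, of v w w'] unfolding \<phi>.diff s by (simp add: algebra_simps)
  show "\<tau> (scv a v) w = \<tau> v (scw a w)"
    using rel[OF rel_scale, of a v w] unfolding \<phi>.diff s by (simp add: algebra_simps)
qed

lemma tensor_product_induct:
  assumes "is_tensor_product scv scw \<tau>"
    and "P 0" "\<And>v w. P (\<tau> v w)" "\<And>x y. P x \<Longrightarrow> P y \<Longrightarrow> P (x - y)"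
  shows "P x"
proof -
  obtain \<phi> where "additive \<phi>" and s: "\<And>v w. \<phi> (frag_of (v, w)) = \<tau> v w"
    and "surj \<phi>"
    using assms(1) unfolding is_tensor_product_def by blast
  interpret \<phi>: additive \<phi> by fact
  obtain z where z: "x = \<phi> z" using \<open>surj \<phi>\<close> by blast
  have "Poly_Mapping.keys z \<subseteq> UNIV" by simp
  then have "P (\<phi> z)"
  proof (induction z rule: frag_induction)
    case (one p)
    then show ?case using assms(3) s by (cases p) simp
  qed (use assms(2,4) in \<open>simp_all add: \<phi>.zero \<phi>.diff\<close>)
  then show ?thesis by (simp add: z)
qed

text \<open>
  The universal property of the tensor product. The vector space structure of the target, over any field,
  provides the integer multiples with which the map on the free abelian group is written.
\<close>

lemma tensor_product_lift:
  fixes b :: "'v::ab_group_add \<Rightarrow> 'w::ab_group_add \<Rightarrow> 't::ab_group_add"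
  assumes T: "is_tensor_product scv scw \<tau>" and vs: "vector_space (sct :: 'l::field \<Rightarrow> 't \<Rightarrow> 't)"
    and left: "\<And>v v' w. b (v + v') w = b v w + b v' w"
    and right: "\<And>v w w'. b v (w + w') = b v w + b v w'"
    and bal: "\<And>a v w. b (scv a v) w = b v (scw a w)"
  shows "\<exists>\<Phi>. additive \<Phi> \<and> (\<forall>v w. \<Phi> (\<tau> v w) = b v w)"
proof -
  interpret V: vector_space sct by fact
  obtain \<phi> where "additive \<phi>" and s: "\<And>v w. \<phi> (frag_of (v, w)) = \<tau> v w"
    and "surj \<phi>" and ker: "{x. \<phi> x = 0} = tensor_relations scv scw"
    using T unfolding is_tensor_product_def by blast
  interpret \<phi>: additive \<phi> by fact
  define \<psi> where "\<psi> z = (\<Sum>p\<in>Poly_Mapping.keys z.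
    sct (of_int (Poly_Mapping.lookup z p)) (b (fst p) (snd p)))" for z
  have sup: "\<psi> z = (\<Sum>p\<in>X. sct (of_int (Poly_Mapping.lookup z p)) (b (fst p) (snd p)))"
    if "finite X" "Poly_Mapping.keys z \<subseteq> X" for z X
    unfolding \<psi>_def by (rule sum.mono_neutral_left) (use that in \<open>auto simp: in_keys_iff\<close>)
  have diff: "\<psi> (x - y) = \<psi> x - \<psi> y" for x y
  proof -
    let ?X = "Poly_Mapping.keys x \<union> Poly_Mapping.keys y"
    have "Poly_Mapping.keys (x - y) \<subseteq> ?X" by (rule keys_diff)
    then show ?thesis
      by (subst (1 2 3) sup[of ?X]) (auto simp: lookup_minus V.scale_left_diff_distrib sum_subtractf)
  qed
  have zero: "\<psi> 0 = 0" by (simp add: \<psi>_def)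
  have single: "\<psi> (Poly_Mapping.single (v, w) 1) = b v w" for v w
    by (simp add: \<psi>_def)
  have rel: "\<psi> z = 0" if "z \<in> tensor_relations scv scw" for z
    using that
    by induction (simp_all add: zero diff single left right bal)
  have eq: "\<psi> x = \<psi> y" if "\<phi> x = \<phi> y" for x y
  proof -
    have "x - y \<in> {x. \<phi> x = 0}" using that by (simp add: \<phi>.diff)
    then show ?thesis using rel[of "x - y"] ker by (simp add: diff)
  qed
  define \<Phi> where "\<Phi> t = \<psi> (SOME z. \<phi> z = t)" for t
  have \<Phi>: "\<Phi> (\<phi> z) = \<psi> z" for z
    unfolding \<Phi>_def by (rule eq) (rule someI, rule refl)
  have add: "\<psi> (x + y) = \<psi> x + \<psi> y" for x y
    using diff[of "x + y" y] by simp
  have "additive \<Phi>"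
  proof
    fix x y
    obtain x' y' where "x = \<phi> x'" "y = \<phi> y'" using \<open>surj \<phi>\<close> by (meson surjD)
    then show "\<Phi> (x + y) = \<Phi> x + \<Phi> y"
      using \<Phi>[of "x' + y'"] by (simp add: \<phi>.add \<Phi> add)
  qed
  moreover have "\<Phi> (\<tau> v w) = b v w" for v w
    using \<Phi>[of "Poly_Mapping.single (v, w) 1"] by (simp add: s single)
  ultimately show ?thesis by blast
qed

lemma tensor_product_additive_eq:
  assumes "is_tensor_product scv scw \<tau>" "additive \<Phi>" "additive \<Psi>"
    and "\<And>v w. \<Phi> (\<tau> v w) = \<Psi> (\<tau> v w)"
  shows "\<Phi> = \<Psi>"
proof
  interpret \<Phi>: additive \<Phi> by fact
  interpret \<Psi>: additive \<Psi> by fact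
  fix x show "\<Phi> x = \<Psi> x"
    by (rule tensor_product_induct[OF assms(1)])
      (use assms(4) in \<open>simp_all add: \<Phi>.zero \<Psi>.zero \<Phi>.diff \<Psi>.diff\<close>)
qed

lemma tensor_product_lift_unique:
  fixes b :: "'v::ab_group_add \<Rightarrow> 'w::ab_group_add \<Rightarrow> 't::ab_group_add"
  assumes "is_tensor_product scv scw \<tau>" "vector_space (sct :: 'l::field \<Rightarrow> 't \<Rightarrow> 't)"
    and "\<And>v v' w. b (v + v') w = b v w + b v' w"
    and "\<And>v w w'. b v (w + w') = b v w + b v w'"
    and "\<And>a v w. b (scv a v) w = b v (scw a w)"
  shows "\<exists>!\<Phi>. additive \<Phi> \<and> (\<forall>v w. \<Phi> (\<tau> v w) = b v w)"
proof -
  obtain \<Phi> where "additive \<Phi>" "\<And>v w. \<Phi> (\<tau> v w) = b v w"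
    using tensor_product_lift[where b = b, OF assms] by metis
  moreover have "\<Psi> = \<Phi>" if "additive \<Psi>" "\<And>v w. \<Psi> (\<tau> v w) = b v w" for \<Psi>
    using tensor_product_additive_eq[OF assms(1) that(1) \<open>additive \<Phi>\<close>] that(2) calculation(2) by simp
  ultimately show ?thesis by blast
qed

lemma tensor_map_rules:
  fixes \<tau>' :: "'u::ab_group_add \<Rightarrow> 'w::ab_group_add \<Rightarrow> 't::ab_group_add"
  assumes T: "is_tensor_product scv scw \<tau>" and T': "is_tensor_product scv' scw \<tau>'"
    and "vector_space (sct :: 'l::field \<Rightarrow> 't \<Rightarrow> 't)"
    and h: "\<And>v v'. h (v + v') = h v + h v'" "\<And>a v. h (scv a v) = scv' a (h v)"
  shows "additive (tensor_map \<tau> \<tau>' h)" "tensor_map \<tau> \<tau>' h (\<tau> v w) = \<tau>' (h v) w"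
proof -
  have "\<exists>!\<Phi>. additive \<Phi> \<and> (\<forall>v w. \<Phi> (\<tau> v w) = \<tau>' (h v) w)"
    by (rule tensor_product_lift_unique[OF T \<open>vector_space sct\<close>])
      (simp_all add: h tensor_product_rules[OF T'])
  from theI'[OF this] show "additive (tensor_map \<tau> \<tau>' h)" "tensor_map \<tau> \<tau>' h (\<tau> v w) = \<tau>' (h v) w"
    unfolding tensor_map_def by auto
qed

section \<open>Extension of scalars\<close>

text \<open>
  An algebra \<open>'v\<close> over \<open>'k\<close> and its base change \<open>'t\<close> to the extension field \<open>'l\<close>. The prefixes \<open>k\<close>,
  \<open>w\<close> and \<open>l\<close> refer to \<open>'v\<close> over \<open>'k\<close>, to \<open>'l\<close> over \<open>'k\<close> and to \<open>'t\<close> over \<open>'l\<close>, respectively.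
\<close>

locale scalar_extension =
  fixes sc :: "'k::field \<Rightarrow> 'v::{comm_ring,comm_monoid_mult} \<Rightarrow> 'v"
    and scw :: "'k \<Rightarrow> 'l::field \<Rightarrow> 'l"
    and \<tau> :: "'v \<Rightarrow> 'l \<Rightarrow> 't::{comm_ring,comm_monoid_mult}"
  assumes base_algebra: "comm_algebra sc"
    and field_algebra: "comm_algebra scw"
    and tensor_algebra: "is_tensor_algebra sc scw \<tau>"
begin

lemma tensor_product: "is_tensor_product sc scw \<tau>"
  using tensor_algebra by (simp add: is_tensor_algebra_def)

lemma tensor_mult: "\<tau> v w * \<tau> v' w' = \<tau> (v * v') (w * w')"
  and tensor_one: "\<tau> 1 1 = 1"
  using tensor_algebra by (simp_all add: is_tensor_algebra_def)

lemmas tensor_add_left = tensor_product_rules(1)[OF tensor_product]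
  and tensor_add_right = tensor_product_rules(2)[OF tensor_product]
  and tensor_balanced = tensor_product_rules(3)[OF tensor_product]

lemma tensor_zero_left [simp]: "\<tau> 0 w = 0"
  by (metis tensor_add_left add_cancel_right_right add_0)

lemma tensor_zero_right [simp]: "\<tau> v 0 = 0"
  by (metis tensor_add_right add_cancel_right_right add_0)

lemma tensor_sum_right: "\<tau> v (sum g A) = (\<Sum>a\<in>A. \<tau> v (g a))"
  by (induction A rule: infinite_finite_induct) (simp_all add: tensor_add_right)

sublocale k: commutative_algebra sc
  using base_algebra by (simp add: commutative_algebra_iff)

sublocale w: vector_space scw
  using field_algebra by (simp add: comm_algebra_def)

abbreviation tscale where "tscale \<equiv> tensor_scale \<tau>"

sublocale l: commutative_algebra tscale
  by unfold_locales
    (auto simp: tensor_scale_def tensor_add_right distrib_left distrib_right tensor_one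
      tensor_mult simp flip: mult.assoc)

lemma tscale_tensor: "tscale c (\<tau> v w) = \<tau> v (c * w)"
  by (simp add: tensor_scale_def tensor_mult)

lemma tensor_eq_tscale: "\<tau> v w = tscale w (\<tau> v 1)"
  by (simp add: tscale_tensor)

lemma tensor_induct [case_names zero tensor diff]:
  assumes "P 0" "\<And>v w. P (\<tau> v w)" "\<And>x y. P x \<Longrightarrow> P y \<Longrightarrow> P (x - y)"
  shows "P x"
  using tensor_product_induct[OF tensor_product] assms by blast

text \<open>
  The map \<open>id \<otimes> y\<close> for a linear functional \<open>y\<close>.
\<close>

definition slice :: "('l \<Rightarrow> 'k) \<Rightarrow> 't \<Rightarrow> 'v" where
  "slice y = (THE \<Phi>. additive \<Phi> \<and> (\<forall>v w. \<Phi> (\<tau> v w) = sc (y w) v))"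

lemma
  assumes y: "Vector_Spaces.linear scw (*) y"
  shows additive_slice: "additive (slice y)"
    and slice_tensor: "slice y (\<tau> v w) = sc (y w) v"
proof -
  have "\<exists>!\<Phi>. additive \<Phi> \<and> (\<forall>v w. \<Phi> (\<tau> v w) = sc (y w) v)"
    by (rule tensor_product_lift_unique[OF tensor_product k.vector_space_axioms])
      (simp_all add: k.scale_right_distrib k.scale_left_distrib linear_simps[OF y] mult.commute)
  from theI'[OF this] show "additive (slice y)" "slice y (\<tau> v w) = sc (y w) v"
    unfolding slice_def by auto
qed

lemma slice_add: "slice y (a + b) = slice y a + slice y b"
  and slice_diff: "slice y (a - b) = slice y a - slice y b"
  and slice_zero: "slice y 0 = 0"
  and slice_sum: "slice y (sum g A) = (\<Sum>i\<in>A. slice y (g i))"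
  if "Vector_Spaces.linear scw (*) y"
  using additive_slice[OF that] by (simp_all add: additive.add additive.diff additive.zero additive.sum)

lemma slice_mult:
  assumes y: "Vector_Spaces.linear scw (*) y"
  shows "slice y (\<tau> r 1 * x) = r * slice y x"
  by (induction x rule: tensor_induct)
    (simp_all add: slice_zero[OF y] slice_tensor[OF y] slice_diff[OF y] tensor_mult
      right_diff_distrib k.mult_scale_right)

definition basis :: "'l set" where "basis = w.extend_basis {}"

lemma independent_basis: "w.independent basis" and span_basis: "w.span basis = UNIV"
  unfolding basis_def
  by (rule w.independent_extend_basis w.span_extend_basis, rule w.independent_empty)+

abbreviation coord :: "'l \<Rightarrow> 'l \<Rightarrow> 'k" where "coord b c \<equiv> w.representation basis c b"

text \<open>
  The sum of the coordinates with index in \<open>M\<close>. It is a linear functional also for infinite \<open>M\<close>, as every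
  element has only finitely many nonzero coordinates; sums of infinitely many slices of an operator
  are obtained in this way.
\<close>

definition coord_sum :: "'l set \<Rightarrow> 'l \<Rightarrow> 'k" where
  "coord_sum M c = (\<Sum>b | coord b c \<noteq> 0 \<and> b \<in> M. coord b c)"

lemma finite_coord: "finite {b. coord b c \<noteq> 0}"
  by (rule w.finite_representation)

lemma linear_coord: "Vector_Spaces.linear scw (*) (coord b)"
  by (rule w.linear_representation) (rule independent_basis span_basis)+

lemma coord_sum_superset:
  assumes "finite X" "{b. coord b c \<noteq> 0} \<subseteq> X"
  shows "coord_sum M c = (\<Sum>b\<in>X \<inter> M. coord b c)"
  unfolding coord_sum_def by (rule sum.mono_neutral_left) (use assms in auto)

lemma linear_coord_sum: "Vector_Spaces.linear scw (*) (coord_sum M)"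
proof -
  {
    fix c d a
    let ?X = "{b. coord b c \<noteq> 0} \<union> {b. coord b d \<noteq> 0}"
    have fin: "finite ?X" by (simp add: finite_coord)
    have "coord_sum M x = (\<Sum>b\<in>?X \<inter> M. coord b x)" if "x \<in> {c, d, c + d, scw a c}" for x
      by (rule coord_sum_superset[OF fin]) (use that in \<open>auto simp: linear_simps[OF linear_coord]\<close>)
    then have "coord_sum M (c + d) = coord_sum M c + coord_sum M d"
      "coord_sum M (scw a c) = a * coord_sum M c"
      by (simp_all add: linear_simps[OF linear_coord] sum.distrib sum_distrib_left)
  }
  then show ?thesis
    unfolding Vector_Spaces.linear_iff using w.vector_space_axioms vector_space_field by auto
qed

text \<open>
  The expansion of an element of the tensor product in the basis of \<open>'l\<close>. The same finite set of
  indices serves for all functionals \<open>coord_sum M\<close>.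
\<close>

lemma slice_expansion:
  "\<exists>X. finite X \<and> (\<forall>b. b \<notin> X \<longrightarrow> slice (coord b) x = 0) \<and>
     x = (\<Sum>b\<in>X. \<tau> (slice (coord b) x) b) \<and>
     (\<forall>M. slice (coord_sum M) x = (\<Sum>b\<in>X \<inter> M. slice (coord b) x))"
proof (induction x rule: tensor_induct)
  case zero
  show ?case
    by (rule exI[of _ "{}"]) (simp add: slice_zero linear_coord linear_coord_sum)
next
  case (tensor v c)
  let ?X = "{b. coord b c \<noteq> 0}"
  have "(\<Sum>b\<in>?X. \<tau> (slice (coord b) (\<tau> v c)) b) = \<tau> v (\<Sum>b\<in>?X. scw (coord b c) b)"
    by (simp add: slice_tensor linear_coord tensor_balanced tensor_sum_right)
  also have "\<dots> = \<tau> v c"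
    by (subst w.sum_nonzero_representation_eq) (simp_all add: independent_basis span_basis)
  finally show ?case
    using coord_sum_superset[OF finite_coord subset_refl, of _ c]
    by (intro exI[of _ ?X])
      (simp add: finite_coord slice_tensor linear_coord linear_coord_sum k.scale_sum_left)
next
  case (diff x y)
  from diff(1) obtain X where X: "finite X" "\<forall>b. b \<notin> X \<longrightarrow> slice (coord b) x = 0"
      "x = (\<Sum>b\<in>X. \<tau> (slice (coord b) x) b)"
      "\<forall>M. slice (coord_sum M) x = (\<Sum>b\<in>X \<inter> M. slice (coord b) x)"
    by blast
  from diff(2) obtain Y where Y: "finite Y" "\<forall>b. b \<notin> Y \<longrightarrow> slice (coord b) y = 0"
      "y = (\<Sum>b\<in>Y. \<tau> (slice (coord b) y) b)"
      "\<forall>M. slice (coord_sum M) y = (\<Sum>b\<in>Y \<inter> M. slice (coord b) y)"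
    by blast
  let ?Z = "X \<union> Y"
  have ext: "(\<Sum>b\<in>X. \<tau> (slice (coord b) x) b) = (\<Sum>b\<in>?Z. \<tau> (slice (coord b) x) b)"
    "(\<Sum>b\<in>Y. \<tau> (slice (coord b) y) b) = (\<Sum>b\<in>?Z. \<tau> (slice (coord b) y) b)"
    "(\<Sum>b\<in>X \<inter> M. slice (coord b) x) = (\<Sum>b\<in>?Z \<inter> M. slice (coord b) x)"
    "(\<Sum>b\<in>Y \<inter> M. slice (coord b) y) = (\<Sum>b\<in>?Z \<inter> M. slice (coord b) y)" for M
    by (rule sum.mono_neutral_left; use X(1,2) Y(1,2) in auto)+
  have td: "\<tau> (p - q) b = \<tau> p b - \<tau> q b" for p q b
    using tensor_add_left[of "p - q" q b] by (simp add: algebra_simps)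
  show ?case
  proof (intro exI[of _ ?Z] conjI allI impI)
    show "finite ?Z" using X(1) Y(1) by simp
    show "slice (coord b) (x - y) = 0" if "b \<notin> ?Z" for b
      using X(2) Y(2) that by (simp add: slice_diff linear_coord)
    have "(\<Sum>b\<in>?Z. \<tau> (slice (coord b) (x - y)) b)
        = (\<Sum>b\<in>?Z. \<tau> (slice (coord b) x) b) - (\<Sum>b\<in>?Z. \<tau> (slice (coord b) y) b)"
      by (simp add: slice_diff linear_coord td sum_subtractf)
    also have "\<dots> = x - y"
      unfolding ext[symmetric] X(3)[symmetric] Y(3)[symmetric] ..
    finally show "x - y = (\<Sum>b\<in>?Z. \<tau> (slice (coord b) (x - y)) b)" ..
    show "slice (coord_sum M) (x - y) = (\<Sum>b\<in>?Z \<inter> M. slice (coord b) (x - y))" for M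
      using X(4) Y(4) ext(3,4) by (simp add: slice_diff linear_coord linear_coord_sum sum_subtractf)
  qed
qed

section \<open>Base change of differential operators\<close>

abbreviation ext where "ext \<equiv> tensor_map \<tau> \<tau>"

context
  fixes \<delta> assumes \<delta>: "Vector_Spaces.linear sc sc \<delta>"
begin

lemma additive_ext: "additive (ext \<delta>)"
  and ext_tensor: "ext \<delta> (\<tau> v w) = \<tau> (\<delta> v) w"
  by (rule tensor_map_rules[OF tensor_product tensor_product l.vector_space_axioms];
      simp add: linear_simps[OF \<delta>])+

lemma ext_tscale: "ext \<delta> (tscale c x) = tscale c (ext \<delta> x)"
  by (induction x rule: tensor_induct)
    (simp_all add: additive.zero[OF additive_ext] ext_tensor tscale_tensor
      l.scale_right_diff_distrib additive.diff[OF additive_ext])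

lemma linear_ext: "Vector_Spaces.linear tscale tscale (ext \<delta>)"
  unfolding Vector_Spaces.linear_iff
  using l.vector_space_axioms additive.add[OF additive_ext] ext_tscale by auto

end

text \<open>
  The tensor product is spanned over \<open>'l\<close> by the tensors \<open>\<tau> v 1\<close>.
\<close>

lemma linear_ext_eqI:
  assumes "Vector_Spaces.linear tscale tscale \<alpha>" "Vector_Spaces.linear tscale tscale \<beta>"
    and "\<And>v. \<alpha> (\<tau> v 1) = \<beta> (\<tau> v 1)"
  shows "\<alpha> = \<beta>"
proof
  fix x show "\<alpha> x = \<beta> x"
  proof (induction x rule: tensor_induct)
    case (tensor v w)
    then show ?case
      using assms(3)[of v] linear_simps(4)[OF assms(1)] linear_simps(4)[OF assms(2)]
      by (subst (1 2) tensor_eq_tscale) simp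
  qed (simp_all add: linear_simps(2,3)[OF assms(1)] linear_simps(2,3)[OF assms(2)])
qed

lemma ext_add:
  assumes "Vector_Spaces.linear sc sc \<alpha>" "Vector_Spaces.linear sc sc \<beta>"
  shows "ext (\<alpha> + \<beta>) = ext \<alpha> + ext \<beta>"
proof (rule linear_ext_eqI)
  show "Vector_Spaces.linear tscale tscale (ext (\<alpha> + \<beta>))"
    by (intro linear_ext k.linear_add_op assms)
  show "Vector_Spaces.linear tscale tscale (ext \<alpha> + ext \<beta>)"
    using l.op.subspace_add[OF l.linear_operators_subspace] linear_ext assms by auto
qed (simp add: ext_tensor assms k.linear_add_op tensor_add_left)

lemma ext_scale:
  assumes "Vector_Spaces.linear sc sc \<alpha>"
  shows "ext (op_scale sc a \<alpha>) = op_scale tscale (scw a 1) (ext \<alpha>)"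
proof (rule linear_ext_eqI)
  show "Vector_Spaces.linear tscale tscale (ext (op_scale sc a \<alpha>))"
    by (intro linear_ext k.linear_scale_op assms)
  show "Vector_Spaces.linear tscale tscale (op_scale tscale (scw a 1) (ext \<alpha>))"
    using l.op.subspace_scale[OF l.linear_operators_subspace] linear_ext assms by auto
  have "ext (op_scale sc a \<alpha>) (\<tau> v 1) = \<tau> (op_scale sc a \<alpha> v) 1" for v
    by (rule ext_tensor[OF k.linear_scale_op[OF assms]])
  then show "ext (op_scale sc a \<alpha>) (\<tau> v 1) = op_scale tscale (scw a 1) (ext \<alpha>) (\<tau> v 1)" for v
    by (simp add: op_scale_def ext_tensor[OF assms] tscale_tensor tensor_balanced)
qed

lemma ext_comp:
  assumes "Vector_Spaces.linear sc sc \<alpha>" "Vector_Spaces.linear sc sc \<beta>"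
  shows "ext (\<alpha> \<circ> \<beta>) = ext \<alpha> \<circ> ext \<beta>"
proof (rule linear_ext_eqI)
  have lin: "Vector_Spaces.linear sc sc (\<alpha> \<circ> \<beta>)"
    using assms Vector_Spaces.linear_compose by blast
  then show "Vector_Spaces.linear tscale tscale (ext (\<alpha> \<circ> \<beta>))"
    by (rule linear_ext)
  show "Vector_Spaces.linear tscale tscale (ext \<alpha> \<circ> ext \<beta>)"
    using linear_ext[OF assms(2)] linear_ext[OF assms(1)] Vector_Spaces.linear_compose by blast
  show "ext (\<alpha> \<circ> \<beta>) (\<tau> v 1) = (ext \<alpha> \<circ> ext \<beta>) (\<tau> v 1)" for v
    by (simp add: ext_tensor lin) (simp add: ext_tensor assms)
qed

lemma ext_mult: "ext (\<lambda>x. r * x) = (\<lambda>x. \<tau> r 1 * x)"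
  by (rule linear_ext_eqI) (simp_all add: linear_ext k.linear_mult l.linear_mult ext_tensor tensor_mult)

lemma op_comm_ext:
  assumes "Vector_Spaces.linear sc sc \<delta>"
  shows "op_comm (ext \<delta>) (\<tau> r c) = op_scale tscale c (ext (op_comm \<delta> r))"
proof (rule linear_ext_eqI)
  show "Vector_Spaces.linear tscale tscale (op_comm (ext \<delta>) (\<tau> r c))"
    by (intro l.linear_op_comm linear_ext assms)
  show "Vector_Spaces.linear tscale tscale (op_scale tscale c (ext (op_comm \<delta> r)))"
    using l.op.subspace_scale[OF l.linear_operators_subspace] linear_ext k.linear_op_comm assms by auto
  have td: "\<tau> (p - q) b = \<tau> p b - \<tau> q b" for p q b
    using tensor_add_left[of "p - q" q b] by (simp add: algebra_simps)
  show "op_comm (ext \<delta>) (\<tau> r c) (\<tau> v 1) = op_scale tscale c (ext (op_comm \<delta> r)) (\<tau> v 1)" for v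
    by (simp add: op_scale_def ext_tensor k.linear_op_comm assms)
      (simp add: op_comm_def ext_tensor assms tensor_mult tscale_tensor td l.scale_right_diff_distrib)
qed

text \<open>
  The commutator of \<open>ext \<delta>\<close> with a general element is a combination of commutators with pure tensors,
  which are extensions of commutators of \<open>\<delta>\<close>.
\<close>

lemma ext_diff_ops_le: "\<delta> \<in> diff_ops_le sc n \<Longrightarrow> ext \<delta> \<in> diff_ops_le tscale n"
proof (induction n arbitrary: \<delta>)
  case 0
  then obtain r where "\<delta> = (\<lambda>x. r * x)" by auto
  then show ?case by (auto simp: ext_mult)
next
  case (Suc n)
  then have \<delta>: "Vector_Spaces.linear sc sc \<delta>" "\<And>r. op_comm \<delta> r \<in> diff_ops_le sc n" by auto
  note lin = linear_ext[OF \<delta>(1)]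
  have "op_comm (ext \<delta>) x \<in> diff_ops_le tscale n" for x
  proof (induction x rule: tensor_induct)
    case zero
    have "op_comm (ext \<delta>) 0 = 0" by (auto simp: op_comm_def linear_simps[OF lin])
    then show ?case using l.zero_diff_ops_le by metis
  next
    case (tensor v w)
    then show ?case
      unfolding op_comm_ext[OF \<delta>(1)] using Suc.IH[OF \<delta>(2)] l.subspace_diff_ops_le
      by (intro l.op.subspace_scale)
  next
    case (diff x y)
    then show ?case
      unfolding l.op_comm_diff_right[OF lin] using l.subspace_diff_ops_le by (intro l.op.subspace_diff)
  qed
  then show ?case using lin by simp
qed

text \<open>
  The restriction of \<open>\<delta>\<close> to \<open>'v\<close>, with values in \<open>'v \<otimes> 'l\<close>, followed by \<open>id \<otimes> y\<close>; for a coordinate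
  functional \<open>y\<close>, a coefficient of \<open>\<delta>\<close>.
\<close>

definition slice_op :: "('l \<Rightarrow> 'k) \<Rightarrow> ('t \<Rightarrow> 't) \<Rightarrow> 'v \<Rightarrow> 'v" where
  "slice_op y \<delta> r = slice y (\<delta> (\<tau> r 1))"

lemma slice_scale:
  assumes "Vector_Spaces.linear scw (*) y"
  shows "slice y (tscale (scw a 1) x) = sc a (slice y x)"
proof (induction x rule: tensor_induct)
  case (tensor v w)
  have "scw a 1 * w = scw a w" using field_algebra by (simp add: comm_algebra_def)
  then show ?case by (simp add: slice_tensor[OF assms] tscale_tensor linear_simps[OF assms])
qed (simp_all add: slice_zero[OF assms] slice_diff[OF assms] l.scale_right_diff_distrib
      k.scale_right_diff_distrib)

text \<open>
  The slice \<open>id \<otimes> y\<close> commutes with multiplication by elements of \<open>'v\<close>, so taking commutators with such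
  elements commutes with passing to slices.
\<close>

lemma slice_op_diff_ops_le:
  assumes y: "Vector_Spaces.linear scw (*) y"
  shows "\<delta> \<in> diff_ops_le tscale n \<Longrightarrow> slice_op y \<delta> \<in> diff_ops_le sc n"
proof (induction n arbitrary: \<delta>)
  case 0
  then obtain z where z: "\<delta> = (\<lambda>x. z * x)" by auto
  have "slice_op y \<delta> = (\<lambda>x. slice y z * x)"
  proof
    show "slice_op y \<delta> r = slice y z * r" for r
      using slice_mult[OF y, of r z] by (simp add: slice_op_def z mult.commute)
  qed
  then show ?case by auto
next
  case (Suc n)
  then have \<delta>: "Vector_Spaces.linear tscale tscale \<delta>" "\<And>r. op_comm \<delta> r \<in> diff_ops_le tscale n" by auto
  have "\<tau> (sc a r) 1 = tscale (scw a 1) (\<tau> r 1)" for a r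
    by (simp add: tensor_balanced tscale_tensor)
  then have "Vector_Spaces.linear sc sc (slice_op y \<delta>)"
    unfolding Vector_Spaces.linear_iff using k.vector_space_axioms
    by (simp add: slice_op_def tensor_add_left linear_simps[OF \<delta>(1)] slice_add[OF y] slice_scale[OF y])
  moreover have "op_comm (slice_op y \<delta>) r = slice_op y (op_comm \<delta> (\<tau> r 1))" for r
    by (auto simp: slice_op_def op_comm_def fun_eq_iff slice_diff[OF y] slice_mult[OF y] tensor_mult)
  ultimately show ?case using Suc.IH \<delta>(2) by simp
qed

lemma slice_op_ext:
  assumes "Vector_Spaces.linear scw (*) y" "Vector_Spaces.linear sc sc \<delta>"
  shows "slice_op y (op_scale tscale c (ext \<delta>)) = op_scale sc (y c) \<delta>"
  by (auto simp: slice_op_def op_scale_def ext_tensor[OF assms(2)] tscale_tensor slice_tensor[OF assms(1)])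

lemma slice_op_sum:
  assumes "Vector_Spaces.linear scw (*) y"
  shows "slice_op y (sum g A) = (\<Sum>a\<in>A. slice_op y (g a))"
  by (auto simp: slice_op_def sum_fun_apply slice_sum[OF assms] fun_eq_iff)

text \<open>
  A functional that does not vanish at \<open>c e\<close> turns a relation over \<open>'l\<close> into one over \<open>'k\<close>.
\<close>

lemma independent_ext:
  assumes B: "finite B" "k.op.independent B" "\<And>\<delta>. \<delta> \<in> B \<Longrightarrow> Vector_Spaces.linear sc sc \<delta>"
    and zero: "(\<Sum>\<delta>\<in>B. op_scale tscale (c \<delta>) (ext \<delta>)) = 0" and e: "e \<in> B"
  shows "c e = 0"
proof (rule ccontr)
  assume "c e \<noteq> 0"
  then obtain y where y: "Vector_Spaces.linear scw (*) y" "y (c e) \<noteq> 0"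
    using nonzero_functional[OF w.vector_space_axioms] by blast
  have "slice_op y (0 :: 't \<Rightarrow> 't) = 0"
    by (auto simp: slice_op_def slice_zero[OF y(1)] fun_eq_iff)
  then have "(\<Sum>\<delta>\<in>B. op_scale sc (y (c \<delta>)) \<delta>) = 0"
    using arg_cong[OF zero, of "slice_op y"] by (simp add: slice_op_sum[OF y(1)] slice_op_ext[OF y(1) B(3)])
  then show False
    using k.op.independentD[OF B(2,1) subset_refl, of "\<lambda>\<delta>. y (c \<delta>)" e] y(2) e by simp
qed

lemma ext_inject:
  assumes "Vector_Spaces.linear sc sc \<alpha>" "Vector_Spaces.linear sc sc \<beta>" "ext \<alpha> = ext \<beta>"
  shows "\<alpha> = \<beta>"
proof -
  obtain y where y: "Vector_Spaces.linear scw (*) y" "y 1 \<noteq> 0"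
    using nonzero_functional[OF w.vector_space_axioms, of 1] by auto
  have "op_scale sc (y 1) \<alpha> = op_scale sc (y 1) \<beta>"
    using slice_op_ext[OF y(1) assms(1), of 1] slice_op_ext[OF y(1) assms(2), of 1] assms(3) by simp
  then show ?thesis using y(2) k.op.scale_cancel_left by blast
qed

lemma l_independent_ext:
  assumes B: "finite B" "k.op.independent B" "\<And>\<delta>. \<delta> \<in> B \<Longrightarrow> Vector_Spaces.linear sc sc \<delta>"
  shows "l.op.independent (ext ` B)" "inj_on ext B"
proof -
  show inj: "inj_on ext B"
    using ext_inject B(3) by (meson inj_onI)
  show "l.op.independent (ext ` B)"
  proof (rule l.op.independent_if_scalars_zero)
    show "finite (ext ` B)" using B(1) by simp
    fix g x assume "(\<Sum>x\<in>ext ` B. op_scale tscale (g x) x) = 0" "x \<in> ext ` B"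
    then show "g x = 0"
      using independent_ext[OF B, of "\<lambda>\<delta>. g (ext \<delta>)"] by (auto simp: sum.reindex[OF inj])
  qed
qed

abbreviation lspan_ext :: "('v \<Rightarrow> 'v) set \<Rightarrow> ('t \<Rightarrow> 't) set" where
  "lspan_ext A \<equiv> l.op.span (ext ` A)"

lemma ext_zero: "ext 0 = 0"
proof -
  have "ext 0 = op_scale tscale 0 (ext 0)"
    using ext_scale[OF k.linear_zero_op, of 0] by (simp only: k.op.scale_zero_left w.scale_zero_left)
  then show ?thesis by (simp only: l.op.scale_zero_left)
qed

lemma lspan_ext_span:
  assumes "\<And>\<delta>. \<delta> \<in> B \<Longrightarrow> Vector_Spaces.linear sc sc \<delta>"
  shows "lspan_ext (k.op.span B) = lspan_ext B"
proof -
  have "Vector_Spaces.linear sc sc \<delta> \<and> ext \<delta> \<in> lspan_ext B" if "\<delta> \<in> k.op.span B" for \<delta>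
    using that
  proof (induction rule: k.op.span_induct_alt)
    case base
    show ?case using k.linear_zero_op ext_zero l.op.span_zero by metis
  next
    case (step c x y)
    have lin: "Vector_Spaces.linear sc sc x" using assms step by blast
    have "ext (op_scale sc c x + y) = op_scale tscale (scw c 1) (ext x) + ext y"
      using step lin by (subst ext_add) (simp_all add: k.linear_scale_op ext_scale)
    also have "\<dots> \<in> lspan_ext B"
      using step by (intro l.op.span_add l.op.span_scale) (auto intro: l.op.span_base)
    finally show ?case using step lin k.linear_add_op k.linear_scale_op by blast
  qed
  then have "lspan_ext (k.op.span B) \<subseteq> lspan_ext B" by (intro l.op.span_minimal) auto
  moreover have "lspan_ext B \<subseteq> lspan_ext (k.op.span B)"
    by (intro l.op.span_mono image_mono k.op.span_superset)
  ultimately show ?thesis by blast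
qed

lemma
  assumes V: "fin_dim_subspace (op_scale sc) V" "\<And>\<delta>. \<delta> \<in> V \<Longrightarrow> Vector_Spaces.linear sc sc \<delta>"
  shows dim_lspan_ext: "l.op.dim (lspan_ext V) = k.op.dim V"
    and fin_dim_lspan_ext: "fin_dim_subspace (op_scale tscale) (lspan_ext V)"
proof -
  obtain B where B: "finite B" "B \<subseteq> V" "k.op.independent B" "V = k.op.span B" "card B = k.op.dim V"
    using fin_dim_subspace_basis[OF k.op.vector_space_axioms V(1)] by blast
  have lin: "Vector_Spaces.linear sc sc \<delta>" if "\<delta> \<in> B" for \<delta> using V(2) B(2) that by blast
  have sp: "lspan_ext V = lspan_ext B"
    unfolding B(4) by (rule lspan_ext_span) (rule lin)
  then show "fin_dim_subspace (op_scale tscale) (lspan_ext V)"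
    unfolding fin_dim_subspace_def using B(1) by blast
  show "l.op.dim (lspan_ext V) = k.op.dim V"
    unfolding sp using l_independent_ext[OF B(1,3) lin]
    by (simp add: l.op.dim_eq_card_independent card_image B(5))
qed

lemma lspan_ext_comp:
  assumes lin: "\<And>\<delta>. \<delta> \<in> A \<union> B \<Longrightarrow> Vector_Spaces.linear sc sc \<delta>"
    and comp: "\<And>\<alpha> \<beta>. \<alpha> \<in> A \<Longrightarrow> \<beta> \<in> B \<Longrightarrow> \<alpha> \<circ> \<beta> \<in> C"
    and \<alpha>: "\<alpha> \<in> lspan_ext A" and \<beta>: "\<beta> \<in> lspan_ext B"
  shows "\<alpha> \<circ> \<beta> \<in> lspan_ext C"
  using \<alpha>
proof (induction rule: l.op.span_induct_alt)
  case base
  have "0 \<circ> \<beta> = 0" by (auto simp: fun_eq_iff)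
  then show ?case using l.op.span_zero by metis
next
  case (step c x y)
  then obtain a where a: "a \<in> A" "x = ext a" by blast
  have linx: "Vector_Spaces.linear tscale tscale x" using a lin linear_ext by blast
  have "x \<circ> \<beta> \<in> lspan_ext C"
    using \<beta>
  proof (induction rule: l.op.span_induct_alt)
    case base
    have "x \<circ> 0 = 0" by (auto simp: fun_eq_iff linear_simps[OF linx])
    then show ?case using l.op.span_zero by metis
  next
    case (step c z \<gamma>)
    then obtain b where b: "b \<in> B" "z = ext b" by blast
    have "x \<circ> (op_scale tscale c z + \<gamma>) = op_scale tscale c (ext (a \<circ> b)) + (x \<circ> \<gamma>)"
      using a b lin linear_simps[OF linx]
      by (simp add: fun_eq_iff op_scale_def ext_comp)
    also have "\<dots> \<in> lspan_ext C"
      using comp[OF a(1) b(1)] by (intro l.op.span_add[OF l.op.span_scale[OF l.op.span_base] step(2)]) blast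
    finally show ?case .
  qed
  moreover have "(op_scale tscale c x + y) \<circ> \<beta> = op_scale tscale c (x \<circ> \<beta>) + (y \<circ> \<beta>)"
    by (auto simp: op_scale_def fun_eq_iff)
  ultimately show ?case
    using step by (metis l.op.span_add l.op.span_scale)
qed

section \<open>The extended filtration\<close>

text \<open>
  A diagonal argument in the style of Baire. The sums \<open>\<Psi> M\<close> of the slices with index in \<open>M\<close> are
  differential operators for every set \<open>M\<close>. If infinitely many slices are nonzero, a set \<open>M\<close> can be built
  in stages such that, at stage \<open>n\<close>, the values of \<open>\<Psi> M\<close> at finitely many points are fixed in such a way
  that they exclude membership in \<open>F n\<close>. Then \<open>\<Psi> M\<close> lies in no \<open>F n\<close>, although the \<open>F n\<close> exhaust the
  operators.
\<close>

lemma finite_slices: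
  assumes fin: "\<And>i. fin_dim_subspace (op_scale sc) (F i)" and exhaust: "(\<Union>i::nat. F i) = diff_ops sc"
    and \<delta>: "\<delta> \<in> diff_ops tscale"
  shows "finite {b. slice_op (coord b) \<delta> \<noteq> 0}" (is "finite ?S")
proof (rule ccontr)
  assume infinite: "infinite ?S"
  define \<Psi> where "\<Psi> M = slice_op (coord_sum M) \<delta>" for M
  obtain n where n: "\<delta> \<in> diff_ops_le tscale n" using \<delta> by (auto simp: diff_ops_def)
  have \<Psi>_diff_op: "\<Psi> M \<in> diff_ops sc" for M
    unfolding \<Psi>_def diff_ops_def using slice_op_diff_ops_le[OF linear_coord_sum n] by auto
  have "\<forall>r. \<exists>X. finite X \<and> (\<forall>b. b \<notin> X \<longrightarrow> slice_op (coord b) \<delta> r = 0) \<and>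
      (\<forall>M. \<Psi> M r = (\<Sum>b\<in>X \<inter> M. slice_op (coord b) \<delta> r))"
    unfolding \<Psi>_def slice_op_def using slice_expansion by blast
  then obtain X where X: "\<And>r. finite (X r)" "\<And>r b. b \<notin> X r \<Longrightarrow> slice_op (coord b) \<delta> r = 0"
    "\<And>r M. \<Psi> M r = (\<Sum>b\<in>X r \<inter> M. slice_op (coord b) \<delta> r)"
    by metis
  \<comment> \<open>A stage is a pair of the part of \<open>M\<close> chosen so far and the set of points at which \<open>\<Psi> M\<close> is fixed:
    elements added to \<open>M\<close> later must not contribute at these points.\<close>
  define P where "P n s \<longleftrightarrow> finite (fst s) \<and> finite (snd s)" for n :: nat and s :: "'l set \<times> 'v set"
  define Q where "Q n s t \<longleftrightarrow> fst s \<subseteq> fst t \<and> snd s \<subseteq> snd t \<and> (\<forall>r\<in>snd s. X r \<inter> fst t \<subseteq> fst s) \<and>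
    (\<forall>\<phi>\<in>F n. \<exists>r\<in>snd t. \<phi> r \<noteq> \<Psi> (fst t) r)" for n :: nat and s t :: "'l set \<times> 'v set"
  have "\<exists>g. \<forall>n. P n (g n) \<and> Q n (g n) (g (Suc n))"
  proof (rule dependent_nat_choice)
    show "\<exists>s. P 0 s" by (rule exI[of _ "({}, {})"]) (simp add: P_def)
    fix s n assume "P n s"
    then obtain M E where s: "s = (M, E)" and fs: "finite M" "finite E"
      by (cases s) (auto simp: P_def)
    obtain B where B: "finite B" "F n = k.op.span B" using fin[of n] by (auto simp: fin_dim_subspace_def)
    obtain E0 where E0: "finite E0" "\<forall>\<phi>\<in>F n. (\<forall>r\<in>E0. \<phi> r = 0) \<longrightarrow> \<phi> = 0"
      using k.separating_points[OF B(1)] B(2) by blast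
    let ?E = "E \<union> E0"
    \<comment> \<open>A new index \<open>b\<close> that does not matter at the points so far. Elements of \<open>F n\<close> are determined by their
      values there, but the sums for \<open>M\<close> and \<open>M \<union> {b}\<close>, which agree there, differ at \<open>t\<close>; so at most one
      of the two can agree with an element of \<open>F n\<close>.\<close>
    have "finite (M \<union> (\<Union>r\<in>?E. X r))" using fs E0(1) X(1) by auto
    then obtain b where b: "b \<in> ?S" "b \<notin> M \<union> (\<Union>r\<in>?E. X r)"
      using infinite by (meson finite_subset subsetI)
    then obtain t where t: "slice_op (coord b) \<delta> t \<noteq> 0" by (auto simp: fun_eq_iff)
    have same: "\<Psi> (insert b M) r = \<Psi> M r" if "r \<in> ?E" for r
    proof -
      have "X r \<inter> insert b M = X r \<inter> M" using b(2) that by blast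
      then show ?thesis by (simp add: X(3))
    qed
    have new: "\<Psi> (insert b M) t \<noteq> \<Psi> M t"
    proof -
      have "b \<in> X t" using t X(2) by blast
      then have "X t \<inter> insert b M = insert b (X t \<inter> M)" by blast
      then show ?thesis using b(2) X(1)[of t] t by (simp add: X(3))
    qed
    have "(\<forall>\<phi>\<in>F n. \<exists>r\<in>insert t ?E. \<phi> r \<noteq> \<Psi> M r) \<or>
      (\<forall>\<phi>\<in>F n. \<exists>r\<in>insert t ?E. \<phi> r \<noteq> \<Psi> (insert b M) r)"
    proof (rule ccontr)
      assume "\<not> ?thesis"
      then obtain \<phi> \<phi>' where \<phi>: "\<phi> \<in> F n" "\<And>r. r \<in> insert t ?E \<Longrightarrow> \<phi> r = \<Psi> M r"
        and \<phi>': "\<phi>' \<in> F n" "\<And>r. r \<in> insert t ?E \<Longrightarrow> \<phi>' r = \<Psi> (insert b M) r" by blast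
      have "\<phi>' - \<phi> \<in> F n" using \<phi>(1) \<phi>'(1) unfolding B(2) by (rule k.op.span_diff[rotated])
      moreover have "\<forall>r\<in>E0. (\<phi>' - \<phi>) r = 0" using \<phi>(2) \<phi>'(2) same by simp
      ultimately have "\<phi>' - \<phi> = 0" using E0(2) by blast
      then have "\<phi>' t = \<phi> t" by simp
      then show False using \<phi>(2)[of t] \<phi>'(2)[of t] new by simp
    qed
    then show "\<exists>s'. P (Suc n) s' \<and> Q n s s'"
    proof
      assume *: "\<forall>\<phi>\<in>F n. \<exists>r\<in>insert t ?E. \<phi> r \<noteq> \<Psi> M r"
      have "P (Suc n) (M, insert t ?E)" using fs E0(1) by (simp add: P_def)
      moreover have "Q n s (M, insert t ?E)"
        unfolding Q_def s fst_conv snd_conv by (intro conjI *) auto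
      ultimately show ?thesis by blast
    next
      assume *: "\<forall>\<phi>\<in>F n. \<exists>r\<in>insert t ?E. \<phi> r \<noteq> \<Psi> (insert b M) r"
      have "P (Suc n) (insert b M, insert t ?E)" using fs E0(1) by (simp add: P_def)
      moreover have "X r \<inter> insert b M \<subseteq> M" if "r \<in> E" for r using b(2) that by blast
      then have "Q n s (insert b M, insert t ?E)"
        unfolding Q_def s fst_conv snd_conv by (intro conjI *) auto
      ultimately show ?thesis by blast
    qed
  qed
  then obtain g where g: "\<And>n. Q n (g n) (g (Suc n))" by blast
  have M_mono: "fst (g m) \<subseteq> fst (g n)" and E_mono: "snd (g m) \<subseteq> snd (g n)" if "m \<le> n" for m n
    using lift_Suc_mono_le[of "\<lambda>n. fst (g n)", OF _ that] lift_Suc_mono_le[of "\<lambda>n. snd (g n)", OF _ that]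
      g by (auto simp: Q_def)
  define M where "M = (\<Union>n. fst (g n))"
  obtain n where n: "\<Psi> M \<in> F n" using \<Psi>_diff_op exhaust by blast
  obtain r where r: "r \<in> snd (g (Suc n))" "\<Psi> M r \<noteq> \<Psi> (fst (g (Suc n))) r"
    using g[of n] n by (auto simp: Q_def)
  have "X r \<inter> fst (g m) \<subseteq> fst (g (Suc n))" if "Suc n \<le> m" for m
    using that
  proof (induction rule: dec_induct)
    case (step m)
    have "r \<in> snd (g m)" using r(1) E_mono[OF step(1)] by blast
    then have "X r \<inter> fst (g (Suc m)) \<subseteq> fst (g m)" using g[of m] unfolding Q_def by blast
    then show ?case using step(3) by blast
  qed simp
  then have "X r \<inter> fst (g m) \<subseteq> fst (g (Suc n))" for m
    using M_mono[of m "Suc n"] by (cases "Suc n \<le> m") auto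
  then have "X r \<inter> M = X r \<inter> fst (g (Suc n))" unfolding M_def by blast
  then show False using r(2) by (simp add: X(3))
qed

text \<open>
  By \<open>finite_slices\<close>, the expansion of an operator in the basis of \<open>'l\<close> is a finite sum of multiples of
  extensions of its slices.
\<close>

lemma diff_ops_tscale:
  assumes F: "alg_filtration sc (diff_ops sc) F" and \<delta>: "\<delta> \<in> diff_ops tscale"
  shows "\<exists>i. \<delta> \<in> lspan_ext (F i)"
proof -
  let ?\<psi> = "\<lambda>b. slice_op (coord b) \<delta>"
  let ?S = "{b. ?\<psi> b \<noteq> 0}"
  have fin: "finite ?S" using finite_slices[OF alg_filtrationD(1,3)[OF F] \<delta>] .
  obtain n where n: "\<delta> \<in> diff_ops_le tscale n" using \<delta> by (auto simp: diff_ops_def)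
  have op: "?\<psi> b \<in> diff_ops sc" for b
    unfolding diff_ops_def using slice_op_diff_ops_le[OF linear_coord n] by auto
  then have "\<forall>b. \<exists>i. ?\<psi> b \<in> F i" using alg_filtrationD(3)[OF F] by blast
  then obtain i where i: "\<And>b. ?\<psi> b \<in> F (i b)" by metis
  define j where "j = Max (i ` ?S)"
  have j: "?\<psi> b \<in> F j" if "b \<in> ?S" for b
    using alg_filtrationD(6)[OF F _ i] fin that by (simp add: j_def)
  have lin: "Vector_Spaces.linear sc sc (?\<psi> b)" for b using op k.diff_ops_linear by blast
  have "\<delta> = (\<Sum>b\<in>?S. op_scale tscale b (ext (?\<psi> b)))"
  proof (rule linear_ext_eqI)
    show "Vector_Spaces.linear tscale tscale \<delta>" using \<delta> by (rule l.diff_ops_linear)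
    show "Vector_Spaces.linear tscale tscale (\<Sum>b\<in>?S. op_scale tscale b (ext (?\<psi> b)))"
      using l.op.subspace_sum[OF l.linear_operators_subspace, of ?S "\<lambda>b. op_scale tscale b (ext (?\<psi> b))"]
        l.op.subspace_scale[OF l.linear_operators_subspace] linear_ext[OF lin] by blast
    show "\<delta> (\<tau> v 1) = (\<Sum>b\<in>?S. op_scale tscale b (ext (?\<psi> b))) (\<tau> v 1)" for v
    proof -
      obtain X where X: "finite X" "\<forall>b. b \<notin> X \<longrightarrow> ?\<psi> b v = 0" "\<delta> (\<tau> v 1) = (\<Sum>b\<in>X. \<tau> (?\<psi> b v) b)"
        using slice_expansion[of "\<delta> (\<tau> v 1)"] unfolding slice_op_def by blast
      have "(\<Sum>b\<in>X. \<tau> (?\<psi> b v) b) = (\<Sum>b\<in>X \<union> ?S. \<tau> (?\<psi> b v) b)"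
        by (rule sum.mono_neutral_left) (use X fin in auto)
      also have "\<dots> = (\<Sum>b\<in>?S. \<tau> (?\<psi> b v) b)"
        by (rule sum.mono_neutral_right) (use X fin in auto)
      finally show ?thesis
        by (simp add: X(3) sum_fun_apply op_scale_def ext_tensor[OF lin] tscale_tensor)
    qed
  qed
  moreover have "\<dots> \<in> lspan_ext (F j)"
    using j by (intro l.op.span_sum l.op.span_scale l.op.span_base) blast
  ultimately show ?thesis by metis
qed

lemma extended_filtration_eq: "extended_filtration \<tau> F i = lspan_ext (F i)"
  by (simp add: extended_filtration_def)

context
  fixes F assumes F: "alg_filtration sc (diff_ops sc) F"
begin

lemma linear_filtration: "\<delta> \<in> F i \<Longrightarrow> Vector_Spaces.linear sc sc \<delta>"
  using alg_filtrationD(7)[OF F] by (auto dest: k.diff_ops_linear)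

lemma ext_sc: "ext (sc a) = tscale (scw a 1)"
proof -
  have "sc a = (\<lambda>x. sc a 1 * x)" by (auto simp: k.mult_scale_left)
  then have "ext (sc a) = (\<lambda>x. \<tau> (sc a 1) 1 * x)" using ext_mult by metis
  then show ?thesis by (auto simp: tensor_scale_def tensor_balanced)
qed

lemma alg_filtration_ext: "alg_filtration tscale (diff_ops tscale) (extended_filtration \<tau> F)"
  unfolding alg_filtration_def
proof (intro conjI allI ballI)
  show "fin_dim_subspace (op_scale tscale) (extended_filtration \<tau> F i)" for i
    unfolding extended_filtration_eq
    by (rule fin_dim_lspan_ext[OF alg_filtrationD(1)[OF F]]) (rule linear_filtration)
  show "mono (extended_filtration \<tau> F)"
    unfolding extended_filtration_eq mono_def
    using alg_filtrationD(6)[OF F] by (intro allI impI l.op.span_mono image_mono) blast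
  show "(\<Union>i. extended_filtration \<tau> F i) = diff_ops tscale"
  proof
    have "ext x \<in> diff_ops tscale" if x: "x \<in> F i" for x i
    proof -
      obtain n where "x \<in> diff_ops_le sc n"
        using alg_filtrationD(7)[OF F x] by (auto simp: diff_ops_def)
      then show ?thesis unfolding diff_ops_def by (intro UN_I[of n] ext_diff_ops_le) simp
    qed
    then have "ext ` F i \<subseteq> diff_ops tscale" for i by blast
    then show "(\<Union>i. extended_filtration \<tau> F i) \<subseteq> diff_ops tscale"
      unfolding extended_filtration_eq by (intro UN_least l.op.span_minimal l.subspace_diff_ops)
    show "diff_ops tscale \<subseteq> (\<Union>i. extended_filtration \<tau> F i)"
      unfolding extended_filtration_eq using diff_ops_tscale[OF F] by blast
  qed
  show "extended_filtration \<tau> F 0 = range tscale"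
  proof
    have "l.op.subspace (range tscale)"
      unfolding l.op.subspace_def
    proof (intro conjI ballI allI)
      have "0 = tscale 0" by (auto simp: fun_eq_iff)
      then show "0 \<in> range tscale" by (metis rangeI)
      show "x + y \<in> range tscale" if "x \<in> range tscale" "y \<in> range tscale" for x y
      proof -
        obtain a b where "x = tscale a" "y = tscale b" using \<open>x \<in> _\<close> \<open>y \<in> _\<close> by blast
        then have "x + y = tscale (a + b)" by (auto simp: fun_eq_iff l.scale_left_distrib)
        then show ?thesis by blast
      qed
      show "op_scale tscale c x \<in> range tscale" if "x \<in> range tscale" for c x
      proof -
        obtain a where "x = tscale a" using \<open>x \<in> _\<close> by blast
        then have "op_scale tscale c x = tscale (c * a)" by (auto simp: op_scale_def)
        then show ?thesis by blast
      qed
    qed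
    then show "extended_filtration \<tau> F 0 \<subseteq> range tscale"
      unfolding extended_filtration_eq alg_filtrationD(4)[OF F]
      by (intro l.op.span_minimal) (auto simp: ext_sc)
    show "range tscale \<subseteq> extended_filtration \<tau> F 0"
    proof
      fix x assume "x \<in> range tscale"
      then obtain c where "x = tscale c" by blast
      have "scw 1 1 = 1" by simp
      then have "x = op_scale tscale c (ext (sc 1))"
        unfolding ext_sc \<open>x = tscale c\<close> by (auto simp: op_scale_def)
      then show "x \<in> extended_filtration \<tau> F 0"
        unfolding extended_filtration_eq alg_filtrationD(4)[OF F]
        by (auto intro!: l.op.span_scale intro: l.op.span_base)
    qed
  qed
  show "\<alpha> \<circ> \<beta> \<in> extended_filtration \<tau> F (i + j)"
    if "\<alpha> \<in> extended_filtration \<tau> F i" "\<beta> \<in> extended_filtration \<tau> F j" for i j \<alpha> \<beta>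
    using that unfolding extended_filtration_eq
    by (rule lspan_ext_comp[rotated 2]) (auto intro: linear_filtration alg_filtrationD(5)[OF F])
qed

lemma dim_extended_filtration: "l.op.dim (extended_filtration \<tau> F i) = k.op.dim (F i)"
  unfolding extended_filtration_eq
  by (rule dim_lspan_ext[OF alg_filtrationD(1)[OF F]]) (rule linear_filtration)

end

end

section \<open>Linear simplicity over \<open>k(s)\<close>\<close>

lemma ratfun_scale_eq: "ratfun_scale a c = to_fract [:a:] * c"
  by (simp add: ratfun_scale_def to_fract_def)

lemma comm_algebra_ratfun_scale: "comm_algebra (ratfun_scale :: 'k::field \<Rightarrow> _)"
proof -
  have add: "to_fract [:a + b:] = to_fract [:a:] + to_fract [:b:]"
    and mult: "to_fract [:a * b:] = to_fract [:a:] * to_fract [:b:]" for a b :: 'k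
    by (simp_all flip: to_fract_add to_fract_mult)
  have one: "to_fract [:1 :: 'k:] = 1" by (metis one_pCons to_fract_1)
  show ?thesis
    unfolding comm_algebra_def
    by (intro conjI allI, unfold_locales)
      (auto simp: ratfun_scale_eq add mult one distrib_left distrib_right mult.assoc)
qed

lemma to_fract_sum: "to_fract (sum g A) = (\<Sum>a\<in>A. to_fract (g a))"
  by (induction A rule: infinite_finite_induct) simp_all

lemma common_denominator:
  assumes "finite A"
  shows "\<exists>d. d \<noteq> 0 \<and> (\<forall>x\<in>A. \<exists>p. to_fract d * x = to_fract p)"
  using assms
proof induction
  case (insert x A)
  then obtain d where d: "d \<noteq> 0" "\<And>x. x \<in> A \<Longrightarrow> \<exists>p. to_fract d * x = to_fract p" by blast
  obtain a b where ab: "x = Fract a b" "b \<noteq> 0" by (cases x)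
  have "to_fract b * x = to_fract a"
    using ab by (simp add: to_fract_def eq_fract)
  then have "to_fract (b * d) * x = to_fract (d * a)"
    by (simp add: mult.commute[of _ x])
  moreover have "\<exists>p. to_fract (b * d) * z = to_fract p" if "z \<in> A" for z
    using d(2)[OF that] by (metis to_fract_mult mult.assoc)
  moreover have "b * d \<noteq> 0" using ab(2) d(1) by simp
  ultimately show ?case by (metis insert_iff)
qed (auto intro: exI[of _ 1])

locale ratfun_extension = scalar_extension sc "ratfun_scale :: 'k \<Rightarrow> 'k poly fract \<Rightarrow> _" \<tau>
  for sc :: "'k::field_char_0 \<Rightarrow> 'v::{comm_ring,comm_monoid_mult} \<Rightarrow> 'v"
    and \<tau> :: "'v \<Rightarrow> 'k poly fract \<Rightarrow> 't::{comm_ring,comm_monoid_mult}"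
begin

text \<open>
  Suppose that a \<open>K\<close>-linear functional \<open>y\<close> vanishes on all \<open>\<alpha> \<delta> \<beta>\<close> but not at \<open>id\<close>. After scaling by
  common denominators, \<open>\<delta>\<close> has polynomial coefficients \<open>q e\<close>, and \<open>y\<close> has polynomial values \<open>Y \<theta>\<close> on the
  operators \<open>\<theta>\<close> of a finite-dimensional piece of the filtration of \<open>R\<close>. Evaluation at a scalar \<open>a\<close>
  gives an operator on \<open>R\<close>, nonzero for almost all \<open>a\<close>, and a functional that vanishes on its products,
  but is nonzero at \<open>id\<close> for almost all \<open>a\<close>. As \<open>k\<close> is infinite, this contradicts linear simplicity
  of the filtration of \<open>R\<close>.
\<close>

lemma linearly_simple_ext:
  assumes F: "alg_filtration sc (diff_ops sc) F" and simple: "linearly_simple sc F"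
  shows "linearly_simple tscale (extended_filtration \<tau> F)"
proof -
  obtain C where C: "C > 0" "\<And>i \<delta>. \<delta> \<in> F i \<Longrightarrow> \<delta> \<noteq> 0 \<Longrightarrow>
      id \<in> k.op.span {\<alpha> \<circ> \<delta> \<circ> \<beta> | \<alpha> \<beta>. \<alpha> \<in> F (C * i) \<and> \<beta> \<in> F (C * i)}"
    using simple unfolding linearly_simple_def by blast
  have "id \<in> l.op.span {\<alpha> \<circ> \<delta> \<circ> \<beta> | \<alpha> \<beta>. \<alpha> \<in> extended_filtration \<tau> F (C * i) \<and>
      \<beta> \<in> extended_filtration \<tau> F (C * i)}" (is "id \<in> l.op.span ?T")
    if \<delta>: "\<delta> \<in> extended_filtration \<tau> F i" "\<delta> \<noteq> 0" for i \<delta>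
  proof (rule ccontr)
    assume "id \<notin> l.op.span ?T"
    then obtain y where y: "Vector_Spaces.linear (op_scale tscale) (*) y" "\<forall>x\<in>l.op.span ?T. y x = 0" "y id = 1"
      using separating_functional[OF l.op.vector_space_axioms l.op.subspace_span] by blast
    note lin = linear_filtration[OF F]
    \<comment> \<open>The products \<open>\<alpha> \<delta> \<beta>\<close> lie in this piece of the filtration.\<close>
    let ?N = "C * i + i + C * i"
    obtain B where B: "finite B" "B \<subseteq> F i" "k.op.independent B" "F i = k.op.span B"
      using fin_dim_subspace_basis[OF k.op.vector_space_axioms alg_filtrationD(1)[OF F]] by metis
    obtain D where D: "finite D" "F ?N = k.op.span D"
      using alg_filtrationD(1)[OF F, of ?N] unfolding fin_dim_subspace_def by blast
    have linB: "Vector_Spaces.linear sc sc e" if "e \<in> B" for e using lin B(2) that by blast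
    have linD: "Vector_Spaces.linear sc sc e" if "e \<in> D" for e
      using lin[of e ?N] that unfolding D(2) by (simp add: k.op.span_base)
    have "\<delta> \<in> l.op.span (ext ` B)"
      using \<delta>(1) unfolding extended_filtration_eq B(4) using lspan_ext_span[of B] linB by blast
    then obtain u where "\<delta> = (\<Sum>e\<in>ext ` B. op_scale tscale (u e) e)"
      unfolding l.op.span_finite[OF finite_imageI[OF B(1)]] by blast
    then have "\<delta> = (\<Sum>e\<in>B. op_scale tscale (u (ext e)) (ext e))"
      using sum.reindex[OF l_independent_ext(2)[of B]] B(1,3) linB by (simp add: o_def)
    then obtain c where c: "\<delta> = (\<Sum>e\<in>B. op_scale tscale (c e) (ext e))"
      by (rule that[of "\<lambda>e. u (ext e)"])
    obtain d where d: "d \<noteq> 0" "\<forall>x\<in>c ` B. \<exists>p. to_fract d * x = to_fract p"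
      using common_denominator[of "c ` B"] B(1) by blast
    then have "\<forall>e\<in>B. \<exists>p. to_fract d * c e = to_fract p" by blast
    then obtain q where q: "\<And>e. e \<in> B \<Longrightarrow> to_fract d * c e = to_fract (q e)"
      using bchoice[of B "\<lambda>e p. to_fract d * c e = to_fract p"] by blast
    obtain g where g: "g \<noteq> 0" "\<forall>x\<in>(\<lambda>e. y (ext e)) ` D. \<exists>p. to_fract g * x = to_fract p"
      using common_denominator[of "(\<lambda>e. y (ext e)) ` D"] D(1) by blast
    define Y where "Y \<theta> = (SOME p. to_fract p = to_fract g * y (ext \<theta>))" for \<theta>
    have "Vector_Spaces.linear sc sc \<theta> \<and> (\<exists>p. to_fract p = to_fract g * y (ext \<theta>))"
      if "\<theta> \<in> k.op.span D" for \<theta>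
      using that
    proof (induction rule: k.op.span_induct_alt)
      case base
      have "to_fract 0 = to_fract g * y (ext 0)" unfolding ext_zero linear_simps(3)[OF y(1)] by simp
      then show ?case using k.linear_zero_op by blast
    next
      case (step a x z)
      have x: "Vector_Spaces.linear sc sc x" using linD step by blast
      obtain p where p: "to_fract p = to_fract g * y (ext x)" using g(2) step(1) by force
      obtain p' where p': "to_fract p' = to_fract g * y (ext z)" using step by blast
      have "y (ext (op_scale sc a x + z)) = ratfun_scale a 1 * y (ext x) + y (ext z)"
        using step x by (simp only: ext_add k.linear_scale_op ext_scale linear_simps[OF y(1)])
      then have "to_fract g * y (ext (op_scale sc a x + z)) = to_fract ([:a:] * p + p')"
        by (simp only: to_fract_add to_fract_mult p p' ratfun_scale_eq) (simp add: algebra_simps)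
      then show ?case using step x k.linear_add_op k.linear_scale_op by metis
    qed
    then have Y: "to_fract (Y \<theta>) = to_fract g * y (ext \<theta>)" if "\<theta> \<in> F ?N" for \<theta>
      using that unfolding Y_def D(2) by (metis (mono_tags, lifting) someI_ex)
    obtain e0 where e0: "e0 \<in> B" "q e0 \<noteq> 0"
    proof (rule ccontr)
      assume "\<not> thesis"
      then have "\<And>e. e \<in> B \<Longrightarrow> c e = 0" using that q d(1) by force
      then have "\<delta> = (\<Sum>e\<in>B. 0)" unfolding c by (intro sum.cong refl) (simp only: l.op.scale_zero_left)
      then show False using \<delta>(2) by simp
    qed
    \<comment> \<open>The factor \<open>q e0\<close> keeps the specialised operator nonzero, and \<open>g\<close> is the value of \<open>Y\<close> at \<open>id\<close>.\<close>
    have "finite {a. poly (q e0 * g) a = 0}" using e0(2) g(1) by (intro poly_roots_finite) simp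
    then have "{a. poly (q e0 * g) a = 0} \<noteq> UNIV" using infinite_UNIV_char_0[where 'a = 'k] by metis
    then obtain a where a: "poly (q e0) a \<noteq> 0" "poly g a \<noteq> 0" by auto
    let ?\<delta> = "\<Sum>e\<in>B. op_scale sc (poly (q e) a) e"
    have sub: "k.op.subspace (F j)" for j
      using fin_dim_subspace_subspace[OF k.op.vector_space_axioms alg_filtrationD(1)[OF F]] .
    have "?\<delta> \<in> F i"
      using B(2) by (intro k.op.subspace_sum[OF sub] k.op.subspace_scale[OF sub]) blast
    moreover have "?\<delta> \<noteq> 0"
      using k.op.independentD[OF B(3,1) subset_refl, of "\<lambda>e. poly (q e) a" e0] e0(1) a(1) by blast
    ultimately have id: "id \<in> k.op.span {\<alpha> \<circ> ?\<delta> \<circ> \<beta> | \<alpha> \<beta>. \<alpha> \<in> F (C * i) \<and> \<beta> \<in> F (C * i)}"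
      by (rule C(2))
    have scale: "poly (Y (op_scale sc b \<theta>)) a = b * poly (Y \<theta>) a" if "\<theta> \<in> F ?N" for b \<theta>
    proof -
      have "to_fract (Y (op_scale sc b \<theta>)) = to_fract ([:b:] * Y \<theta>)"
        using that lin[OF that] k.op.subspace_scale[OF sub that]
        by (simp only: Y ext_scale linear_simps[OF y(1)] to_fract_mult ratfun_scale_eq) simp
      then show ?thesis unfolding to_fract_eq_iff by simp
    qed
    have add: "poly (Y (\<theta> + \<eta>)) a = poly (Y \<theta>) a + poly (Y \<eta>) a" if "\<theta> \<in> F ?N" "\<eta> \<in> F ?N" for \<theta> \<eta>
    proof -
      have "to_fract (Y (\<theta> + \<eta>)) = to_fract (Y \<theta> + Y \<eta>)"
        using that lin[OF that(1)] lin[OF that(2)] k.op.subspace_add[OF sub that]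
        by (simp only: Y ext_add linear_simps[OF y(1)] to_fract_add distrib_left)
      then show ?thesis unfolding to_fract_eq_iff by simp
    qed
    have zero: "poly (Y 0) a = 0"
    proof -
      have "to_fract (Y 0) = to_fract 0"
        using k.op.subspace_0[OF sub] by (simp only: Y ext_zero linear_simps[OF y(1)]) simp
      then show ?thesis unfolding to_fract_eq_iff by simp
    qed
    have sum: "(\<Sum>e\<in>A. h e) \<in> F ?N \<and> poly (Y (\<Sum>e\<in>A. h e)) a = (\<Sum>e\<in>A. poly (Y (h e)) a)"
      if "finite A" "\<And>e. e \<in> A \<Longrightarrow> h e \<in> F ?N" for A and h :: "('v \<Rightarrow> 'v) \<Rightarrow> 'v \<Rightarrow> 'v"
      using that
    proof induction
      case empty
      show ?case using zero k.op.subspace_0[OF sub] by (simp only: sum.empty)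
    next
      case (insert e A)
      then have *: "h e \<in> F ?N" "sum h A \<in> F ?N" "poly (Y (sum h A)) a = (\<Sum>e\<in>A. poly (Y (h e)) a)" by auto
      show ?case
        unfolding sum.insert[OF insert(1,2)] add[OF *(1,2)] *(3)
        using k.op.subspace_add[OF sub *(1,2)] by blast
    qed
    have "x \<in> F ?N \<and> poly (Y x) a = 0" if "x \<in> k.op.span {\<alpha> \<circ> ?\<delta> \<circ> \<beta> | \<alpha> \<beta>. \<alpha> \<in> F (C * i) \<and> \<beta> \<in> F (C * i)}" for x
      using that
    proof (induction rule: k.op.span_induct_alt)
      case base
      show ?case using zero k.op.subspace_0[OF sub] by blast
    next
      case (step b x z)
      then obtain \<alpha> \<beta> where \<alpha>: "\<alpha> \<in> F (C * i)" and \<beta>: "\<beta> \<in> F (C * i)" and x: "x = \<alpha> \<circ> ?\<delta> \<circ> \<beta>" by blast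
      have mem: "\<alpha> \<circ> e \<circ> \<beta> \<in> F ?N" if "e \<in> B" for e
        using alg_filtrationD(5)[OF F alg_filtrationD(5)[OF F \<alpha>, of e i] \<beta>] B(2) that by blast
      have x': "x = (\<Sum>e\<in>B. op_scale sc (poly (q e) a) (\<alpha> \<circ> e \<circ> \<beta>))"
        by (auto simp: x fun_eq_iff sum_fun_apply op_scale_def linear_simps[OF lin[OF \<alpha>]])
      have x_mem: "x \<in> F ?N"
        unfolding x' using mem by (intro k.op.subspace_sum[OF sub] k.op.subspace_scale[OF sub])
      have "poly (Y x) a = (\<Sum>e\<in>B. poly (q e) a * poly (Y (\<alpha> \<circ> e \<circ> \<beta>)) a)"
        unfolding x' using sum[OF B(1), of "\<lambda>e. op_scale sc (poly (q e) a) (\<alpha> \<circ> e \<circ> \<beta>)"] mem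
        by (simp add: k.op.subspace_scale[OF sub] scale)
      also have "\<dots> = poly (\<Sum>e\<in>B. q e * Y (\<alpha> \<circ> e \<circ> \<beta>)) a" by (simp add: poly_sum)
      also have "(\<Sum>e\<in>B. q e * Y (\<alpha> \<circ> e \<circ> \<beta>)) = 0"
      proof -
        have "ext \<alpha> \<circ> \<delta> \<circ> ext \<beta> \<in> ?T"
          using l.op.span_base[OF imageI[OF \<alpha>, of ext]] l.op.span_base[OF imageI[OF \<beta>, of ext]]
          unfolding extended_filtration_eq mem_Collect_eq by blast
        then have "y (ext \<alpha> \<circ> \<delta> \<circ> ext \<beta>) = 0"
          using y(2)[rule_format, OF l.op.span_base] by simp
        moreover have "ext \<alpha> \<circ> \<delta> \<circ> ext \<beta> = (\<Sum>e\<in>B. op_scale tscale (c e) (ext (\<alpha> \<circ> e \<circ> \<beta>)))"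
        proof -
          have "ext (\<alpha> \<circ> e \<circ> \<beta>) = ext \<alpha> \<circ> ext e \<circ> ext \<beta>" if "e \<in> B" for e
            using lin[OF \<alpha>] lin[OF \<beta>] linB[OF that]
              Vector_Spaces.linear_compose[OF linB[OF that] lin[OF \<alpha>]] by (simp add: ext_comp)
          then show ?thesis
            by (auto simp: c fun_eq_iff sum_fun_apply op_scale_def linear_simps[OF linear_ext[OF lin[OF \<alpha>]]])
        qed
        ultimately have "(\<Sum>e\<in>B. c e * y (ext (\<alpha> \<circ> e \<circ> \<beta>))) = 0"
          by (simp add: linear_simps[OF y(1)])
        then have "to_fract d * to_fract g * (\<Sum>e\<in>B. c e * y (ext (\<alpha> \<circ> e \<circ> \<beta>))) = 0" by simp
        also have "to_fract d * to_fract g * (\<Sum>e\<in>B. c e * y (ext (\<alpha> \<circ> e \<circ> \<beta>))) =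
            (\<Sum>e\<in>B. (to_fract d * c e) * (to_fract g * y (ext (\<alpha> \<circ> e \<circ> \<beta>))))"
          by (simp add: sum_distrib_left mult_ac)
        also have "\<dots> = to_fract (\<Sum>e\<in>B. q e * Y (\<alpha> \<circ> e \<circ> \<beta>))"
          unfolding to_fract_sum by (intro sum.cong refl) (simp add: q Y mem)
        finally show ?thesis by (simp only: to_fract_eq_0_iff)
      qed
      finally have "poly (Y x) a = 0" by simp
      then show ?case
        using step x_mem add[of "op_scale sc b x" z] scale[OF x_mem, of b]
          k.op.subspace_add[OF sub k.op.subspace_scale[OF sub x_mem, of b], of z]
          k.op.subspace_scale[OF sub x_mem, of b] by (metis add.right_neutral mult_zero_right)
    qed
    from this[OF id] have "id \<in> F ?N" "poly (Y id) a = 0" by auto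
    have "ext id = id"
      using ext_mult[of 1] tensor_one by (simp add: id_def)
    then have "to_fract (Y id) = to_fract g"
      unfolding Y[OF \<open>id \<in> F ?N\<close>] by (simp add: y(3))
    then show False using \<open>poly (Y id) a = 0\<close> a(2) unfolding to_fract_eq_iff by simp
  qed
  then show ?thesis unfolding linearly_simple_def using C(1) by blast
qed

end

section \<open>Operators with nilpotent commutators\<close>

abbreviation ad_pow :: "'a \<Rightarrow> nat \<Rightarrow> ('a \<Rightarrow> 'a) \<Rightarrow> ('a \<Rightarrow> 'a::{comm_ring,comm_monoid_mult})" where
  "ad_pow g n \<equiv> (\<lambda>\<eta>. op_comm \<eta> g) ^^ n"

lemma ad_pow_Suc: "ad_pow g (Suc n) G = ad_pow g n (op_comm G g)"
  by (simp only: funpow_Suc_right o_apply)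

lemma ad_pow_zero: "ad_pow g n 0 = 0"
  by (induction n) (simp_all only: funpow.simps id_apply o_apply op_comm_zero)

lemma ad_pow_add: "ad_pow g n (G + H) = ad_pow g n G + ad_pow g n H"
  by (induction n) (simp_all only: funpow.simps id_apply o_apply op_comm_add)

lemma ad_pow_ge:
  assumes "ad_pow g n G = 0" "n \<le> m" shows "ad_pow g m G = 0"
  using assms(2,1) by (induction rule: dec_induct) (simp_all only: funpow.simps o_apply op_comm_zero)

lemma op_comm_commute: "op_comm (op_comm G r) s = op_comm (op_comm G s) r"
  by (auto simp: op_comm_def fun_eq_iff algebra_simps)

lemma ad_pow_op_comm: "ad_pow g n (op_comm G r) = op_comm (ad_pow g n G) r"
  by (induction n) (simp_all add: op_comm_commute)

lemma ad_pow_mult_left: "ad_pow g n (\<lambda>x. a * G x) = (\<lambda>x. a * ad_pow g n G x)"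
proof (induction n)
  case (Suc n)
  then show ?case by (auto simp: op_comm_def fun_eq_iff algebra_simps)
qed simp

lemma additive_op_comm: "additive G \<Longrightarrow> additive (op_comm G r)"
  by (auto simp: additive_def op_comm_def algebra_simps)

lemma additive_ad_pow: "additive G \<Longrightarrow> additive (ad_pow g n G)"
  by (induction n) (simp_all add: additive_op_comm)

lemma op_comm_comp:
  "additive G \<Longrightarrow> op_comm (G \<circ> H) g = (op_comm G g \<circ> H) + (G \<circ> op_comm H g)"
  by (auto simp: op_comm_def fun_eq_iff additive.diff)

lemma ad_pow_comp:
  assumes "additive G" "additive H" "ad_pow g n G = 0" "ad_pow g m H = 0"
  shows "ad_pow g (n + m) (G \<circ> H) = 0"
  using assms
proof (induction "n + m" arbitrary: n m G H rule: less_induct)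
  case less
  show ?case
  proof (cases n)
    case 0
    then have "G \<circ> H = 0" using less.prems by (auto simp: fun_eq_iff)
    then show ?thesis by (simp only: ad_pow_zero)
  next
    case n: (Suc n')
    show ?thesis
    proof (cases m)
      case 0
      then have "G \<circ> H = 0" using less.prems additive.zero[OF less.prems(1)] by (auto simp: fun_eq_iff)
      then show ?thesis by (simp only: ad_pow_zero)
    next
      case m: (Suc m')
      have "ad_pow g (n' + m) (op_comm G g \<circ> H) = 0"
      proof (rule less.hyps)
        show "ad_pow g n' (op_comm G g) = 0" using less.prems(3) unfolding n ad_pow_Suc .
      qed (use less.prems n in \<open>simp_all add: additive_op_comm\<close>)
      moreover have "ad_pow g (n + m') (G \<circ> op_comm H g) = 0"
      proof (rule less.hyps)
        show "ad_pow g m' (op_comm H g) = 0" using less.prems(4) unfolding m ad_pow_Suc .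
      qed (use less.prems m in \<open>simp_all add: additive_op_comm\<close>)
      moreover have "n + m = Suc (n' + m)" "n + m' = n' + m" using n m by auto
      ultimately show ?thesis
        by (simp only: ad_pow_Suc op_comm_comp[OF less.prems(1)] ad_pow_add add_0)
    qed
  qed
qed

text \<open>
  For the extension of operators to a localization at \<open>g\<close>, only their commutators with \<open>g\<close> matter. Nilpotency
  of these holds for differential operators, is stable under sums and products, and suffices for
  uniqueness of the extension.
\<close>

definition nilpotent_op :: "'a \<Rightarrow> ('a \<Rightarrow> 'a::{comm_ring,comm_monoid_mult}) \<Rightarrow> bool" where
  "nilpotent_op g G \<longleftrightarrow> additive G \<and> (\<exists>n. ad_pow g n G = 0)"

lemma nilpotent_op_add:
  assumes "nilpotent_op g G" "nilpotent_op g H" shows "nilpotent_op g (G + H)"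
proof -
  obtain n m where "ad_pow g n G = 0" "ad_pow g m H = 0" using assms by (auto simp: nilpotent_op_def)
  then have "ad_pow g (max n m) (G + H) = 0"
    using ad_pow_ge[where n = n and m = "max n m" and G = G] ad_pow_ge[where n = m and m = "max n m" and G = H]
    by (simp only: ad_pow_add max.cobounded1 max.cobounded2 add_0)
  moreover have "additive (G + H)" using assms by (auto simp: nilpotent_op_def additive_def)
  ultimately show ?thesis unfolding nilpotent_op_def by blast
qed

lemma nilpotent_op_uminus: "nilpotent_op g G \<Longrightarrow> nilpotent_op g (- G)"
proof -
  assume G: "nilpotent_op g G"
  have "ad_pow g n (- G) = - ad_pow g n G" for n
  proof -
    have "ad_pow g n (G + - G) = ad_pow g n G + ad_pow g n (- G)" by (rule ad_pow_add)
    then have "ad_pow g n G + ad_pow g n (- G) = 0" by (simp only: add.right_inverse ad_pow_zero)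
    then show ?thesis by (metis add_eq_0_iff)
  qed
  then show ?thesis using G by (auto simp: nilpotent_op_def additive_def)
qed

lemma nilpotent_op_diff:
  "nilpotent_op g G \<Longrightarrow> nilpotent_op g H \<Longrightarrow> nilpotent_op g (G - H)"
  using nilpotent_op_add[OF _ nilpotent_op_uminus] by (metis diff_conv_add_uminus)

lemma nilpotent_op_comp: "nilpotent_op g G \<Longrightarrow> nilpotent_op g H \<Longrightarrow> nilpotent_op g (G \<circ> H)"
  unfolding nilpotent_op_def using ad_pow_comp[where G = G and H = H and g = g] by (auto simp: additive_def)

lemma nilpotent_op_op_comm: "nilpotent_op g G \<Longrightarrow> nilpotent_op g (op_comm G r)"
  unfolding nilpotent_op_def by (auto simp: additive_op_comm ad_pow_op_comm) (metis op_comm_zero)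

lemma nilpotent_op_mult: "nilpotent_op g (\<lambda>x. r * x)"
proof -
  have "ad_pow g 1 (\<lambda>x. r * x) = 0" using op_comm_mult[of r g] by simp
  then show ?thesis unfolding nilpotent_op_def by (metis additive_def distrib_left)
qed

lemma (in commutative_algebra) diff_ops_le_ad_pow:
  "\<delta> \<in> diff_ops_le sc n \<Longrightarrow> ad_pow g (Suc n) \<delta> = 0"
proof (induction n arbitrary: \<delta>)
  case 0
  then obtain r where "\<delta> = (\<lambda>x. r * x)" by auto
  then show ?case using op_comm_mult[of r g] by simp
next
  case (Suc n)
  then have "op_comm \<delta> g \<in> diff_ops_le sc n" by simp
  from Suc.IH[OF this] show ?case by (subst ad_pow_Suc)
qed

lemma (in commutative_algebra) diff_ops_nilpotent:
  assumes "\<delta> \<in> diff_ops sc" shows "nilpotent_op g \<delta>"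
proof -
  obtain n where "\<delta> \<in> diff_ops_le sc n" using assms by (auto simp: diff_ops_def)
  then show ?thesis
    unfolding nilpotent_op_def
    using diff_ops_le_ad_pow linear_simps(1)[OF diff_ops_linear[OF assms]]
    by (blast intro: additive.intro)
qed

section \<open>Extension of operators to a localization\<close>

text \<open>
  The map \<open>j\<close> exhibits \<open>'q\<close> as the localization of \<open>'a\<close> at \<open>g\<close>, and \<open>u\<close> is the inverse of \<open>g\<close>.
\<close>

locale localization =
  fixes g :: "'a::{comm_ring,comm_monoid_mult}"
    and j :: "'a \<Rightarrow> 'q::{comm_ring,comm_monoid_mult}" and u :: 'q
  assumes j_add: "j (x + y) = j x + j y" and j_mult: "j (x * y) = j x * j y" and j_one: "j 1 = 1"
    and g_u: "j g * u = 1"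
    and fraction: "\<exists>x n. z = j x * u ^ n"
    and kernel: "j x = 0 \<Longrightarrow> \<exists>n. g ^ n * x = 0"
begin

lemma additive_j: "additive j"
  using j_add by (rule additive.intro)

lemma j_zero: "j 0 = 0" and j_diff: "j (x - y) = j x - j y"
  using additive.zero[OF additive_j] additive.diff[OF additive_j] by auto

lemma j_pow: "j (x ^ n) = j x ^ n"
  by (induction n) (simp_all add: j_one j_mult)

lemma g_u_pow: "j g ^ n * u ^ n = 1"
  by (induction n) (simp_all add: g_u mult_ac, metis g_u mult.assoc mult.left_commute mult_1_right)

text \<open>
  By induction, the commutator with \<open>g\<close> vanishes, so that \<open>G\<close> is linear over the powers of \<open>g\<close>, and
  multiplication by a power of \<open>g\<close> brings every argument into the image of \<open>j\<close>.
\<close>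

lemma nilpotent_op_eq_0:
  assumes "additive G" "ad_pow (j g) n G = 0" "\<And>v. G (j v) = 0"
  shows "G = 0"
  using assms
proof (induction n arbitrary: G)
  case (Suc n)
  have "op_comm G (j g) = 0"
  proof (rule Suc.IH)
    show "additive (op_comm G (j g))" using Suc.prems(1) by (rule additive_op_comm)
    show "ad_pow (j g) n (op_comm G (j g)) = 0" using Suc.prems(2) by (simp only: ad_pow_Suc)
    show "op_comm G (j g) (j v) = 0" for v
      using Suc.prems(3) by (simp add: op_comm_def flip: j_mult)
  qed
  then have comm: "G (j g * x) = j g * G x" for x
    by (auto simp: op_comm_def fun_eq_iff)
  have comm_pow: "G (j g ^ t * x) = j g ^ t * G x" for t x
    by (induction t) (simp_all add: comm mult.assoc)
  have "G z = 0" for z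
  proof -
    obtain x t where z: "z = j x * u ^ t" using fraction by blast
    have "j g ^ t * G z = G (j x)"
      using g_u_pow[of t] by (simp add: z mult.left_commute flip: comm_pow)
    then have "u ^ t * (j g ^ t * G z) = 0" using Suc.prems(3) by simp
    then have "(j g ^ t * u ^ t) * G z = 0" by (simp only: mult.assoc mult.left_commute)
    then show ?thesis by (simp add: g_u_pow)
  qed
  then show ?case by (auto simp: fun_eq_iff)
qed simp

text \<open>
  Induction on the order of nilpotency. If \<open>H\<close> extends \<open>[\<delta>, g]\<close>, an extension \<open>G\<close> of \<open>\<delta>\<close> should satisfy
  \<open>[G, g] = H\<close>, hence \<open>G (v / g\<^sup>t\<^sup>+\<^sup>1) = (G (v / g\<^sup>t) - H (v / g\<^sup>t\<^sup>+\<^sup>1)) / g\<close>. This recursion on the exponent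
  defines \<open>A v t\<close>, the value at \<open>v / g\<^sup>t\<close>; it is compatible with the expansion of fractions.
\<close>

lemma extension_exists:
  assumes "additive \<delta>" "ad_pow g n \<delta> = 0"
  shows "\<exists>G. additive G \<and> ad_pow (j g) n G = 0 \<and> (\<forall>v. G (j v) = j (\<delta> v))"
  using assms
proof (induction n arbitrary: \<delta>)
  case 0
  then show ?case by (intro exI[of _ 0]) (auto simp: additive_def j_zero)
next
  case (Suc n)
  interpret \<delta>: additive \<delta> by fact
  have "ad_pow g n (op_comm \<delta> g) = 0" using Suc.prems(2) by (simp only: ad_pow_Suc)
  from Suc.IH[OF additive_op_comm[OF Suc.prems(1)] this]
  obtain H where H: "additive H" "ad_pow (j g) n H = 0" "\<And>v. H (j v) = j (op_comm \<delta> g v)" by blast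
  define A where "A v t = rec_nat (j (\<delta> v)) (\<lambda>t a. u * (a - H (j v * u ^ Suc t))) t" for v t
  have A0: "A v 0 = j (\<delta> v)" and AS: "A v (Suc t) = u * (A v t - H (j v * u ^ Suc t))" for v t
    by (simp_all add: A_def)
  have A_add: "A (v + w) t = A v t + A w t" for v w t
    by (induction t) (simp_all add: A0 AS j_add \<delta>.add distrib_right additive.add[OF H(1)] algebra_simps)
  have shift: "A (g * v) (Suc t) = A v t" for v t
  proof (induction t)
    case 0
    have "A (g * v) (Suc 0) = u * (j (\<delta> (g * v)) - H ((j g * u) * j v))"
      by (simp add: A0 AS j_mult mult_ac)
    also have "\<dots> = u * j g * j (\<delta> v)"
      unfolding g_u mult_1_left H(3) op_comm_def by (simp add: j_diff j_mult mult_ac)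
    finally show ?case using g_u by (simp add: A0 mult.commute[of u])
  next
    case (Suc t)
    have "j (g * v) * u ^ Suc (Suc t) = (j g * u) * (j v * u ^ Suc t)" by (simp add: j_mult mult_ac)
    then show ?case using Suc by (simp only: AS[of _ "Suc t"] AS[of v t] g_u mult_1_left)
  qed
  have shift_pow: "A (g ^ m * v) (m + t) = A v t" for m v t
    by (induction m) (simp_all add: shift mult.assoc)
  have frac_shift: "j (g ^ m * v) * u ^ (m + t) = j v * u ^ t" for m v t
  proof -
    have "j (g ^ m * v) * u ^ (m + t) = (j g ^ m * u ^ m) * (j v * u ^ t)"
      by (simp add: j_mult j_pow power_add mult_ac)
    then show ?thesis by (simp add: g_u_pow)
  qed
  have A_wd: "A v t = A w r" if eq: "j v * u ^ t = j w * u ^ r" for v t w r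
  proof -
    have "j (g ^ r * v) * u ^ (r + t) = j (g ^ t * w) * u ^ (t + r)" by (simp only: frac_shift eq)
    moreover have "x * u ^ n * j g ^ n = x" for x n
      using g_u_pow[of n] by (simp add: mult.assoc mult.commute[of "u ^ n"])
    ultimately have "j (g ^ r * v) = j (g ^ t * w)" by (metis add.commute)
    then have "j (g ^ r * v - g ^ t * w) = 0" by (simp add: j_diff)
    then obtain m where m: "g ^ m * (g ^ r * v - g ^ t * w) = 0" using kernel by blast
    then have "g ^ (m + r) * v = g ^ (m + t) * w" by (simp add: power_add algebra_simps)
    then have "A (g ^ (m + r) * v) (m + r + t) = A (g ^ (m + t) * w) (m + t + r)"
      by (simp add: add_ac)
    then show ?thesis by (simp only: shift_pow)
  qed
  define G where "G z = (let (v, t) = (SOME p. z = j (fst p) * u ^ snd p) in A v t)" for z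
  have G: "G (j v * u ^ t) = A v t" for v t
  proof -
    let ?p = "SOME p. j v * u ^ t = j (fst p) * u ^ snd p"
    have "j v * u ^ t = j (fst ?p) * u ^ snd ?p"
      by (rule someI[of "\<lambda>p. j v * u ^ t = j (fst p) * u ^ snd p" "(v, t)"]) simp
    then show ?thesis unfolding G_def by (simp add: case_prod_beta Let_def) (rule A_wd[symmetric])
  qed
  have G_j: "G (j v) = j (\<delta> v)" for v using G[of v 0] by (simp add: A0)
  have add: "G (x + y) = G x + G y" for x y
  proof -
    obtain v t where x: "x = j v * u ^ t" using fraction by blast
    obtain w r where y: "y = j w * u ^ r" using fraction by blast
    have x': "x = j (g ^ r * v) * u ^ (r + t)" unfolding x by (simp only: frac_shift)
    have y': "y = j (g ^ t * w) * u ^ (r + t)"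
      unfolding y using frac_shift[of t w r] by (simp only: add.commute[of r t])
    have "x + y = j (g ^ r * v + g ^ t * w) * u ^ (r + t)" unfolding x' y' by (simp add: j_add distrib_right)
    then have "G (x + y) = A (g ^ r * v) (r + t) + A (g ^ t * w) (r + t)" by (simp only: G A_add)
    then show ?thesis unfolding x' y' G .
  qed
  have comm: "op_comm G (j g) = H"
  proof
    fix x
    obtain v t where "x = j v * u ^ t" using fraction by blast
    then have x: "x = j (g * v) * u ^ Suc t" using frac_shift[of 1 v t] by simp
    have gx: "j g * x = j (g * v) * u ^ t"
    proof -
      have "j g * x = (j g * u) * (j (g * v) * u ^ t)" unfolding x by (simp add: mult_ac)
      then show ?thesis by (simp add: g_u)
    qed
    have "j g * G x = (j g * u) * (A (g * v) t - H x)" unfolding x G AS by (simp only: mult.assoc)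
    then show "op_comm G (j g) x = H x" by (simp add: op_comm_def gx G g_u)
  qed
  show ?case
  proof (intro exI[of _ G] conjI allI)
    show "additive G" using add by (rule additive.intro)
    show "ad_pow (j g) (Suc n) G = 0" by (simp only: ad_pow_Suc comm H(2))
  qed (rule G_j)
qed

definition loc_op :: "('a \<Rightarrow> 'a) \<Rightarrow> 'q \<Rightarrow> 'q" where
  "loc_op \<delta> = (THE G. nilpotent_op (j g) G \<and> (\<forall>v. G (j v) = j (\<delta> v)))"

lemma nilpotent_op_eqI:
  assumes "nilpotent_op (j g) G" "nilpotent_op (j g) H" "\<And>v. G (j v) = H (j v)"
  shows "G = H"
proof -
  have "nilpotent_op (j g) (G - H)" using assms(1,2) by (rule nilpotent_op_diff)
  then obtain n where "additive (G - H)" "ad_pow (j g) n (G - H) = 0" unfolding nilpotent_op_def by blast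
  then have "G - H = 0" by (rule nilpotent_op_eq_0) (simp add: assms(3))
  then show ?thesis by simp
qed

lemma
  assumes "nilpotent_op g \<delta>"
  shows nilpotent_loc_op: "nilpotent_op (j g) (loc_op \<delta>)" and loc_op_j: "loc_op \<delta> (j v) = j (\<delta> v)"
proof -
  have "\<exists>G. nilpotent_op (j g) G \<and> (\<forall>v. G (j v) = j (\<delta> v))"
    using extension_exists assms unfolding nilpotent_op_def by blast
  then have "\<exists>!G. nilpotent_op (j g) G \<and> (\<forall>v. G (j v) = j (\<delta> v))"
    using nilpotent_op_eqI by (metis (no_types, lifting))
  from theI'[OF this] show "nilpotent_op (j g) (loc_op \<delta>)" "loc_op \<delta> (j v) = j (\<delta> v)"
    unfolding loc_op_def by auto
qed

lemma loc_op_eqI: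
  assumes "nilpotent_op g \<delta>" "nilpotent_op (j g) G" "\<And>v. G (j v) = j (\<delta> v)"
  shows "loc_op \<delta> = G"
  by (rule nilpotent_op_eqI[OF nilpotent_loc_op[OF assms(1)] assms(2)]) (simp add: loc_op_j assms)

lemma loc_op_add:
  assumes "nilpotent_op g \<alpha>" "nilpotent_op g \<beta>"
  shows "loc_op (\<alpha> + \<beta>) = loc_op \<alpha> + loc_op \<beta>"
  by (intro loc_op_eqI nilpotent_op_add nilpotent_loc_op assms) (simp add: loc_op_j assms j_add)

lemma loc_op_comp:
  assumes "nilpotent_op g \<alpha>" "nilpotent_op g \<beta>"
  shows "loc_op (\<alpha> \<circ> \<beta>) = loc_op \<alpha> \<circ> loc_op \<beta>"
  by (intro loc_op_eqI nilpotent_op_comp nilpotent_loc_op assms) (simp add: loc_op_j assms)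

lemma loc_op_op_comm:
  assumes "nilpotent_op g \<delta>"
  shows "loc_op (op_comm \<delta> r) = op_comm (loc_op \<delta>) (j r)"
  by (intro loc_op_eqI nilpotent_op_op_comm nilpotent_loc_op assms)
    (simp add: op_comm_def loc_op_j assms j_mult j_diff flip: j_mult)

lemma loc_op_mult: "loc_op (\<lambda>x. r * x) = (\<lambda>x. j r * x)"
  by (intro loc_op_eqI nilpotent_op_mult) (simp add: j_mult)

lemma nilpotent_ad_pow: "nilpotent_op g \<delta> \<Longrightarrow> nilpotent_op g (ad_pow g n \<delta>)"
  by (induction n) (simp_all add: nilpotent_op_op_comm)

lemma loc_op_ad_pow:
  assumes "nilpotent_op g \<delta>"
  shows "loc_op (ad_pow g n \<delta>) = ad_pow (j g) n (loc_op \<delta>)"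
  by (induction n) (simp_all add: loc_op_op_comm nilpotent_ad_pow assms)

text \<open>
  The recursive formula of \<open>ext_op_aux\<close> holds for any extension whose commutators extend the commutators,
  and so it recovers \<open>loc_op \<delta>\<close>.
\<close>

lemma ext_op_aux_eq:
  assumes "commutative_algebra sc" "\<delta> \<in> diff_ops_le sc n"
  shows "ext_op_aux n j g u \<delta> = loc_op \<delta>"
  using assms(2)
proof (induction n arbitrary: \<delta>)
  case 0
  then obtain r where \<delta>: "\<delta> = (\<lambda>x. r * x)" by auto
  show ?case
  proof
    fix x
    have val: "loc_op \<delta> x = j (\<delta> v) * u ^ t" if "x = j v * u ^ t" for v t
      by (simp add: that \<delta> loc_op_mult j_mult mult.assoc)
    obtain v t where "x = j v * u ^ t" using fraction by blast
    then show "ext_op_aux 0 j g u \<delta> x = loc_op \<delta> x"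
      unfolding ext_op_aux.simps using val by (intro the_equality) auto
  qed
next
  case (Suc n)
  interpret commutative_algebra sc by fact
  have "\<delta> \<in> diff_ops sc" using Suc.prems unfolding diff_ops_def by blast
  then have nil: "nilpotent_op g \<delta>" by (rule diff_ops_nilpotent)
  have IH: "ext_op_aux n j g u (op_comm \<delta> r) = op_comm (loc_op \<delta>) (j r)" for r
    using Suc.IH[of "op_comm \<delta> r"] Suc.prems by (simp add: loc_op_op_comm nil)
  show ?case
  proof
    fix x
    have val: "loc_op \<delta> x = (j (\<delta> v) - op_comm (loc_op \<delta>) (j (g ^ t)) x) * u ^ t"
      if x: "x = j v * u ^ t" for v t
    proof -
      have "j (g ^ t) * x = (j g ^ t * u ^ t) * j v" by (simp add: x j_pow mult_ac)
      then have "loc_op \<delta> (j (g ^ t) * x) = j (\<delta> v)" by (simp add: g_u_pow loc_op_j nil)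
      then have "(j (\<delta> v) - op_comm (loc_op \<delta>) (j (g ^ t)) x) * u ^ t = (j g ^ t * u ^ t) * loc_op \<delta> x"
        by (simp add: op_comm_def j_pow mult_ac)
      then show ?thesis by (simp add: g_u_pow)
    qed
    obtain v t where "x = j v * u ^ t" using fraction by blast
    then show "ext_op_aux (Suc n) j g u \<delta> x = loc_op \<delta> x"
      unfolding ext_op_aux.simps IH using val by (intro the_equality) auto
  qed
qed

lemma ext_op_eq:
  assumes "commutative_algebra sc" "\<delta> \<in> diff_ops sc"
  shows "ext_op sc j g u \<delta> = loc_op \<delta>"
  unfolding ext_op_def by (rule ext_op_aux_eq[OF assms(1) commutative_algebra.op_order[OF assms]])

end

section \<open>Conjugation by \<open>f^s\<close>\<close>

instance fract :: ("{idom,ring_char_0}") field_char_0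
proof
  show "inj (of_nat :: nat \<Rightarrow> 'a fract)"
    by (auto simp: inj_on_def of_nat_fract eq_fract)
qed

lemma infinite_range_of_nat: "infinite (range (of_nat :: nat \<Rightarrow> 'l::field_char_0))"
  using inj_of_nat range_inj_infinite by blast

lemma gbinomial_poly: "\<exists>p. \<forall>c :: 'l::field_char_0. poly p c = c gchoose i"
proof (intro exI[of _ "smult (1 / fact i) (\<Prod>k = 0..<i. [:- of_nat k, 1:])"] allI)
  show "poly (smult (1 / fact i) (\<Prod>k = 0..<i. [:- of_nat k, 1:])) c = c gchoose i" for c :: 'l
    by (simp add: gbinomial_prod_rev poly_prod)
qed

context localization
begin

text \<open>
  Conjugation by \<open>g\<close> maps \<open>G\<close> to \<open>G + g\<inverse> [G, g]\<close>. As multiplication by \<open>g\<inverse>\<close> commutes with the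
  commutator, the \<open>n\<close>-fold conjugation is given by the binomial theorem.
\<close>

lemma conjugate_pow:
  assumes vs: "vector_space sc" and scm: "\<And>a x y. sc a x * y = sc a (x * y)" and G: "additive G"
  shows "u ^ n * G (j g ^ n * x) = (\<Sum>i\<le>n. sc (of_nat (n choose i)) (u ^ i * ad_pow (j g) i G x))"
  using G
proof (induction n arbitrary: G)
  interpret vector_space sc by fact
  case 0
  then show ?case by simp
next
  interpret vector_space sc by fact
  case (Suc n)
  let ?D = "\<lambda>x. u * op_comm G (j g) x"
  have D: "additive ?D" using additive_op_comm[OF Suc.prems] by (auto simp: additive_def distrib_left)
  have G': "additive (G + ?D)" using Suc.prems D by (auto simp: additive_def)
  have step: "u * G (j g * y) = (G + ?D) y" for y
    using g_u by (simp add: op_comm_def right_diff_distrib mult.commute[of u] mult.left_commute flip: mult.assoc)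
  have "u ^ Suc n * G (j g ^ Suc n * x) = u ^ n * (G + ?D) (j g ^ n * x)"
    unfolding step[symmetric] by (simp add: mult_ac)
  also have "\<dots> = (\<Sum>i\<le>n. sc (of_nat (n choose i)) (u ^ i * ad_pow (j g) i G x))
      + (\<Sum>i\<le>n. sc (of_nat (n choose i)) (u ^ Suc i * ad_pow (j g) (Suc i) G x))"
  proof -
    have "ad_pow (j g) i (G + ?D) x = ad_pow (j g) i G x + u * ad_pow (j g) (Suc i) G x" for i
      by (simp only: ad_pow_add ad_pow_mult_left plus_fun_apply ad_pow_Suc)
    then show ?thesis
      unfolding Suc.IH[OF G'] sum.distrib[symmetric]
      by (intro sum.cong refl) (simp add: distrib_left scale_right_distrib mult_ac)
  qed
  also have "\<dots> = (\<Sum>i\<le>Suc n. sc (of_nat (Suc n choose i)) (u ^ i * ad_pow (j g) i G x))"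
  proof -
    define w where "w i = u ^ i * ad_pow (j g) i G x" for i
    have "(\<Sum>i\<le>Suc n. sc (of_nat (Suc n choose i)) (w i))
        = w 0 + (\<Sum>i\<le>n. sc (of_nat (n choose Suc i)) (w (Suc i))) + (\<Sum>i\<le>n. sc (of_nat (n choose i)) (w (Suc i)))"
      by (simp add: sum.atMost_Suc_shift scale_left_distrib sum.distrib add_ac del: sum.atMost_Suc)
    also have "w 0 + (\<Sum>i\<le>n. sc (of_nat (n choose Suc i)) (w (Suc i))) = (\<Sum>i\<le>Suc n. sc (of_nat (n choose i)) (w i))"
      by (simp add: sum.atMost_Suc_shift del: sum.atMost_Suc)
    also have "\<dots> = (\<Sum>i\<le>n. sc (of_nat (n choose i)) (w i))" by (simp add: binomial_eq_0)
    finally show ?thesis by (simp add: w_def)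
  qed
  finally show ?case .
qed

text \<open>
  The conjugation \<open>g\<^sup>-\<^sup>c G g\<^sup>c\<close> for a scalar exponent \<open>c\<close>; the binomial series stops as \<open>G\<close> has nilpotent
  commutators. The bound \<open>N\<close> is explicit so that different operators can share it.
\<close>

definition twist :: "('l::field_char_0 \<Rightarrow> 'q \<Rightarrow> 'q) \<Rightarrow> 'l \<Rightarrow> nat \<Rightarrow> ('q \<Rightarrow> 'q) \<Rightarrow> 'q \<Rightarrow> 'q" where
  "twist sc c N G x = (\<Sum>i\<le>N. sc (c gchoose i) (u ^ i * ad_pow (j g) i G x))"

lemma twist_of_nat:
  assumes vs: "vector_space sc" and scm: "\<And>a x y. sc a x * y = sc a (x * y)" and G: "additive G"
    and nil: "ad_pow (j g) (Suc N) G = 0"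
  shows "twist sc (of_nat n) N G x = u ^ n * G (j g ^ n * x)"
proof -
  interpret vector_space sc by fact
  define w where "w i = sc (of_nat (n choose i)) (u ^ i * ad_pow (j g) i G x)" for i
  have w: "w i = 0" if "i > n \<or> i > N" for i
    using that ad_pow_ge[OF nil, of i] by (auto simp: w_def binomial_eq_0 Suc_le_eq)
  have "(\<Sum>i\<le>N. w i) = (\<Sum>i\<le>max n N. w i)"
    by (rule sum.mono_neutral_left) (auto intro: w)
  also have "\<dots> = (\<Sum>i\<le>n. w i)"
    by (rule sum.mono_neutral_right) (auto intro: w)
  finally show ?thesis
    by (simp add: twist_def conjugate_pow[OF vs scm G] w_def flip: binomial_gbinomial)
qed

lemma twist_mono:
  assumes "vector_space sc" "ad_pow (j g) (Suc N) G = 0" "N \<le> M"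
  shows "twist sc c M G x = twist sc c N G x"
proof -
  interpret vector_space sc by fact
  show ?thesis
    unfolding twist_def
  proof (rule sum.mono_neutral_right)
    show "\<forall>i\<in>{..M} - {..N}. sc (c gchoose i) (u ^ i * ad_pow (j g) i G x) = 0"
      using ad_pow_ge[OF assms(2)] by (auto simp: Suc_le_eq)
  qed (use assms(3) in auto)
qed

lemma ad_pow_scale:
  assumes "vector_space sc" and scm: "\<And>a x y. sc a x * y = sc a (x * y)"
    and "\<And>c x. G (sc c x) = sc c (G x)"
  shows "ad_pow r n G (sc c x) = sc c (ad_pow r n G x)"
proof (induction n arbitrary: x)
  case (Suc n)
  interpret vector_space sc by fact
  have "r * sc c x = sc c (r * x)" for x using scm[of c x r] by (simp add: mult.commute)
  then show ?case using Suc by (simp add: op_comm_def scale_right_diff_distrib)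
qed (simp add: assms)

text \<open>
  Both sides are polynomial in \<open>c\<close>, and they agree for natural numbers \<open>c\<close>, where the twist is the
  conjugation by \<open>g\<^sup>c\<close>. A functional that separates the two sides at some \<open>c\<close> would turn their difference
  into a nonzero polynomial with infinitely many roots.
\<close>

lemma twist_comp:
  fixes sc :: "'l::field_char_0 \<Rightarrow> 'q \<Rightarrow> 'q"
  assumes vs: "vector_space sc" and scm: "\<And>a x y. sc a x * y = sc a (x * y)"
    and G: "additive G" "ad_pow (j g) (Suc N) G = 0" "\<And>c x. G (sc c x) = sc c (G x)"
    and H: "additive H" "ad_pow (j g) (Suc N) H = 0"
    and GH: "ad_pow (j g) (Suc N) (G \<circ> H) = 0"
  shows "twist sc c N (G \<circ> H) x = twist sc c N G (twist sc c N H x)"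
proof (rule ccontr)
  interpret vector_space sc by fact
  define w where "w i = u ^ i * ad_pow (j g) i (G \<circ> H) x" for i
  define z where "z l m = u ^ l * ad_pow (j g) l G (u ^ m * ad_pow (j g) m H x)" for l m
  have scm': "x * sc a y = sc a (x * y)" for a x y using scm[of a y x] by (simp add: mult.commute)
  have L: "twist sc c N (G \<circ> H) x = (\<Sum>i\<le>N. sc (c gchoose i) (w i))" for c
    by (simp add: twist_def w_def)
  have R: "twist sc c N G (twist sc c N H x) =
      (\<Sum>l\<le>N. \<Sum>m\<le>N. sc ((c gchoose l) * (c gchoose m)) (z l m))" for c
  proof -
    have "ad_pow (j g) l G (twist sc c N H x) =
        (\<Sum>m\<le>N. sc (c gchoose m) (ad_pow (j g) l G (u ^ m * ad_pow (j g) m H x)))" for l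
    proof -
      define K where "K = ad_pow (j g) l G"
      have "additive K" unfolding K_def by (rule additive_ad_pow) (rule G(1))
      moreover have "K (sc a y) = sc a (K y)" for a y
        unfolding K_def by (rule ad_pow_scale[OF vs scm]) (rule G(3))
      ultimately have "K (twist sc c N H x) = (\<Sum>m\<le>N. sc (c gchoose m) (K (u ^ m * ad_pow (j g) m H x)))"
        unfolding twist_def by (simp only: additive.sum)
      then show ?thesis unfolding K_def .
    qed
    then show ?thesis
      unfolding twist_def[of sc c N G] z_def
      by (simp only: sum_distrib_left scm' scale_sum_right scale_scale)
  qed
  assume ne: "twist sc c N (G \<circ> H) x \<noteq> twist sc c N G (twist sc c N H x)"
  then obtain y where y: "Vector_Spaces.linear sc (*) y"
    "y (twist sc c N (G \<circ> H) x - twist sc c N G (twist sc c N H x)) \<noteq> 0"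
    using nonzero_functional[OF vs] by (metis eq_iff_diff_eq_0)
  obtain b where b: "\<And>i c. poly (b i) c = (c :: 'l) gchoose i"
    using gbinomial_poly by metis
  define P where "P = (\<Sum>i\<le>N. smult (y (w i)) (b i)) - (\<Sum>l\<le>N. \<Sum>m\<le>N. smult (y (z l m)) (b l * b m))"
  have P: "poly P c = y (twist sc c N (G \<circ> H) x - twist sc c N G (twist sc c N H x))" for c
    unfolding L R P_def by (simp add: poly_sum b linear_simps[OF y(1)] mult_ac)
  have "poly P (of_nat n) = 0" for n
  proof -
    have "additive (G \<circ> H)" using G(1) H(1) by (simp add: additive_def)
    then have "twist sc (of_nat n) N (G \<circ> H) x = u ^ n * G (H (j g ^ n * x))"
      by (simp add: twist_of_nat[OF vs scm _ GH])
    moreover have "twist sc (of_nat n) N G (twist sc (of_nat n) N H x)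
        = u ^ n * G ((j g ^ n * u ^ n) * H (j g ^ n * x))"
      by (simp only: twist_of_nat[OF vs scm G(1,2)] twist_of_nat[OF vs scm H] mult.assoc)
    ultimately show ?thesis by (simp add: P g_u_pow linear_simps[OF y(1)])
  qed
  then have "range of_nat \<subseteq> {c. poly P c = 0}" by auto
  then have "P = 0" using infinite_range_of_nat finite_subset poly_roots_finite by metis
  then show False using P[of c] y(2) by simp
qed

text \<open>
  Pascal's rule for the binomial coefficients expresses \<open>G (g\<^sup>c g x) = G (g\<^sup>c\<^sup>+\<^sup>1 x)\<close>.
\<close>

lemma twist_mult_g:
  assumes vs: "vector_space sc" and scm: "\<And>a x y. sc a x * y = sc a (x * y)"
    and nil: "ad_pow (j g) (Suc N) G = 0"
  shows "twist sc c N G (j g * x) = j g * twist sc (c + 1) N G x"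
proof -
  interpret vector_space sc by fact
  define w where "w i = u ^ i * ad_pow (j g) i G x" for i
  have scm': "x * sc a y = sc a (x * y)" for a x y using scm[of a y x] by (simp add: mult.commute)
  have "u ^ i * ad_pow (j g) i G (j g * x) = j g * (w i + w (Suc i))" for i
  proof -
    have "ad_pow (j g) i G (j g * x) = j g * ad_pow (j g) i G x + ad_pow (j g) (Suc i) G x"
      by (simp add: op_comm_def)
    then have "u ^ i * ad_pow (j g) i G (j g * x) = j g * w i + u ^ i * ad_pow (j g) (Suc i) G x"
      by (simp only: distrib_left w_def mult.left_commute)
    also have "u ^ i * ad_pow (j g) (Suc i) G x = (j g * u) * (u ^ i * ad_pow (j g) (Suc i) G x)"
      by (simp only: g_u mult_1_left)
    also have "\<dots> = j g * w (Suc i)" by (simp only: w_def power_Suc mult.assoc)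
    finally show ?thesis by (simp only: distrib_left)
  qed
  then have "twist sc c N G (j g * x) = j g * ((\<Sum>i\<le>N. sc (c gchoose i) (w i)) + (\<Sum>i\<le>N. sc (c gchoose i) (w (Suc i))))"
    unfolding twist_def by (simp add: scale_right_distrib sum.distrib sum_distrib_left distrib_left scm')
  also have "(\<Sum>i\<le>N. sc (c gchoose i) (w i)) + (\<Sum>i\<le>N. sc (c gchoose i) (w (Suc i)))
      = (\<Sum>i\<le>Suc N. sc ((c + 1) gchoose i) (w i))"
  proof -
    have w0: "w (Suc N) = 0" using nil by (simp add: w_def)
    have "(\<Sum>i\<le>N. sc (c gchoose i) (w i)) = (\<Sum>i\<le>Suc N. sc (c gchoose i) (w i))" by (simp add: w0)
    also have "\<dots> = w 0 + (\<Sum>i\<le>N. sc (c gchoose Suc i) (w (Suc i)))"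
      by (simp add: sum.atMost_Suc_shift del: sum.atMost_Suc)
    finally show ?thesis
      unfolding sum.atMost_Suc_shift gbinomial_Suc_Suc scale_left_distrib sum.distrib by (simp add: add_ac)
  qed
  also have "\<dots> = twist sc (c + 1) N G x"
    using nil by (simp add: twist_def w_def)
  finally show ?thesis .
qed

lemma twist_mult_u_pow:
  assumes "vector_space sc" "\<And>a x y. sc a x * y = sc a (x * y)" "ad_pow (j g) (Suc N) G = 0"
  shows "twist sc c N G (u ^ t * x) = u ^ t * twist sc (c - of_nat t) N G x"
proof -
  have g_pow: "twist sc b N G (j g ^ t * y) = j g ^ t * twist sc (b + of_nat t) N G y" for b y
  proof (induction t arbitrary: b)
    case (Suc t)
    then show ?case by (simp add: twist_mult_g[OF assms] mult.assoc add.assoc)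
  qed simp
  have "j g ^ t * (u ^ t * x) = x" using g_u_pow[of t] by (simp only: mult.assoc[symmetric] mult_1_left)
  then have "u ^ t * twist sc (c - of_nat t) N G x = u ^ t * twist sc (c - of_nat t) N G (j g ^ t * (u ^ t * x))"
    by simp
  also have "\<dots> = (j g ^ t * u ^ t) * twist sc c N G (u ^ t * x)"
    unfolding g_pow by (simp add: mult.left_commute mult.assoc)
  finally show ?thesis by (simp add: g_u_pow)
qed

end

section \<open>The module \<open>R_f(s) f^s\<close>\<close>

lemma comm_algebra_localization:
  assumes sc: "comm_algebra sc" and loc: "is_localization f \<iota>"
  shows "comm_algebra (\<lambda>a x. \<iota> (sc a 1) * x)"
proof -
  interpret commutative_algebra sc using sc by (simp add: commutative_algebra_iff)
  have add: "\<iota> (sc (a + b) 1) = \<iota> (sc a 1) + \<iota> (sc b 1)" for a b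
    using loc by (simp add: is_localization_def scale_left_distrib)
  have mult: "\<iota> (sc (a * b) 1) = \<iota> (sc a 1) * \<iota> (sc b 1)" for a b
  proof -
    have "sc (a * b) 1 = sc a 1 * sc b 1" by (simp add: mult_scale_left)
    then show ?thesis using loc by (simp add: is_localization_def)
  qed
  have one: "\<iota> 1 = 1" using loc by (simp add: is_localization_def)
  show ?thesis
    unfolding comm_algebra_def
    by (intro conjI allI, unfold_locales) (auto simp: add mult one distrib_left distrib_right mult.assoc)
qed

locale fs_module = R: ratfun_extension sc \<tau> + Rf: ratfun_extension "\<lambda>a x. \<iota> (sc a 1) * x" \<tau>\<^sub>f
  for sc :: "'k::field_char_0 \<Rightarrow> 'r::{comm_ring,comm_monoid_mult} \<Rightarrow> 'r" and f :: 'r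
    and \<iota> :: "'r \<Rightarrow> 'q::{comm_ring,comm_monoid_mult}"
    and \<tau> :: "'r \<Rightarrow> 'k poly fract \<Rightarrow> 'rs::{comm_ring,comm_monoid_mult}"
    and \<tau>\<^sub>f :: "'q \<Rightarrow> 'k poly fract \<Rightarrow> 'qs::{comm_ring,comm_monoid_mult}" +
  assumes loc: "is_localization f \<iota>"
begin

lemma \<iota>_add: "\<iota> (x + y) = \<iota> x + \<iota> y" and \<iota>_mult: "\<iota> (x * y) = \<iota> x * \<iota> y" and \<iota>_one: "\<iota> 1 = 1"
  and \<iota>_unit: "\<exists>u. \<iota> f * u = 1" and \<iota>_fraction: "\<exists>x n. z * \<iota> f ^ n = \<iota> x"
  and \<iota>_eq_iff: "\<iota> x = \<iota> y \<longleftrightarrow> (\<exists>n. f ^ n * x = f ^ n * y)"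
  using loc unfolding is_localization_def by blast+

lemma \<iota>_zero: "\<iota> 0 = 0"
  using \<iota>_add[of 0 0] by (metis add_cancel_right_right add_0)

lemma \<iota>_scale: "\<iota> (sc a x) = \<iota> (sc a 1) * \<iota> x"
  using R.k.mult_scale_left[of a 1 x] by (simp flip: \<iota>_mult)

definition j :: "'rs \<Rightarrow> 'qs" where "j = tensor_map \<tau> \<tau>\<^sub>f \<iota>"

lemma additive_j: "additive j" and j_tensor: "j (\<tau> v w) = \<tau>\<^sub>f (\<iota> v) w"
  unfolding j_def
  by (rule tensor_map_rules[OF R.tensor_product Rf.tensor_product Rf.l.vector_space_axioms];
      simp add: \<iota>_add flip: \<iota>_scale)+

definition finv :: 'q where "finv = (SOME v. \<iota> f * v = 1)"

lemma \<iota>_finv: "\<iota> f * finv = 1"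
  unfolding finv_def using \<iota>_unit by (rule someI_ex)

lemma \<iota>_finv_pow: "\<iota> f ^ n * finv ^ n = 1"
proof (induction n)
  case (Suc n)
  have "\<iota> f ^ Suc n * finv ^ Suc n = (\<iota> f * finv) * (\<iota> f ^ n * finv ^ n)" by (simp add: mult_ac)
  then show ?case using Suc \<iota>_finv by simp
qed simp

lemma \<tau>\<^sub>f_pow: "\<tau>\<^sub>f x 1 ^ n = \<tau>\<^sub>f (x ^ n) 1"
  by (induction n) (simp_all add: Rf.tensor_one Rf.tensor_mult)

lemma \<tau>_pow: "\<tau> x 1 ^ n = \<tau> (x ^ n) 1"
  by (induction n) (simp_all add: R.tensor_one R.tensor_mult)

abbreviation u :: 'qs where "u \<equiv> \<tau>\<^sub>f finv 1"

lemma pure_fraction: "\<exists>x n. \<tau>\<^sub>f q c = \<tau>\<^sub>f (\<iota> x) c * u ^ n"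
proof -
  obtain x n where x: "q * \<iota> f ^ n = \<iota> x" using \<iota>_fraction by blast
  have "\<iota> x * finv ^ n = q * (\<iota> f ^ n * finv ^ n)" by (simp add: mult.assoc flip: x)
  then have "q = \<iota> x * finv ^ n" by (simp add: \<iota>_finv_pow)
  then show ?thesis
    by (intro exI[of _ x] exI[of _ n]) (simp add: \<tau>\<^sub>f_pow Rf.tensor_mult)
qed

text \<open>
  Slices are natural in the first tensor factor, so they reduce the kernel of \<open>j\<close> to the kernel of \<open>\<iota>\<close>.
\<close>

lemma slice_j:
  assumes y: "Vector_Spaces.linear ratfun_scale (*) y"
  shows "Rf.slice y (j x) = \<iota> (R.slice y x)"
proof -
  have diff: "\<iota> (a - b) = \<iota> a - \<iota> b" for a b
    using \<iota>_add by (intro additive.diff additive.intro)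
  show ?thesis
    by (induction x rule: R.tensor_induct)
      (simp_all add: additive.zero[OF additive_j] additive.diff[OF additive_j] R.slice_zero[OF y]
        Rf.slice_zero[OF y] R.slice_diff[OF y] Rf.slice_diff[OF y] \<iota>_zero diff j_tensor
        R.slice_tensor[OF y] Rf.slice_tensor[OF y] \<iota>_scale[symmetric])
qed

text \<open>
  \<open>R\<^sub>f(s)\<close> is the localization of \<open>R(s)\<close> at \<open>f\<close>. For the kernel, an element is expanded in a basis of \<open>k(s)\<close>:
  its finitely many coefficients are killed by powers of \<open>f\<close>.
\<close>

sublocale loc: localization "\<tau> f 1" j u
proof
  show "j (x + y) = j x + j y" for x y by (rule additive.add[OF additive_j])
  note j_simps = additive.zero[OF additive_j] additive.diff[OF additive_j] j_tensor
  show "j (x * y) = j x * j y" for x y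
  proof (induction x rule: R.tensor_induct)
    case (tensor p c)
    show ?case
      by (induction y rule: R.tensor_induct)
        (simp_all add: j_simps R.tensor_mult Rf.tensor_mult \<iota>_mult right_diff_distrib)
  qed (simp_all add: j_simps left_diff_distrib)
  show "j 1 = 1"
    using j_tensor[of 1 1] by (simp add: R.tensor_one Rf.tensor_one \<iota>_one)
  show gu: "j (\<tau> f 1) * u = 1"
    by (simp add: j_tensor Rf.tensor_mult \<iota>_finv Rf.tensor_one)
  show "\<exists>x n. z = j x * u ^ n" for z
  proof (induction z rule: Rf.tensor_induct)
    case zero
    show ?case by (intro exI[of _ 0]) (simp add: j_simps)
  next
    case (tensor q c)
    then show ?case using pure_fraction by (metis j_tensor)
  next
    case (diff x y)
    then obtain p n q m where x: "x = j p * u ^ n" and y: "y = j q * u ^ m" by blast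
    have gun: "j (\<tau> (f ^ k) 1) * u ^ k = 1" for k
    proof -
      have "\<iota> (f ^ k) = \<iota> f ^ k" by (induction k) (simp_all add: \<iota>_one \<iota>_mult)
      then show ?thesis by (simp add: j_tensor \<tau>\<^sub>f_pow Rf.tensor_mult \<iota>_finv_pow Rf.tensor_one)
    qed
    have jm: "j (\<tau> r 1 * z) = j (\<tau> r 1) * j z" for r z
      by (induction z rule: R.tensor_induct)
        (simp_all add: j_simps R.tensor_mult Rf.tensor_mult \<iota>_mult right_diff_distrib)
    have "x = j (\<tau> (f ^ m) 1 * p) * u ^ (m + n)"
    proof -
      have "j (\<tau> (f ^ m) 1 * p) * u ^ (m + n) = (j (\<tau> (f ^ m) 1) * u ^ m) * (j p * u ^ n)"
        unfolding jm power_add by (simp only: mult_ac)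
      then show ?thesis by (simp add: gun x)
    qed
    moreover have "y = j (\<tau> (f ^ n) 1 * q) * u ^ (m + n)"
    proof -
      have "j (\<tau> (f ^ n) 1 * q) * u ^ (m + n) = (j (\<tau> (f ^ n) 1) * u ^ n) * (j q * u ^ m)"
        unfolding jm power_add by (simp only: mult_ac)
      then show ?thesis by (simp add: gun y)
    qed
    ultimately have "x - y = j (\<tau> (f ^ m) 1 * p - \<tau> (f ^ n) 1 * q) * u ^ (m + n)"
      by (simp add: j_simps left_diff_distrib)
    then show ?case by blast
  qed
  show "\<exists>n. \<tau> f 1 ^ n * x = 0" if x: "j x = 0" for x
  proof -
    obtain X where X: "finite X" "x = (\<Sum>b\<in>X. \<tau> (R.slice (R.coord b) x) b)"
      using R.slice_expansion by blast
    have "\<exists>n. f ^ n * R.slice (R.coord b) x = 0" for b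
    proof -
      have "\<iota> (R.slice (R.coord b) x) = \<iota> 0"
        by (simp add: slice_j[OF R.linear_coord, symmetric] x Rf.slice_zero[OF R.linear_coord] \<iota>_zero)
      then show ?thesis unfolding \<iota>_eq_iff by simp
    qed
    then obtain n where n: "\<And>b. f ^ n b * R.slice (R.coord b) x = 0" by metis
    define N where "N = (\<Sum>b\<in>X. n b)"
    have N: "f ^ N * R.slice (R.coord b) x = 0" if "b \<in> X" for b
    proof -
      have "N = (N - n b) + n b" using that X(1) by (simp add: N_def member_le_sum)
      then have "f ^ N = f ^ (N - n b) * f ^ n b" by (metis power_add)
      then show ?thesis by (simp add: mult.assoc n)
    qed
    have "\<tau> f 1 ^ N * x = (\<Sum>b\<in>X. \<tau> (f ^ N * R.slice (R.coord b) x) b)"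
      by (subst X(2)) (simp add: \<tau>_pow sum_distrib_left R.tensor_mult)
    also have "\<dots> = 0" using N by simp
    finally show ?thesis by blast
  qed
qed

abbreviation "D \<equiv> diff_ops (tensor_scale \<tau>)"
abbreviation "act \<equiv> fs_act f \<iota> \<tau> \<tau>\<^sub>f"
abbreviation "T \<equiv> loc.twist (tensor_scale \<tau>\<^sub>f)"

lemma binom_s_eq: "binom_s i = (ratfun_s :: 'k poly fract) gchoose i"
  by (simp add: binom_s_def gbinomial_prod_rev lessThan_atLeast0)

lemma op_order_le: "\<delta> \<in> diff_ops_le sc' n \<Longrightarrow> op_order sc' \<delta> \<le> n"
  unfolding op_order_def by (rule Least_le)

lemma D_nilpotent: "\<delta> \<in> D \<Longrightarrow> nilpotent_op (\<tau> f 1) \<delta>"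
  by (rule R.l.diff_ops_nilpotent)

lemma D_ad_pow: "\<delta> \<in> D \<Longrightarrow> ad_pow (\<tau> f 1) n \<delta> \<in> D"
proof (induction n)
  case (Suc n)
  then obtain m where m: "ad_pow (\<tau> f 1) n \<delta> \<in> diff_ops_le (tensor_scale \<tau>) m"
    unfolding diff_ops_def by blast
  then have "ad_pow (\<tau> f 1) n \<delta> \<in> diff_ops_le (tensor_scale \<tau>) (Suc m)"
    using R.l.diff_ops_le_Suc by blast
  then show ?case unfolding diff_ops_def by auto
qed simp

lemma loc_op_nil:
  assumes "\<delta> \<in> diff_ops_le (tensor_scale \<tau>) N"
  shows "ad_pow (j (\<tau> f 1)) (Suc N) (loc.loc_op \<delta>) = 0"
proof -
  have "\<delta> \<in> D" using assms unfolding diff_ops_def by blast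
  have "loc.loc_op (\<lambda>x. 0 * x) = (\<lambda>x. j 0 * x)" by (rule loc.loc_op_mult)
  then have "loc.loc_op 0 = 0" by (simp add: loc.j_zero zero_fun_def)
  then show ?thesis
    using loc.loc_op_ad_pow[OF D_nilpotent[OF \<open>\<delta> \<in> D\<close>], of "Suc N"] R.l.diff_ops_le_ad_pow[OF assms]
    by metis
qed

text \<open>
  The commutator with a scalar extends the zero operator.
\<close>

lemma loc_op_scale:
  assumes "\<delta> \<in> D"
  shows "loc.loc_op \<delta> (tensor_scale \<tau>\<^sub>f c x) = tensor_scale \<tau>\<^sub>f c (loc.loc_op \<delta> x)"
proof -
  have "op_comm \<delta> (\<tau> 1 c) = (\<lambda>x. 0 * x)"
    using linear_simps(4)[OF R.l.diff_ops_linear[OF assms], of c]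
    by (auto simp: op_comm_def tensor_scale_def fun_eq_iff)
  then have "op_comm (loc.loc_op \<delta>) (j (\<tau> 1 c)) = (\<lambda>x. j 0 * x)"
    using loc.loc_op_op_comm[OF D_nilpotent[OF assms], of "\<tau> 1 c"] loc.loc_op_mult[of 0] by simp
  then have "op_comm (loc.loc_op \<delta>) (\<tau>\<^sub>f 1 c) x = 0"
    by (simp add: j_tensor \<iota>_one loc.j_zero)
  then show ?thesis by (simp add: op_comm_def tensor_scale_def)
qed

lemma additive_loc_op: "\<delta> \<in> D \<Longrightarrow> additive (loc.loc_op \<delta>)"
  using loc.nilpotent_loc_op[OF D_nilpotent] unfolding nilpotent_op_def by blast

text \<open>
  The action is the extension to \<open>R\<^sub>f(s)\<close> followed by the conjugation with \<open>f\<^sup>s\<close>. Any bound for the order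
  can take the place of the order.
\<close>

lemma act_eq:
  assumes "\<delta> \<in> diff_ops_le (tensor_scale \<tau>) N"
  shows "act \<delta> x = T ratfun_s N (loc.loc_op \<delta>) x"
proof -
  have D: "\<delta> \<in> D" using assms unfolding diff_ops_def by blast
  have inv: "(THE u. \<tau>\<^sub>f (\<iota> f) 1 * u = 1) = u"
  proof (rule the_equality)
    show 1: "\<tau>\<^sub>f (\<iota> f) 1 * u = 1" using loc.g_u by (simp add: j_tensor)
    show "w = u" if "\<tau>\<^sub>f (\<iota> f) 1 * w = 1" for w
    proof -
      have "w = (\<tau>\<^sub>f (\<iota> f) 1 * u) * w" by (simp add: 1)
      also have "\<dots> = (\<tau>\<^sub>f (\<iota> f) 1 * w) * u" by (simp add: mult_ac)
      finally show ?thesis by (simp add: that)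
    qed
  qed
  have ext: "ext_op (tensor_scale \<tau>) j (\<tau> f 1) u (ad_pow (\<tau> f 1) i \<delta>) =
      ad_pow (j (\<tau> f 1)) i (loc.loc_op \<delta>)" for i
    using loc.ext_op_eq[OF R.l.commutative_algebra_axioms D_ad_pow[OF D]]
      loc.loc_op_ad_pow[OF D_nilpotent[OF D]] by simp
  have "act \<delta> x = T ratfun_s (op_order (tensor_scale \<tau>) \<delta>) (loc.loc_op \<delta>) x"
    unfolding fs_act_def Let_def inv j_def[symmetric] ext loc.twist_def binom_s_eq ..
  also have "\<dots> = T ratfun_s N (loc.loc_op \<delta>) x"
    by (rule loc.twist_mono[symmetric, OF Rf.l.vector_space_axioms])
      (rule loc_op_nil[OF R.l.op_order[OF D]], rule op_order_le[OF assms])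
  finally show ?thesis .
qed

lemma T_add: "T c N (G + H) x = T c N G x + T c N H x"
  by (simp add: loc.twist_def ad_pow_add distrib_left Rf.l.scale_right_distrib sum.distrib)

lemma act_mult: "act (\<lambda>x. r * x) y = j r * y"
proof -
  have "(\<lambda>x. r * x) \<in> diff_ops_le (tensor_scale \<tau>) 0" by auto
  from act_eq[OF this] show ?thesis
    by (simp add: loc.twist_def loc.loc_op_mult)
qed

lemma act_add_right:
  assumes "\<delta> \<in> D"
  shows "act \<delta> (x + y) = act \<delta> x + act \<delta> y"
proof -
  have "ad_pow (j (\<tau> f 1)) i (loc.loc_op \<delta>) (x + y) =
    ad_pow (j (\<tau> f 1)) i (loc.loc_op \<delta>) x + ad_pow (j (\<tau> f 1)) i (loc.loc_op \<delta>) y" for i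
    by (rule additive.add[OF additive_ad_pow[OF additive_loc_op[OF assms]]])
  then show ?thesis
    by (simp add: act_eq[OF R.l.op_order[OF assms]] loc.twist_def distrib_left
        Rf.l.scale_right_distrib sum.distrib)
qed

lemma act_scale_right:
  assumes "\<delta> \<in> D"
  shows "act \<delta> (tensor_scale \<tau>\<^sub>f c x) = tensor_scale \<tau>\<^sub>f c (act \<delta> x)"
proof -
  have "ad_pow (j (\<tau> f 1)) i (loc.loc_op \<delta>) (tensor_scale \<tau>\<^sub>f c x) =
    tensor_scale \<tau>\<^sub>f c (ad_pow (j (\<tau> f 1)) i (loc.loc_op \<delta>) x)" for i
    by (rule loc.ad_pow_scale) (rule Rf.l.vector_space_axioms Rf.l.mult_scale_left loc_op_scale[OF assms])+
  then show ?thesis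
    by (simp add: act_eq[OF R.l.op_order[OF assms]] loc.twist_def Rf.l.mult_scale_right
        Rf.l.scale_sum_right mult.commute)
qed

lemma left_module_act:
  assumes F: "alg_filtration (tensor_scale \<tau>) D F"
  shows "left_module D act"
  unfolding left_module_def
proof (intro conjI ballI allI)
  show "act \<alpha> (x + y) = act \<alpha> x + act \<alpha> y" if "\<alpha> \<in> D" for \<alpha> x y
    using that by (rule act_add_right)
  fix \<alpha> \<beta> x assume \<alpha>: "\<alpha> \<in> D" and \<beta>: "\<beta> \<in> D"
  have add: "\<alpha> + \<beta> \<in> D" using R.l.op.subspace_add[OF R.l.subspace_diff_ops \<alpha> \<beta>] .
  have comp: "\<alpha> \<circ> \<beta> \<in> D"
  proof -
    obtain i k where "\<alpha> \<in> F i" "\<beta> \<in> F k"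
      using \<alpha> \<beta> unfolding alg_filtrationD(3)[OF F, symmetric] by blast
    then show ?thesis using alg_filtrationD(7)[OF F alg_filtrationD(5)[OF F]] by blast
  qed
  obtain N where N: "\<alpha> \<in> diff_ops_le (tensor_scale \<tau>) N" "\<beta> \<in> diff_ops_le (tensor_scale \<tau>) N"
    "\<alpha> + \<beta> \<in> diff_ops_le (tensor_scale \<tau>) N" "\<alpha> \<circ> \<beta> \<in> diff_ops_le (tensor_scale \<tau>) N"
  proof -
    let ?o = "op_order (tensor_scale \<tau>)"
    let ?N = "max (max (?o \<alpha>) (?o \<beta>)) (max (?o (\<alpha> + \<beta>)) (?o (\<alpha> \<circ> \<beta>)))"
    have "\<delta> \<in> diff_ops_le (tensor_scale \<tau>) ?N" if "\<delta> \<in> D" "?o \<delta> \<le> ?N" for \<delta>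
      using R.l.op_order[OF that(1)] R.l.diff_ops_le_mono[OF that(2)] by blast
    then show ?thesis using \<alpha> \<beta> add comp by (intro that[of ?N]) simp_all
  qed
  show "act (\<alpha> + \<beta>) x = act \<alpha> x + act \<beta> x"
    by (simp only: act_eq[OF N(1)] act_eq[OF N(2)] act_eq[OF N(3)] T_add
        loc.loc_op_add[OF D_nilpotent[OF \<alpha>] D_nilpotent[OF \<beta>]])
  show "act (\<alpha> \<circ> \<beta>) x = act \<alpha> (act \<beta> x)"
    unfolding act_eq[OF N(1)] act_eq[OF N(2)] act_eq[OF N(4)]
      loc.loc_op_comp[OF D_nilpotent[OF \<alpha>] D_nilpotent[OF \<beta>]]
  proof (rule loc.twist_comp)
    show "ad_pow (j (\<tau> f 1)) (Suc N) (loc.loc_op \<alpha> \<circ> loc.loc_op \<beta>) = 0"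
      using loc_op_nil[OF N(4)] unfolding loc.loc_op_comp[OF D_nilpotent[OF \<alpha>] D_nilpotent[OF \<beta>]] .
  qed (rule Rf.l.vector_space_axioms Rf.l.mult_scale_left additive_loc_op[OF \<alpha>] loc_op_nil[OF N(1)]
      loc_op_scale[OF \<alpha>] additive_loc_op[OF \<beta>] loc_op_nil[OF N(2)])+
next
  show "act id m = m" for m
    using act_mult[of 1 m] by (simp add: id_def loc.j_one)
qed

lemma act_scale_eq: "act_scale (tensor_scale \<tau>) act = tensor_scale \<tau>\<^sub>f"
proof (intro ext)
  fix c x
  have "tensor_scale \<tau> c = (\<lambda>x. \<tau> 1 c * x)" by (auto simp: tensor_scale_def)
  then show "act_scale (tensor_scale \<tau>) act c x = tensor_scale \<tau>\<^sub>f c x"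
    by (simp add: act_scale_def act_mult j_tensor \<iota>_one) (simp add: tensor_scale_def)
qed

section \<open>A filtration of \<open>R_f(s) f^s\<close>\<close>

text \<open>
  The element \<open>x / f\<^sup>t\<close> of \<open>R\<^sub>f(s)\<close>.
\<close>

definition frac :: "nat \<Rightarrow> 'r \<Rightarrow> 'qs" where "frac t x = u ^ t * \<tau>\<^sub>f (\<iota> x) 1"

lemma frac_eq: "frac t x = u ^ t * j (\<tau> x 1)"
  by (simp add: frac_def j_tensor)

lemma frac_add: "frac t (x + y) = frac t x + frac t y"
  by (simp add: frac_def \<iota>_add Rf.tensor_add_left distrib_left)

lemma frac_scale: "frac t (sc a x) = tensor_scale \<tau>\<^sub>f (ratfun_scale a 1) (frac t x)"
  unfolding frac_def \<iota>_scale[of a x] Rf.tensor_balanced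
  by (simp add: Rf.l.mult_scale_right[symmetric] Rf.tscale_tensor)

lemma frac_shift: "frac t x = frac (t + n) (f ^ n * x)"
proof -
  have "\<iota> (f ^ n) = \<iota> f ^ n" by (induction n) (simp_all add: \<iota>_one \<iota>_mult)
  then have "\<tau>\<^sub>f (\<iota> (f ^ n * x)) 1 = \<tau>\<^sub>f (\<iota> f ^ n) 1 * \<tau>\<^sub>f (\<iota> x) 1"
    by (simp add: \<iota>_mult Rf.tensor_mult)
  then have "frac (t + n) (f ^ n * x) = u ^ t * (u ^ n * (\<tau>\<^sub>f (\<iota> f ^ n) 1 * \<tau>\<^sub>f (\<iota> x) 1))"
    by (simp add: frac_def power_add mult.assoc)
  also have "\<dots> = u ^ t * ((u ^ n * \<tau>\<^sub>f (\<iota> f ^ n) 1) * \<tau>\<^sub>f (\<iota> x) 1)" by (simp only: mult.assoc)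
  also have "u ^ n * \<tau>\<^sub>f (\<iota> f ^ n) 1 = 1"
    by (simp add: \<tau>\<^sub>f_pow Rf.tensor_mult mult.commute[of "finv ^ n"] \<iota>_finv_pow Rf.tensor_one)
  finally show ?thesis by (simp add: frac_def)
qed

lemma span_frac:
  "Rf.l.span (frac t ` R.k.span B) = Rf.l.span (frac t ` B)"
proof
  have "frac t x \<in> Rf.l.span (frac t ` B)" if "x \<in> R.k.span B" for x
    using that
  proof (induction rule: R.k.span_induct_alt)
    case base
    have "frac t 0 = 0" by (simp add: frac_def \<iota>_zero)
    then show ?case by (simp add: Rf.l.span_zero)
  next
    case (step c x y)
    then show ?case
      by (simp add: frac_add frac_scale Rf.l.span_add Rf.l.span_scale Rf.l.span_base)
  qed
  then show "Rf.l.span (frac t ` R.k.span B) \<subseteq> Rf.l.span (frac t ` B)"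
    by (intro Rf.l.span_minimal) auto
  show "Rf.l.span (frac t ` B) \<subseteq> Rf.l.span (frac t ` R.k.span B)"
    by (intro Rf.l.span_mono image_mono R.k.span_superset)
qed

lemma act_scale_left:
  assumes "alg_filtration (tensor_scale \<tau>) D F'" "\<delta> \<in> D"
  shows "act (op_scale (tensor_scale \<tau>) c \<delta>) x = tensor_scale \<tau>\<^sub>f c (act \<delta> x)"
proof -
  have sc: "tensor_scale \<tau> c = (\<lambda>x. \<tau> 1 c * x)" by (auto simp: tensor_scale_def)
  then have "tensor_scale \<tau> c \<in> D" using R.l.mult_in_diff_ops by metis
  moreover have "op_scale (tensor_scale \<tau>) c \<delta> = tensor_scale \<tau> c \<circ> \<delta>" by (auto simp: op_scale_def)
  ultimately have "act (op_scale (tensor_scale \<tau>) c \<delta>) x = act (tensor_scale \<tau> c) (act \<delta> x)"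
    using left_module_act[OF assms(1)] assms(2) by (simp add: left_module_def)
  also have "\<dots> = act_scale (tensor_scale \<tau>) act c (act \<delta> x)" by (simp add: act_scale_def)
  finally show ?thesis unfolding act_scale_eq .
qed

context
  fixes F and G :: "nat \<Rightarrow> 'r set" and C a :: nat
  assumes F: "alg_filtration sc (diff_ops sc) F"
    and G: "compatible_filtration sc F (\<lambda>\<delta> m. \<delta> m) G"
    and C: "C > 0" "\<And>i. F i \<subseteq> diff_ops_le sc (C * i)"
    and a: "(\<lambda>x. f * x) \<in> F a"
begin

text \<open>
  An operator in \<open>F i\<close> has order at most \<open>C i\<close>, so it adds at most \<open>C i\<close> to the exponent of the denominator;
  writing all fractions with denominator \<open>f\<^sup>C\<^sup>i\<close> multiplies numerators by up to \<open>C i\<close> factors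
  \<open>f\<close>, each of which raises the degree by \<open>a\<close>. Hence the slope \<open>1 + a C\<close>.
\<close>

definition fs_filtration :: "nat \<Rightarrow> 'qs set" where
  "fs_filtration i = Rf.l.span (frac (C * i) ` G ((1 + a * C) * i))"

lemma G_subspace: "R.k.subspace (G i)"
  using fin_dim_subspace_subspace[OF R.k.vector_space_axioms] compatible_filtrationD(1)[OF G]
  unfolding act_scale_id by blast

lemma G_pow: "x \<in> G m \<Longrightarrow> f ^ n * x \<in> G (n * a + m)"
proof (induction n)
  case (Suc n)
  then have "f * (f ^ n * x) \<in> G (a + (n * a + m))"
    using compatible_filtrationD(4)[OF G a] by simp
  then show ?case by (simp add: mult.assoc add.assoc)
qed simp

lemma G_ad_pow:
  assumes "\<epsilon> \<in> F i"
  shows "x \<in> G m \<Longrightarrow> ad_pow f l \<epsilon> x \<in> G (i + l * a + m)"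
proof (induction l arbitrary: x m)
  case 0
  then show ?case using compatible_filtrationD(4)[OF G assms] by simp
next
  case (Suc l)
  have "f * x \<in> G (a + m)" using compatible_filtrationD(4)[OF G a Suc.prems] .
  from Suc.IH[OF this] have 1: "ad_pow f l \<epsilon> (f * x) \<in> G (i + Suc l * a + m)"
    by (simp add: add_ac)
  have 2: "f * ad_pow f l \<epsilon> x \<in> G (i + Suc l * a + m)"
    using compatible_filtrationD(4)[OF G a Suc.IH[OF Suc.prems]] by (simp add: add_ac)
  show ?case using R.k.subspace_diff[OF G_subspace 1 2] by (simp add: op_comm_def)
qed

lemma frac_mem:
  assumes "x \<in> G m" "t \<le> C * i" "(C * i - t) * a + m \<le> (1 + a * C) * i"
  shows "frac t x \<in> fs_filtration i"
proof -
  have "frac t x = frac (C * i) (f ^ (C * i - t) * x)"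
    using frac_shift[of t x "C * i - t"] assms(2) by simp
  moreover have "f ^ (C * i - t) * x \<in> G ((1 + a * C) * i)"
    using compatible_filtrationD(5)[OF G assms(3) G_pow[OF assms(1)]] .
  ultimately show ?thesis unfolding fs_filtration_def by (auto intro: Rf.l.span_base)
qed

lemma fs_filtration_subspace: "Rf.l.subspace (fs_filtration i)"
  unfolding fs_filtration_def by (rule Rf.l.subspace_span)

lemma fs_filtration_mono: "mono fs_filtration"
  unfolding mono_iff_le_Suc
proof
  fix i
  have "frac (C * i) x \<in> fs_filtration (Suc i)" if "x \<in> G ((1 + a * C) * i)" for x
    by (rule frac_mem[OF that]) (simp_all add: algebra_simps)
  then show "fs_filtration i \<le> fs_filtration (Suc i)"
    unfolding fs_filtration_def[of i] by (intro Rf.l.span_minimal fs_filtration_subspace) auto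
qed

lemma fs_filtration_exhaustive: "(\<Union>i. fs_filtration i) = UNIV"
proof -
  have "\<exists>i. z \<in> fs_filtration i" for z
  proof (induction z rule: Rf.tensor_induct)
    case zero
    show ?case using Rf.l.subspace_0[OF fs_filtration_subspace] by blast
  next
    case (tensor q c)
    obtain x n where x: "\<tau>\<^sub>f q c = \<tau>\<^sub>f (\<iota> x) c * u ^ n" using pure_fraction by blast
    obtain m where m: "x \<in> G m" using compatible_filtrationD(3)[OF G] by blast
    have "n \<le> C * (m + n)" using C(1) by (metis One_nat_def Suc_leI le_add2 mult_le_mono1 nat_mult_1 order_trans)
    moreover have "(C * (m + n) - n) * a + m \<le> (1 + a * C) * (m + n)"
    proof -
      have "(C * (m + n) - n) * a \<le> C * (m + n) * a" by simp
      then show ?thesis by (simp add: algebra_simps)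
    qed
    ultimately have "frac n x \<in> fs_filtration (m + n)" by (rule frac_mem[OF m])
    then have "tensor_scale \<tau>\<^sub>f c (frac n x) \<in> fs_filtration (m + n)"
      by (rule Rf.l.subspace_scale[OF fs_filtration_subspace])
    moreover have "tensor_scale \<tau>\<^sub>f c (frac n x) = \<tau>\<^sub>f q c"
      unfolding x frac_def Rf.l.mult_scale_right[symmetric] Rf.tscale_tensor by (simp add: mult.commute)
    ultimately show ?case by auto
  next
    case (diff x y)
    then obtain i k where "x \<in> fs_filtration i" "y \<in> fs_filtration k" by blast
    then have "x \<in> fs_filtration (max i k)" "y \<in> fs_filtration (max i k)"
      using monoD[OF fs_filtration_mono, of i "max i k"] monoD[OF fs_filtration_mono, of k "max i k"] by auto
    then show ?case using Rf.l.subspace_diff[OF fs_filtration_subspace] by blast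
  qed
  then show ?thesis by blast
qed

lemma ad_pow_ext:
  assumes "Vector_Spaces.linear sc sc \<epsilon>"
  shows "ad_pow (\<tau> f 1) l (R.ext \<epsilon>) = R.ext (ad_pow f l \<epsilon>) \<and> Vector_Spaces.linear sc sc (ad_pow f l \<epsilon>)"
proof (induction l)
  case (Suc l)
  then have lin: "Vector_Spaces.linear sc sc (ad_pow f l \<epsilon>)" by blast
  have "op_comm (R.ext (ad_pow f l \<epsilon>)) (\<tau> f 1) = R.ext (op_comm (ad_pow f l \<epsilon>) f)"
    using R.op_comm_ext[OF lin, of f 1] by (simp add: R.l.op.scale_one)
  then show ?case using Suc R.k.linear_op_comm[OF lin] by simp
qed (use assms in simp)

text \<open>
  The action on \<open>x / f\<^sup>t f\<^sup>s\<close> is the action on \<open>x f\<^sup>s\<^sup>-\<^sup>t\<close>, that is, a combination of the fractions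
  \<open>ad(f)\<^sup>l(\<epsilon>)(x) / f\<^sup>t\<^sup>+\<^sup>l\<close>. Each of the \<open>l\<close> commutators uses up one factor \<open>f\<close> of the allowance in the degree.
\<close>

lemma act_ext_frac:
  assumes \<epsilon>: "\<epsilon> \<in> F i" and x: "x \<in> G ((1 + a * C) * k)"
  shows "act (R.ext \<epsilon>) (frac (C * k) x) \<in> fs_filtration (i + k)"
proof -
  have ord: "R.ext \<epsilon> \<in> diff_ops_le (tensor_scale \<tau>) (C * i)"
    using R.ext_diff_ops_le C(2) \<epsilon> by blast
  then have DD: "R.ext \<epsilon> \<in> D" unfolding diff_ops_def by blast
  have lin: "Vector_Spaces.linear sc sc \<epsilon>" using R.linear_filtration[OF F \<epsilon>] .
  let ?s = "ratfun_s - of_nat (C * k)"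
  have adj: "ad_pow (j (\<tau> f 1)) l (loc.loc_op (R.ext \<epsilon>)) (j (\<tau> x 1)) = j (\<tau> (ad_pow f l \<epsilon> x) 1)" for l
  proof -
    have "ad_pow (j (\<tau> f 1)) l (loc.loc_op (R.ext \<epsilon>)) (j (\<tau> x 1)) = loc.loc_op (ad_pow (\<tau> f 1) l (R.ext \<epsilon>)) (j (\<tau> x 1))"
      by (simp only: loc.loc_op_ad_pow[OF D_nilpotent[OF DD]])
    also have "\<dots> = j (ad_pow (\<tau> f 1) l (R.ext \<epsilon>) (\<tau> x 1))"
      by (rule loc.loc_op_j[OF D_nilpotent[OF D_ad_pow[OF DD]]])
    finally show ?thesis
      using ad_pow_ext[OF lin, of l] R.ext_tensor[of "ad_pow f l \<epsilon>" x 1] by simp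
  qed
  have "act (R.ext \<epsilon>) (frac (C * k) x)
      = u ^ (C * k) * T ?s (C * i) (loc.loc_op (R.ext \<epsilon>)) (j (\<tau> x 1))"
    unfolding act_eq[OF ord] frac_eq
    by (rule loc.twist_mult_u_pow[OF Rf.l.vector_space_axioms Rf.l.mult_scale_left loc_op_nil[OF ord]])
  also have "\<dots> = (\<Sum>l\<le>C * i. tensor_scale \<tau>\<^sub>f (?s gchoose l) (frac (C * k + l) (ad_pow f l \<epsilon> x)))"
    unfolding loc.twist_def adj sum_distrib_left frac_eq Rf.l.mult_scale_right power_add
    by (simp only: mult.assoc)
  also have "\<dots> \<in> fs_filtration (i + k)"
  proof (intro Rf.l.subspace_sum[OF fs_filtration_subspace] Rf.l.subspace_scale[OF fs_filtration_subspace])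
    fix l assume "l \<in> {..C * i}"
    then have l: "l \<le> C * i" by simp
    show "frac (C * k + l) (ad_pow f l \<epsilon> x) \<in> fs_filtration (i + k)"
    proof (rule frac_mem[OF G_ad_pow[OF \<epsilon> x]])
      show "C * k + l \<le> C * (i + k)" using l by (simp add: algebra_simps)
      have "C * (i + k) - (C * k + l) = C * i - l" by (simp add: algebra_simps)
      moreover have "(C * i - l) * a + l * a = C * i * a"
        using l by (simp flip: add_mult_distrib)
      ultimately show "(C * (i + k) - (C * k + l)) * a + (i + l * a + (1 + a * C) * k) \<le> (1 + a * C) * (i + k)"
        by (simp add: algebra_simps)
    qed
  qed
  finally show ?thesis .
qed

lemma compatible_fs_filtration:
  "compatible_filtration (tensor_scale \<tau>) (extended_filtration \<tau> F) act fs_filtration"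
  unfolding compatible_filtration_def act_scale_eq
proof (intro conjI allI ballI)
  note F' = R.alg_filtration_ext[OF F]
  show "mono fs_filtration" by (rule fs_filtration_mono)
  show "(\<Union>i. fs_filtration i) = UNIV" by (rule fs_filtration_exhaustive)
  show "fin_dim_subspace (tensor_scale \<tau>\<^sub>f) (fs_filtration i)" for i
  proof -
    obtain B where "finite B" "G ((1 + a * C) * i) = R.k.span B"
      using compatible_filtrationD(1)[OF G] unfolding act_scale_id fin_dim_subspace_def by blast
    then show ?thesis
      unfolding fin_dim_subspace_def fs_filtration_def using span_frac by (metis finite_imageI)
  qed
  fix i k \<delta> m assume \<delta>: "\<delta> \<in> extended_filtration \<tau> F i" and m: "m \<in> fs_filtration k"
  have gen: "act \<delta> (frac (C * k) x) \<in> fs_filtration (i + k) \<and> \<delta> \<in> D" if x: "x \<in> G ((1 + a * C) * k)" for x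
    using \<delta> unfolding R.extended_filtration_eq
  proof (induction rule: R.l.op.span_induct_alt)
    case base
    have 0: "(0 :: 'rs \<Rightarrow> 'rs) = (\<lambda>x. 0 * x)" by (auto simp: fun_eq_iff)
    have "act 0 (frac (C * k) x) = 0" unfolding 0 act_mult by (simp add: loc.j_zero)
    then show ?case
      using Rf.l.subspace_0[OF fs_filtration_subspace] R.l.op.subspace_0[OF R.l.subspace_diff_ops] by metis
  next
    case (step c \<alpha> \<beta>)
    then obtain \<epsilon> where \<epsilon>: "\<epsilon> \<in> F i" "\<alpha> = R.ext \<epsilon>" by blast
    have \<alpha>: "\<alpha> \<in> D"
      using R.ext_diff_ops_le C(2) \<epsilon> unfolding diff_ops_def by blast
    have c\<alpha>: "op_scale (tensor_scale \<tau>) c \<alpha> \<in> D"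
      using R.l.op.subspace_scale[OF R.l.subspace_diff_ops \<alpha>] .
    have sum: "op_scale (tensor_scale \<tau>) c \<alpha> + \<beta> \<in> D"
      using R.l.op.subspace_add[OF R.l.subspace_diff_ops c\<alpha>] step by blast
    have "act (op_scale (tensor_scale \<tau>) c \<alpha> + \<beta>) (frac (C * k) x)
        = tensor_scale \<tau>\<^sub>f c (act \<alpha> (frac (C * k) x)) + act \<beta> (frac (C * k) x)"
      using left_module_act[OF F'] c\<alpha> step(2) act_scale_left[OF F' \<alpha>] unfolding left_module_def by metis
    also have "\<dots> \<in> fs_filtration (i + k)"
      using step(2) act_ext_frac[OF \<epsilon>(1) x] unfolding \<epsilon>(2)
      by (intro Rf.l.subspace_add[OF fs_filtration_subspace] Rf.l.subspace_scale[OF fs_filtration_subspace]) auto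
    finally show ?case using sum by blast
  qed
  have \<delta>D: "\<delta> \<in> D" using \<delta> alg_filtrationD(7)[OF F'] by blast
  show "act \<delta> m \<in> fs_filtration (i + k)"
    using m unfolding fs_filtration_def[of k]
  proof (induction rule: Rf.l.span_induct_alt)
    case base
    have "act \<delta> (tensor_scale \<tau>\<^sub>f 0 0) = tensor_scale \<tau>\<^sub>f 0 (act \<delta> 0)" by (rule act_scale_right[OF \<delta>D])
    then have "act \<delta> 0 = 0" by simp
    then show ?case using Rf.l.subspace_0[OF fs_filtration_subspace] by simp
  next
    case (step c x y)
    then have "act \<delta> x \<in> fs_filtration (i + k)" using gen by blast
    then show ?case
      using step(2) by (simp add: act_add_right[OF \<delta>D] act_scale_right[OF \<delta>D]
          Rf.l.subspace_add[OF fs_filtration_subspace] Rf.l.subspace_scale[OF fs_filtration_subspace])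
  qed
qed

lemma dim_fs_filtration: "Rf.l.dim (fs_filtration i) \<le> R.k.dim (G ((1 + a * C) * i))"
proof -
  obtain B where B: "finite B" "G ((1 + a * C) * i) = R.k.span B" "card B = R.k.dim (G ((1 + a * C) * i))"
    using fin_dim_subspace_basis[OF R.k.vector_space_axioms] compatible_filtrationD(1)[OF G]
    unfolding act_scale_id by metis
  have "fs_filtration i \<subseteq> Rf.l.span (frac (C * i) ` B)"
    unfolding fs_filtration_def B(2) span_frac ..
  then have "Rf.l.dim (fs_filtration i) \<le> card (frac (C * i) ` B)"
    using B(1) by (intro Rf.l.dim_le_card) auto
  also have "\<dots> \<le> card B" by (rule card_image_le[OF B(1)])
  finally show ?thesis by (simp only: B(3))
qed

end

end

section \<open>Bernstein's inequality\<close>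

text \<open>
  The element \<open>m\<close> lies in some \<open>G a\<close>. If \<open>\<delta>\<close> in \<open>F i\<close> kills \<open>G (C i + a)\<close>, it kills all \<open>\<beta> m\<close> with \<open>\<beta>\<close> in
  \<open>F (C i)\<close>; as \<open>id\<close> is a combination of products \<open>\<alpha> \<delta> \<beta>\<close> if \<open>\<delta>\<close> is nonzero, this would give \<open>m = 0\<close>. So
  \<open>F i\<close> embeds into the linear maps from \<open>G (C i + a)\<close> to \<open>G ((C + 1) i + a)\<close>, here written as
  matrices.
\<close>

lemma dim_product_bound:
  fixes sc :: "'k::field \<Rightarrow> 'r::{comm_ring,comm_monoid_mult} \<Rightarrow> 'r"
    and act :: "('r \<Rightarrow> 'r) \<Rightarrow> 'm \<Rightarrow> 'm::ab_group_add" and m :: 'm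
  assumes "vector_space sc" and vm: "vector_space (act_scale sc act)"
    and lin: "\<And>\<delta>. \<delta> \<in> A \<Longrightarrow> Vector_Spaces.linear sc sc \<delta>"
    and F: "alg_filtration sc A F" and simple: "linearly_simple sc F" and mod: "left_module A act"
    and G: "compatible_filtration sc F act G" and m: "m \<noteq> 0"
  shows "\<exists>C a. C > 0 \<and> (\<forall>i. vector_space.dim (op_scale sc) (F i) \<le>
    vector_space.dim (act_scale sc act) (G (C * i + a)) * vector_space.dim (act_scale sc act) (G ((C + 1) * i + a)))"
proof -
  interpret k: vector_space sc by fact
  interpret op: vector_space "op_scale sc" by (rule vector_space_op_scale) fact
  interpret M: vector_space "act_scale sc act" by fact
  obtain C where C: "C > 0" "\<And>i \<delta>. \<delta> \<in> F i \<Longrightarrow> \<delta> \<noteq> 0 \<Longrightarrow>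
      id \<in> op.span {\<alpha> \<circ> \<delta> \<circ> \<beta> | \<alpha> \<beta>. \<alpha> \<in> F (C * i) \<and> \<beta> \<in> F (C * i)}"
    using simple unfolding linearly_simple_def by blast
  obtain a where a: "m \<in> G a" using compatible_filtrationD(3)[OF G] by blast
  have subF: "op.subspace (F i)" for i
    using fin_dim_subspace_subspace[OF op.vector_space_axioms alg_filtrationD(1)[OF F]] .
  have act_add: "act \<alpha> (x + y) = act \<alpha> x + act \<alpha> y" if "\<alpha> \<in> A" for \<alpha> x y
    using mod that by (simp add: left_module_def)
  have act_zero: "act \<alpha> 0 = 0" if "\<alpha> \<in> A" for \<alpha>
    using act_add[OF that, of 0 0] by simp
  have act_plus: "act (\<alpha> + \<beta>) x = act \<alpha> x + act \<beta> x" if "\<alpha> \<in> A" "\<beta> \<in> A" for \<alpha> \<beta> x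
    using mod that unfolding left_module_def by blast
  have act_comp: "act (\<alpha> \<circ> \<beta>) x = act \<alpha> (act \<beta> x)" if "\<alpha> \<in> A" "\<beta> \<in> A" for \<alpha> \<beta> x
    using mod that unfolding left_module_def by blast
  have scA: "sc c \<in> A" for c using alg_filtrationD(4,7)[OF F] by (metis rangeI)
  have act_sc: "act (op_scale sc c \<alpha>) x = act_scale sc act c (act \<alpha> x)" if "\<alpha> \<in> A" for c \<alpha> x
  proof -
    have "op_scale sc c \<alpha> = sc c \<circ> \<alpha>" by (auto simp: op_scale_def)
    then show ?thesis using act_comp[OF scA that] by (simp add: act_scale_def)
  qed
  have faithful: "\<delta> = 0" if \<delta>: "\<delta> \<in> F i" and kill: "\<And>x. x \<in> G (C * i + a) \<Longrightarrow> act \<delta> x = 0" for i \<delta>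
  proof (rule ccontr)
    assume "\<delta> \<noteq> 0"
    have "\<theta> \<in> F (C * i + i + C * i) \<and> act \<theta> m = 0"
      if "\<theta> \<in> op.span {\<alpha> \<circ> \<delta> \<circ> \<beta> | \<alpha> \<beta>. \<alpha> \<in> F (C * i) \<and> \<beta> \<in> F (C * i)}" for \<theta>
      using that
    proof (induction rule: op.span_induct_alt)
      case base
      have "act 0 m = act (op_scale sc 0 (sc 0)) m" by (simp only: op.scale_zero_left)
      also have "\<dots> = 0" by (simp only: act_sc[OF scA] M.scale_zero_left)
      finally show ?case using op.subspace_0[OF subF] by blast
    next
      case (step c x y)
      then obtain \<alpha> \<beta> where \<alpha>: "\<alpha> \<in> F (C * i)" and \<beta>: "\<beta> \<in> F (C * i)" and x: "x = \<alpha> \<circ> \<delta> \<circ> \<beta>" by blast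
      note inA = alg_filtrationD(7)[OF F]
      have \<alpha>\<delta>: "\<alpha> \<circ> \<delta> \<in> F (C * i + i)" by (rule alg_filtrationD(5)[OF F \<alpha> \<delta>])
      have xF: "x \<in> F (C * i + i + C * i)" unfolding x by (rule alg_filtrationD(5)[OF F \<alpha>\<delta> \<beta>])
      have "act x m = act \<alpha> (act \<delta> (act \<beta> m))"
        unfolding x act_comp[OF inA[OF \<alpha>\<delta>] inA[OF \<beta>]] act_comp[OF inA[OF \<alpha>] inA[OF \<delta>]] ..
      then have "act x m = 0"
        using kill[OF compatible_filtrationD(4)[OF G \<beta> a]] act_zero[OF inA[OF \<alpha>]] by simp
      moreover have "act (op_scale sc c x + y) m = act_scale sc act c (act x m) + act y m"
        using act_plus[OF inA[OF op.subspace_scale[OF subF xF]] inA[OF conjunct1[OF step(2)]]] act_sc[OF inA[OF xF]]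
        by simp
      ultimately have "act (op_scale sc c x + y) m = 0" using step(2) by simp
      then show ?case using op.subspace_add[OF subF op.subspace_scale[OF subF xF]] step(2) by blast
    qed
    from this[OF C(2)[OF \<delta> \<open>\<delta> \<noteq> 0\<close>]] have "act id m = 0" by blast
    then show False using mod m by (simp add: left_module_def)
  qed
  have "op.dim (F i) \<le> M.dim (G (C * i + a)) * M.dim (G ((C + 1) * i + a))" for i
  proof -
    obtain E where E: "finite E" "op.independent E" "F i = op.span E" "card E = op.dim (F i)"
      using fin_dim_subspace_basis[OF op.vector_space_axioms alg_filtrationD(1)[OF F]] by metis
    obtain P where P: "finite P" "P \<subseteq> G (C * i + a)" "G (C * i + a) = M.span P" "card P = M.dim (G (C * i + a))"
      using fin_dim_subspace_basis[OF vm compatible_filtrationD(1)[OF G]] by metis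
    obtain Q where Q: "finite Q" "M.independent Q" "G ((C + 1) * i + a) = M.span Q"
      "card Q = M.dim (G ((C + 1) * i + a))"
      using fin_dim_subspace_basis[OF vm compatible_filtrationD(1)[OF G]] by metis
    define fsc where "fsc = (\<lambda>c (h :: 'm \<times> 'm \<Rightarrow> 'k) x. c * h x)"
    interpret fn: vector_space fsc
      by unfold_locales (auto simp: fsc_def fun_eq_iff algebra_simps)
    interpret vp: vector_space_pair "op_scale sc" fsc ..
    define mat where "mat \<delta> = (\<lambda>(p, q). if p \<in> P then M.representation Q (act \<delta> p) q else 0)" for \<delta>
    have mem: "act \<delta> p \<in> M.span Q" if "\<delta> \<in> F i" "p \<in> P" for \<delta> p
      using compatible_filtrationD(4)[OF G that(1), of p "C * i + a"] P(2) that(2)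
      unfolding Q(3)[symmetric] by (auto simp: add_ac)
    have mat_comb: "mat (op_scale sc c x + y) = fsc c (mat x) + mat y" if "x \<in> F i" "y \<in> F i" for c x y
    proof
      fix pq :: "'m \<times> 'm"
      obtain p q where pq: "pq = (p, q)" by (cases pq)
      note inA = alg_filtrationD(7)[OF F]
      have "act (op_scale sc c x + y) p = act_scale sc act c (act x p) + act y p"
        using act_plus[OF inA[OF op.subspace_scale[OF subF that(1)]] inA[OF that(2)]] act_sc[OF inA[OF that(1)]]
        by simp
      then show "mat (op_scale sc c x + y) pq = (fsc c (mat x) + mat y) pq"
        using mem[OF that(1)] mem[OF that(2)]
        by (simp add: mat_def pq fsc_def M.representation_add[OF Q(2)] M.representation_scale[OF Q(2)] M.span_scale)
    qed
    \<comment> \<open>The action is additive in the operator only on \<open>A\<close>, so \<open>mat\<close> is replaced by a map that is linear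
      on all operators and agrees with it on \<open>F i\<close>.\<close>
    obtain h where h: "Vector_Spaces.linear (op_scale sc) fsc h" "\<forall>e\<in>E. h e = mat e"
      using vp.linear_independent_extend[OF E(2)] by blast
    have h_mat: "h \<delta> = mat \<delta>" if "\<delta> \<in> F i" for \<delta>
    proof -
      have "\<delta> \<in> F i \<and> h \<delta> = mat \<delta>" if "\<delta> \<in> op.span E" for \<delta>
        using that
      proof (induction rule: op.span_induct_alt)
        case base
        have z: "0 \<in> F i" by (rule op.subspace_0[OF subF])
        have "mat (op_scale sc (-1) 0 + 0) = fsc (-1) (mat 0) + mat 0" by (rule mat_comb[OF z z])
        then have "mat 0 = fsc (-1) (mat 0) + mat 0" by (simp only: op.scale_zero_right add_0)
        then have "mat 0 = 0" by (auto simp: fsc_def fun_eq_iff)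
        then show ?case using z linear_simps(3)[OF h(1)] by metis
      next
        case (step c x y)
        have x: "x \<in> F i" unfolding E(3) using step(1) by (rule op.span_base)
        then have "op_scale sc c x + y \<in> F i"
          using step(2) op.subspace_add[OF subF op.subspace_scale[OF subF]] by blast
        moreover have "h (op_scale sc c x + y) = mat (op_scale sc c x + y)"
          unfolding linear_simps[OF h(1)] using mat_comb[OF x] h(2) step by metis
        ultimately show ?case by blast
      qed
      then show ?thesis using that unfolding E(3) by blast
    qed
    have inj: "inj_on h (op.span E)"
    proof (rule inj_onI)
      fix x y assume xy: "x \<in> op.span E" "y \<in> op.span E" "h x = h y"
      have "x - y \<in> F i" unfolding E(3) using xy(1,2) by (rule op.span_diff)
      then have m0: "mat (x - y) = 0" using h_mat linear_simps(2)[OF h(1)] xy(3) by force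
      have zero: "act (x - y) p = 0" if "p \<in> P" for p
      proof -
        have "M.representation Q (act (x - y) p) q = 0" for q
          using fun_cong[OF m0, of "(p, q)"] that by (simp add: mat_def)
        then show ?thesis
          using M.sum_nonzero_representation_eq[OF Q(2) mem[OF \<open>x - y \<in> F i\<close> that]] by simp
      qed
      have A: "x - y \<in> A" using alg_filtrationD(7)[OF F \<open>x - y \<in> F i\<close>] .
      have "x - y = 0"
      proof (rule faithful[OF \<open>x - y \<in> F i\<close>])
        fix z assume "z \<in> G (C * i + a)"
        then have "z \<in> M.span P" by (simp only: P(3))
        then show "act (x - y) z = 0"
        proof (induction rule: M.span_induct_alt)
          case base
          show ?case by (rule act_zero[OF A])
        next
          case (step c p w)
          have "(x - y) \<circ> sc c = sc c \<circ> (x - y)"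
            using linear_simps(4)[OF lin[OF A]] by (auto simp: fun_eq_iff)
          then have "act (x - y) (act_scale sc act c p) = act_scale sc act c (act (x - y) p)"
            unfolding act_scale_def using act_comp[OF A scA] act_comp[OF scA A] by metis
          then show ?case
            unfolding act_add[OF A] using step zero[OF step(1)] by (simp only: M.scale_zero_right add_0)
        qed
      qed
      then show "x = y" by simp
    qed
    let ?I = "(\<lambda>pq x. if x = pq then 1 else 0 :: 'k) ` (P \<times> Q)"
    have fin: "finite ?I" using P(1) Q(1) by simp
    have "h ` E \<subseteq> fn.span ?I"
    proof
      fix w assume "w \<in> h ` E"
      then obtain e where e: "e \<in> E" "w = mat e" using h(2) by auto
      have "w x = 0" if "x \<notin> P \<times> Q" for x
        using that M.representation_ne_zero by (cases x) (auto simp: e mat_def)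
      then have "w = (\<Sum>pq\<in>P \<times> Q. fsc (w pq) (\<lambda>x. if x = pq then 1 else 0))"
        using P(1) Q(1) by (auto simp: fun_eq_iff sum_fun_apply fsc_def if_distrib cong: if_cong)
      also have "\<dots> \<in> fn.span ?I"
        by (intro fn.span_sum fn.span_scale fn.span_base) auto
      finally show "w \<in> fn.span ?I" .
    qed
    moreover have "fn.independent (h ` E)"
      by (rule vp.linear_independent_injective_image[OF h(1) E(2) inj])
    ultimately have "card (h ` E) \<le> card ?I"
      using fn.independent_span_bound[OF fin] by blast
    also have "\<dots> \<le> card (P \<times> Q)" using P(1) Q(1) by (intro card_image_le) simp
    finally have "card E \<le> card P * card Q"
      using card_image[OF inj_on_subset[OF inj op.span_superset]] by (simp add: card_cartesian_product)
    then show ?thesis by (simp only: E(4) P(4) Q(4))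
  qed
  then show ?thesis using C(1) by blast
qed

section \<open>Growth of filtrations\<close>

lemma filt_Dim_nonneg: "0 \<le> filt_Dim sc G"
  unfolding filt_Dim_def by (rule Inf_greatest) auto

lemma filt_Dim_le:
  assumes "t \<ge> 0" "\<And>i. i \<ge> N \<Longrightarrow> real (vector_space.dim sc (G i)) \<le> C * real i powr t"
  shows "filt_Dim sc G \<le> ereal t"
  unfolding filt_Dim_def
proof (rule Inf_lower)
  have "\<forall>\<^sub>F i in sequentially. real (vector_space.dim sc (G i)) \<le> C * real i powr t"
    by (rule eventually_sequentiallyI[of N]) (rule assms(2))
  then show "ereal t \<in> {ereal t | t. t \<ge> 0 \<and>
      (\<exists>C. \<forall>\<^sub>F i in sequentially. real (vector_space.dim sc (G i)) \<le> C * real i powr t)}"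
    using assms(1) by blast
qed

text \<open>
  If \<open>dim G i\<close> grows at most like \<open>i\<^sup>t\<close>, the product bound makes \<open>dim F i\<close> grow at most like \<open>i\<^sup>2\<^sup>t\<close>.
\<close>

lemma filt_Dim_half_le:
  assumes C: "C > 0" and bound: "\<And>i. vector_space.dim scF (F i) \<le>
    vector_space.dim scG (G (C * i + a)) * vector_space.dim scG (G ((C + 1) * i + a))"
  shows "filt_Dim scF F / 2 \<le> filt_Dim scG G"
  unfolding filt_Dim_def[of scG G]
proof (rule Inf_greatest, safe)
  fix t c assume t: "t \<ge> 0"
    and "\<forall>\<^sub>F i in sequentially. real (vector_space.dim scG (G i)) \<le> c * real i powr t"
  then obtain N where N: "\<And>i. i \<ge> N \<Longrightarrow> real (vector_space.dim scG (G i)) \<le> c * real i powr t"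
    by (auto simp: eventually_sequentially)
  \<comment> \<open>For \<open>i \<ge> 1\<close>, both indices in the bound are at most \<open>(C + 1 + a) i\<close>.\<close>
  let ?K = "real (C + 1 + a)"
  have G: "real (vector_space.dim scG (G k)) \<le> \<bar>c\<bar> * (?K powr t * real i powr t)"
    if "k \<ge> N" "k \<le> (C + 1) * i + a" "i \<ge> 1" for k i
  proof -
    have "a \<le> a * i" using that(3) by simp
    then have "k \<le> (C + 1) * i + a * i" using that(2) by linarith
    then have "k \<le> (C + 1 + a) * i" by (simp only: add_mult_distrib)
    then have "real k \<le> ?K * real i" by (metis of_nat_le_iff of_nat_mult)
    then have "real k powr t \<le> (?K * real i) powr t" using t by (intro powr_mono2) auto
    also have "\<dots> = ?K powr t * real i powr t" by (simp add: powr_mult)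
    finally have "\<bar>c\<bar> * real k powr t \<le> \<bar>c\<bar> * (?K powr t * real i powr t)" by (intro mult_left_mono) auto
    moreover have "c * real k powr t \<le> \<bar>c\<bar> * real k powr t" by (intro mult_right_mono) auto
    ultimately show ?thesis using N[OF that(1)] by linarith
  qed
  have "filt_Dim scF F \<le> ereal (2 * t)"
  proof (rule filt_Dim_le)
    fix i assume i: "i \<ge> max N 1"
    have "i \<le> C * i" using C by simp
    moreover have "(C + 1) * i = C * i + i" by simp
    ultimately have "N \<le> C * i + a" "N \<le> (C + 1) * i + a" using i by linarith+
    then have "real (vector_space.dim scG (G (C * i + a))) * real (vector_space.dim scG (G ((C + 1) * i + a)))
        \<le> (\<bar>c\<bar> * (?K powr t * real i powr t)) * (\<bar>c\<bar> * (?K powr t * real i powr t))"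
      using i by (intro mult_mono G) auto
    also have "\<dots> = (\<bar>c\<bar> * ?K powr t) ^ 2 * real i powr (2 * t)"
      by (simp add: power2_eq_square powr_add[symmetric] mult_ac)
    finally have "real (vector_space.dim scG (G (C * i + a)) * vector_space.dim scG (G ((C + 1) * i + a)))
        \<le> (\<bar>c\<bar> * ?K powr t) ^ 2 * real i powr (2 * t)" by simp
    then show "real (vector_space.dim scF (F i)) \<le> (\<bar>c\<bar> * ?K powr t) ^ 2 * real i powr (2 * t)"
      using bound[of i] by (meson of_nat_le_iff order_trans)
  qed (use t in simp)
  then have "filt_Dim scF F / 2 \<le> ereal (2 * t) / 2" by (rule ereal_divide_right_mono) simp
  then show "filt_Dim scF F / 2 \<le> ereal t" by simp
qed

lemma filt_mult_bound:
  assumes "filt_Dim sc G = ereal t" "filt_mult sc G < \<infinity>"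
  shows "\<exists>c N. \<forall>i\<ge>N. real (vector_space.dim sc (G i)) \<le> c * real i powr t"
proof -
  obtain c where c: "filt_mult sc G < ereal c" using assms(2) by (metis ereal_dense2 less_PInf_Ex_of_nat)
  then have "\<forall>\<^sub>F i in sequentially. ereal (real (vector_space.dim sc (G i)) / real i powr t) < ereal c"
    unfolding filt_mult_def assms(1) real_of_ereal.simps by (rule Limsup_lessD)
  then obtain N where N: "\<And>i. i \<ge> N \<Longrightarrow> real (vector_space.dim sc (G i)) / real i powr t < c"
    by (auto simp: eventually_sequentially)
  have "real (vector_space.dim sc (G i)) \<le> c * real i powr t" if "i \<ge> max N 1" for i
    using N[of i] that by (simp add: pos_divide_less_eq)
  then show ?thesis by blast
qed

lemma filt_mult_finite:
  assumes "filt_Dim sc G = ereal t" "\<And>i. i \<ge> N \<Longrightarrow> real (vector_space.dim sc (G i)) \<le> c * real i powr t"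
  shows "filt_mult sc G < \<infinity>"
proof -
  have "real (vector_space.dim sc (G i)) / real i powr t \<le> c" if "i \<ge> max N 1" for i
    using assms(2)[of i] that by (simp add: pos_divide_le_eq)
  then have "\<forall>\<^sub>F i in sequentially. ereal (real (vector_space.dim sc (G i)) / real i powr t) \<le> ereal c"
    by (intro eventually_sequentiallyI[of "max N 1"]) simp
  then have "filt_mult sc G \<le> ereal c"
    unfolding filt_mult_def assms(1) real_of_ereal.simps by (rule Limsup_bounded)
  then show ?thesis by (rule le_less_trans) simp
qed

section \<open>Holonomicity of \<open>R_f(s) f^s\<close>\<close>

theorem theorem4p11:
  fixes sc :: "'k::field_char_0 \<Rightarrow> 'r::comm_ring_1 \<Rightarrow> 'r"
    and f :: 'r
    and F :: "nat \<Rightarrow> ('r \<Rightarrow> 'r) set"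
    and \<iota> :: "'r \<Rightarrow> 'q::{comm_ring,comm_monoid_mult}"
    and \<tau> :: "'r \<Rightarrow> 'k poly fract \<Rightarrow> 'rs::comm_ring_1"
    and \<tau>\<^sub>f :: "'q \<Rightarrow> 'k poly fract \<Rightarrow> 'qs::{comm_ring,comm_monoid_mult}"
  assumes "comm_algebra sc"
    and "f \<noteq> 0"
    and "is_localization f \<iota>"
    and "is_tensor_algebra sc ratfun_scale \<tau>"
    and "is_tensor_algebra (\<lambda>a x. \<iota> (sc a 1) * x) ratfun_scale \<tau>\<^sub>f"
    and "alg_filtration sc (diff_ops sc) F"
    and "linearly_dominated sc F"
    and "linearly_simple sc F"
    and "filt_Dim (op_scale sc) F < \<infinity>"
    and "0 < filt_mult (op_scale sc) F"
    and "filt_mult (op_scale sc) F < \<infinity>"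
    and "holonomic sc (diff_ops sc) F (\<lambda>\<delta> m. \<delta> m)"
  shows "holonomic (tensor_scale \<tau>) (diff_ops (tensor_scale \<tau>)) (extended_filtration \<tau> F)
           (fs_act f \<iota> \<tau> \<tau>\<^sub>f)"
proof -
  interpret fs_module sc f \<iota> \<tau> \<tau>\<^sub>f
    by unfold_locales
      (use assms(1,3-5) comm_algebra_ratfun_scale comm_algebra_localization[OF assms(1,3)] in blast)+
  note F = assms(6)
  let ?F = "extended_filtration \<tau> F"
  let ?sc = "tensor_scale \<tau>"
  note F' = R.alg_filtration_ext[OF F]
  note simple' = R.linearly_simple_ext[OF F assms(8)]
  have dims: "vector_space.dim (op_scale ?sc) (?F i) = vector_space.dim (op_scale sc) (F i)" for i
    by (rule R.dim_extended_filtration[OF F])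
  have Dim: "filt_Dim (op_scale ?sc) ?F = filt_Dim (op_scale sc) F"
    unfolding filt_Dim_def dims ..
  have mult: "filt_mult (op_scale ?sc) ?F = filt_mult (op_scale sc) F"
    unfolding filt_mult_def Dim dims ..
  have "\<exists>G'. compatible_filtration ?sc ?F act G' \<and>
      filt_Dim (act_scale ?sc act) G' = filt_Dim (op_scale ?sc) ?F / 2 \<and>
      filt_mult (act_scale ?sc act) G' < \<infinity>" if "(UNIV :: 'qs set) \<noteq> {0}"
  proof -
    have "\<exists>m :: 'qs. m \<noteq> 0"
    proof (rule ccontr)
      assume "\<nexists>m :: 'qs. m \<noteq> 0"
      then have "(UNIV :: 'qs set) = {0}" by auto
      then show False using that by contradiction
    qed
    then obtain m :: 'qs where m: "m \<noteq> 0" by blast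
    have "(UNIV :: 'r set) \<noteq> {0}" using zero_neq_one by (metis UNIV_I singletonD)
    then obtain G where G: "compatible_filtration sc F (\<lambda>\<delta> m. \<delta> m) G"
      "filt_Dim sc G = filt_Dim (op_scale sc) F / 2" "filt_mult sc G < \<infinity>"
      using assms(12) unfolding holonomic_def act_scale_id by blast
    obtain d where d: "filt_Dim (op_scale sc) F = ereal d" "d \<ge> 0"
      using assms(9) filt_Dim_nonneg[of "op_scale sc" F] by (cases "filt_Dim (op_scale sc) F") auto
    have DimG: "filt_Dim sc G = ereal (d / 2)" by (simp add: G(2) d(1))
    obtain c N where N: "\<And>i. i \<ge> N \<Longrightarrow> real (R.k.dim (G i)) \<le> c * real i powr (d / 2)"
      using filt_mult_bound[OF DimG G(3)] by blast
    obtain C where C: "C > 0" "\<And>i. F i \<subseteq> diff_ops_le sc (C * i)"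
      using assms(7) by (auto simp: linearly_dominated_def)
    have "(\<lambda>x. f * x) \<in> diff_ops sc" by (rule R.k.mult_in_diff_ops)
    then obtain a where a: "(\<lambda>x. f * x) \<in> F a" using alg_filtrationD(3)[OF F] by blast
    let ?G = "fs_filtration G C a"
    have G': "compatible_filtration ?sc ?F act ?G"
      by (rule compatible_fs_filtration[OF F G(1) C a])
    have bound: "real (Rf.l.dim (?G i)) \<le> (c * real (1 + a * C) powr (d / 2)) * real i powr (d / 2)"
      if "i \<ge> N" for i
    proof -
      have "N \<le> (1 + a * C) * i" using that by simp
      have "real (Rf.l.dim (?G i)) \<le> real (R.k.dim (G ((1 + a * C) * i)))"
        using dim_fs_filtration[OF F G(1) C a, of i] by simp
      also have "\<dots> \<le> c * real ((1 + a * C) * i) powr (d / 2)" by (rule N) fact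
      also have "\<dots> = (c * real (1 + a * C) powr (d / 2)) * real i powr (d / 2)"
        unfolding of_nat_mult by (subst powr_mult) (simp_all only: mult.assoc of_nat_0_le_iff)
      finally show ?thesis .
    qed
    have "filt_Dim (tensor_scale \<tau>\<^sub>f) ?G \<le> ereal (d / 2)"
      by (rule filt_Dim_le[of _ N]) (use d(2) bound in auto)
    moreover have "ereal (d / 2) \<le> filt_Dim (tensor_scale \<tau>\<^sub>f) ?G"
    proof -
      have vm: "vector_space (act_scale ?sc act)" unfolding act_scale_eq by (rule Rf.l.vector_space_axioms)
      obtain C' a' where "C' > 0" "\<And>i. vector_space.dim (op_scale ?sc) (?F i) \<le>
          vector_space.dim (act_scale ?sc act) (?G (C' * i + a'))
            * vector_space.dim (act_scale ?sc act) (?G ((C' + 1) * i + a'))"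
        using dim_product_bound[OF R.l.vector_space_axioms vm R.l.diff_ops_linear F' simple'
            left_module_act[OF F'] G' m] by blast
      then have "filt_Dim (op_scale ?sc) ?F / 2 \<le> filt_Dim (act_scale ?sc act) ?G"
        by (rule filt_Dim_half_le)
      then show ?thesis unfolding act_scale_eq Dim d(1) by simp
    qed
    ultimately have DimG': "filt_Dim (tensor_scale \<tau>\<^sub>f) ?G = ereal (d / 2)" by (rule antisym)
    show ?thesis
      unfolding act_scale_eq Dim
      using G' DimG' filt_mult_finite[OF DimG' bound] by (intro exI[of _ ?G]) (simp add: d(1))
  qed
  then show ?thesis
    unfolding holonomic_def mult
    using F' simple' assms(9-11) left_module_act[OF F'] unfolding Dim by blast
qed

end
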